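(* Under the standing assumptions (i)–(v) listed in the context, the non-autonomous port-Hamiltonian system $$\frac{\partial x}{\partial t}(t,\zeta)=\Big(P_1\frac{\partial}{\partial\zeta}+P_0\Big)(\mathcal{H}(t,\zeta)x(t,\zeta))+K(t,\zeta)x(t,\zeta),\quad \zeta\in[a,b],\ t\ge 0,$$ $$\tilde W_B\begin{bmatrix}(\mathcal{H}x)(t,b)\\(\mathcal{H}x)(t,a)\end{bmatrix}=0,\quad t\ge 0,\qquad x(0,\cdot)=x_0,$$ is $C^1$-well posed with regularity spaces $$Y_t=\Big\{x\in L^2(a,b;\mathbb{K}^n)\ \Big|\ \mathcal{H}(t,\cdot)x\in H^1(a,b;\mathbb{K}^n),\ \tilde W_B\begin{bmatrix}(\mathcal{H}(t,\cdot)x)(b)\\(\mathcal{H}(t,\cdot)x)(a)\end{bmatrix}=0\Big\},\quad t\ge 0.$$ Moreover, for each compact interval $[0,T]$ and every classical solution $x$ of the system, $$\|x(t)\|_t^2\le e^{c_T(t-s)}\|x(s)\|_s^2\qquad(0\le s\le t\le T)$$ for some constant $c_T\ge 0$ that depends only on $m$, $\max_{t\in[0,T]}\|\dot{\mathcal{H}}(t,\cdot)\|$ and $\max_{t\in[0,T]}\|K(t)\|$. If, additionally, $$\mathcal{H}(t,\zeta)K(t,\zeta)+K^*(t,\zeta)\mathcal{H}(t,\zeta)+\frac{\partial}{\partial t}\mathcal{H}(t,\zeta)\le 0\quad\text{for every }t\ge 0\text{ and a.e. }\zeta\in[a,b],$$ then $$\|x(t)\|_t\le\|x(s)\|_s\qquad\text{for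 }0\le s\le t$$ holds for every classical solution $x$ of the system.
   Context: Setting: $\mathbb{K}\in\{\mathbb{R},\mathbb{C}\}$, $n\in\mathbb{N}$, $a<b$, $X=L^2(a,b;\mathbb{K}^n)$ with its standard inner product $(\cdot\mid\cdot)$ and norm $\|\cdot\|$; $P_0,P_1\in\mathbb{K}^{n\times n}$, $\tilde W_B\in\mathbb{K}^{n\times 2n}$; $\mathcal{H}(t,\zeta),K(t,\zeta)\in\mathbb{K}^{n\times n}$ for $t\ge 0$, $\zeta\in[a,b]$. Functions in $L^\infty(a,b;\mathbb{K}^{n\times n})$ are identified with the corresponding multiplication operators on $X$. Put $$W_B:=\tilde W_B\begin{bmatrix} P_1 & -P_1 \\ I & I \end{bmatrix}^{-1},\qquad \Sigma:=\begin{bmatrix} 0 & I \\ I & 0 \end{bmatrix}.$$ Standing assumptions: (i) $\operatorname{Re}P_0:=\frac{P_0+P_0^*}{2}\le 0$ is negative semi-definite; (ii) $P_1$ is invertible and self-adjoint; (iii) $W_B\Sigma W_B^*\ge 0$ and $\operatorname{rank}\tilde W_B=n$; (iv) $\mathcal{H}\in C^2([0,\infty);L^\infty(a,b;\mathbb{K}^{n\times n}))$ and there exist constants $m,M>0$ with $m\le\mathcal{H}(t,\xi)=\mathcal{H}^*(t,\xi)\le M$ for a.e. $\xi\in[a,b]$ and all $t\ge 0$; (v) $K\in C^1([0,\infty);L^\infty(a,b;\mathbb{K}^{n\times n}))$. Let $Ax=P_1\frac{\partial}{\partial\zeta}x+P_0x$ with $D(A)=\{x\in H^1(a,b;\mathbb{K}^n)\mid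 \tilde W_B\binom{x(b)}{x(a)}=0\}$, and $D(A\mathcal{H}(t))=\{x\in X\mid\mathcal{H}(t,\cdot)x\in D(A)\}$. Energy norms: $\|x\|_t^2:=\int_a^b(x(\zeta)\mid\mathcal{H}(t,\zeta)x(\zeta))\,\mathrm{d}\zeta$. The system is understood as the abstract Cauchy problem $\dot x(t)=A(t)x(t)$ in $X$ with $A(t)=A\mathcal{H}(t,\cdot)+K(t,\cdot)$, $D(A(t))=D(A\mathcal{H}(t))$, and arbitrary initial time $s\ge 0$, $x(s)=x_s$. A continuous function $u:[s,\infty)\to X$ is a classical solution of $\dot u(t)-A(t)u(t)=0$ a.e. on $[s,\infty)$, $u(s)=x_s$, if $u(t)\in D(A(t))$ for all $t\ge s$, $u\in C^1((s,\infty),X)$ and $u$ satisfies the Cauchy problem (so that in particular $A(\cdot)u\in C((s,\infty),X)$). The problem is $C^1$-well posed with regularity spaces $\{Y_t\}_{t\ge 0}$ if the $Y_t$ are dense subspaces of $X$ with: $Y_t\subseteq D(A(t))$ for all $t\ge 0$; for each $s\ge 0$, $x_s\in Y_s$ there is a unique classical solution $u(\cdot,s,x_s)$, and $u(t,s,x_s)\in Y_t$ for all $t\ge s$; and the solutions depend continuously on the initial data $s,x_s$, i.e. if $s_k\to s$ and $x_k\in Y_{s_k}$, $x_k\to x\in Y_s$, then $\tilde u(t,s_k,x_k)\to\tilde u(t,s,x)$ uniformly for $t$ in compact subsets of $[0,\infty)$, where $\tilde u(t,s,x)=u(t,s,x)$ for $t\ge s$ and $\tilde u(t,s,x)=x$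 for $t<s$.
   Formalization: The constant c_T may also depend on the upper bound M of H in (iv); independence of M fails, e.g. for H = diag(1,M), K = [[0,0],[1,0]], P_1 = I, P_0 = 0 with periodic boundary conditions, where x = (1,t) has squared energy 1+Mt² on an interval of length 1. *)

theory Defs
  imports "HOL-Analysis.Analysis" "HOL-Probability.Essential_Supremum"
begin

section \<open>The scalar field\<close>

text \<open>
  By the Frobenius theorem the only finite-dimensional real normed fields are, up to isomorphism,
  the reals and the complex numbers; \<open>z * cconj z = \<bar>z\<bar>\<^sup>2\<close> determines the conjugation.
\<close>

class real_or_complex = real_normed_field + euclidean_space +
  fixes cconj :: "'a \<Rightarrow> 'a"
  assumes cconj_add: "cconj (x + y) = cconj x + cconj y"
    and cconj_mult: "cconj (x * y) = cconj x * cconj y"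
    and mult_cconj_scaleR: "x * cconj x = (norm x)\<^sup>2 *\<^sub>R 1"

instantiation real :: real_or_complex
begin
definition cconj_real :: "real \<Rightarrow> real" where "cconj_real x = x"
instance
  by standard (auto simp: cconj_real_def power2_eq_square)
end

instantiation complex :: real_or_complex
begin
definition cconj_complex :: "complex \<Rightarrow> complex" where "cconj_complex = cnj"
instance
  by standard (simp_all add: cconj_complex_def complex_mult_cnj cmod_power2 scaleR_conv_of_real)
end


section \<open>Matrices\<close>

definition ctranspose :: "'k::real_or_complex^'n^'m \<Rightarrow> 'k^'m^'n" where
  "ctranspose A = (\<chi> i j. cconj (A $ j $ i))"

text \<open>
  The library inner product on \<open>'k^'n\<close> is real-valued: it is the real part of
  \<open>(x | y) = (\<Sum>i. x $ i * cconj (y $ i))\<close>. For Hermitian \<open>A\<close> the number \<open>(x | A x)\<close> is real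
  and so equals \<open>x \<bullet> (A *v x)\<close>; see \<open>inner_hermitian\<close> below.
\<close>

definition pos_semidef :: "'k::real_or_complex^'n^'n \<Rightarrow> bool" where
  "pos_semidef A \<longleftrightarrow> ctranspose A = A \<and> (\<forall>x. 0 \<le> x \<bullet> (A *v x))"

definition loewner_le :: "'k::real_or_complex^'n^'n \<Rightarrow> 'k^'n^'n \<Rightarrow> bool" where
  "loewner_le A B \<longleftrightarrow> pos_semidef (B - A)"

definition stack :: "'k^'n \<Rightarrow> 'k^'n \<Rightarrow> 'k^('n + 'n)" where
  "stack u v = (\<chi> i. case i of Inl p \<Rightarrow> u $ p | Inr p \<Rightarrow> v $ p)"

definition block :: "'k^'n^'n \<Rightarrow> 'k^'n^'n \<Rightarrow> 'k^'n^'n \<Rightarrow> 'k^'n^'n \<Rightarrow> 'k^('n + 'n)^('n + 'n)" where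
  "block A B C D = (\<chi> i. case i of
      Inl p \<Rightarrow> stack (A $ p) (B $ p)
    | Inr p \<Rightarrow> stack (C $ p) (D $ p))"

definition W_B :: "'k::real_or_complex^'n^'n \<Rightarrow> 'k^('n + 'n)^'n \<Rightarrow> 'k^('n + 'n)^'n" where
  "W_B P1 W = W ** matrix_inv (block P1 (- P1) (mat 1) (mat 1))"

definition Sigma_mat :: "'k::real_or_complex^('n::finite + 'n)^('n + 'n)" where
  "Sigma_mat = block 0 (mat 1) (mat 1) 0"


section \<open>Function spaces\<close>

text \<open>
  Elements of \<open>L\<^sup>2\<close> and \<open>L\<^sup>\<infinity>\<close> are represented by functions on the real line; only the values on
  \<open>[a,b]\<close> matter, and equality of elements is equality a.e. on \<open>[a,b]\<close>.
\<close>

definition eq_ae :: "real \<Rightarrow> real \<Rightarrow> (real \<Rightarrow> 'v) \<Rightarrow> (real \<Rightarrow> 'v) \<Rightarrow> bool" where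
  "eq_ae a b x y \<longleftrightarrow> (AE \<zeta> in lebesgue_on {a..b}. x \<zeta> = y \<zeta>)"

definition L2 :: "real \<Rightarrow> real \<Rightarrow> (real \<Rightarrow> 'k::real_or_complex^'n) set" where
  "L2 a b = {x. x \<in> borel_measurable (lebesgue_on {a..b}) \<and>
                integrable (lebesgue_on {a..b}) (\<lambda>\<zeta>. (norm (x \<zeta>))\<^sup>2)}"

definition L2_norm :: "real \<Rightarrow> real \<Rightarrow> (real \<Rightarrow> 'k::real_or_complex^'n) \<Rightarrow> real" where
  "L2_norm a b x = sqrt (LINT \<zeta>|lebesgue_on {a..b}. (norm (x \<zeta>))\<^sup>2)"

text \<open>
  Matrix values are measured in the operator norm (\<open>norm\<close> on \<open>'k^'n^'n\<close> is the Frobenius norm), so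
  that the \<open>L\<^sup>\<infinity>\<close> norm is the norm of the multiplication operator on \<open>L\<^sup>2\<close>.
\<close>

definition Linf_enorm :: "real \<Rightarrow> real \<Rightarrow> (real \<Rightarrow> 'k::real_or_complex^'n^'n) \<Rightarrow> ereal" where
  "Linf_enorm a b F = esssup (lebesgue_on {a..b}) (\<lambda>\<zeta>. ereal (onorm ((*v) (F \<zeta>))))"

definition Linf :: "real \<Rightarrow> real \<Rightarrow> (real \<Rightarrow> 'k::real_or_complex^'n^'n) set" where
  "Linf a b = {F. F \<in> borel_measurable (lebesgue_on {a..b}) \<and> Linf_enorm a b F < \<infinity>}"

definition Linf_norm :: "real \<Rightarrow> real \<Rightarrow> (real \<Rightarrow> 'k::real_or_complex^'n^'n) \<Rightarrow> real" where
  "Linf_norm a b F = real_of_ereal (Linf_enorm a b F)"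

text \<open>
  Continuity and differentiability of maps from \<open>S \<subseteq> \<real>\<close> into a function space \<open>V\<close> with norm \<open>N\<close>;
  at a boundary point of \<open>S\<close> these are one-sided.
\<close>

definition continuous_into ::
  "(real \<Rightarrow> 'v::real_normed_vector) set \<Rightarrow> ((real \<Rightarrow> 'v) \<Rightarrow> real) \<Rightarrow> real set
    \<Rightarrow> (real \<Rightarrow> real \<Rightarrow> 'v) \<Rightarrow> bool" where
  "continuous_into V N S u \<longleftrightarrow>
     (\<forall>t\<in>S. u t \<in> V) \<and>
     (\<forall>t\<in>S. ((\<lambda>r. N (\<lambda>\<zeta>. u r \<zeta> - u t \<zeta>)) \<longlongrightarrow> 0) (at t within S))"

definition C1_into ::
  "(real \<Rightarrow> 'v::real_normed_vector) set \<Rightarrow> ((real \<Rightarrow> 'v) \<Rightarrow> real) \<Rightarrow> real set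
    \<Rightarrow> (real \<Rightarrow> real \<Rightarrow> 'v) \<Rightarrow> (real \<Rightarrow> real \<Rightarrow> 'v) \<Rightarrow> bool" where
  "C1_into V N S u u' \<longleftrightarrow>
     (\<forall>t\<in>S. u t \<in> V) \<and>
     (\<forall>t\<in>S. ((\<lambda>r. N (\<lambda>\<zeta>. (u r \<zeta> - u t \<zeta>) /\<^sub>R (r - t) - u' t \<zeta>)) \<longlongrightarrow> 0) (at t within S)) \<and>
     continuous_into V N S u'"

text \<open>
  \<open>g\<close> is the absolutely continuous representative of \<open>x\<close> on \<open>[a,b]\<close> and \<open>d\<close> its derivative,
  which is required to be square integrable. \<open>g\<close> is unique on \<open>[a,b]\<close> and \<open>d\<close> is unique a.e.
\<close>

definition ac_rep ::
  "real \<Rightarrow> real \<Rightarrow> (real \<Rightarrow> 'k::real_or_complex^'n) \<Rightarrow> (real \<Rightarrow> 'k^'n) \<Rightarrow> (real \<Rightarrow> 'k^'n) \<Rightarrow> bool" where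
  "ac_rep a b x g d \<longleftrightarrow>
     eq_ae a b x g \<and> d \<in> L2 a b \<and>
     (\<forall>\<zeta>\<in>{a..b}. g \<zeta> = g a + (LINT \<eta>|lebesgue_on {a..\<zeta>}. d \<eta>))"

definition H1 :: "real \<Rightarrow> real \<Rightarrow> (real \<Rightarrow> 'k::real_or_complex^'n) set" where
  "H1 a b = {x \<in> L2 a b. \<exists>g d. ac_rep a b x g d}"

definition H1_trace :: "real \<Rightarrow> real \<Rightarrow> (real \<Rightarrow> 'k::real_or_complex^'n) \<Rightarrow> real \<Rightarrow> 'k^'n" where
  "H1_trace a b x = (SOME g. \<exists>d. ac_rep a b x g d)"

definition H1_deriv :: "real \<Rightarrow> real \<Rightarrow> (real \<Rightarrow> 'k::real_or_complex^'n) \<Rightarrow> real \<Rightarrow> 'k^'n" where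
  "H1_deriv a b x = (SOME d. \<exists>g. ac_rep a b x g d)"


section \<open>Well-posedness of non-autonomous Cauchy problems in \<open>L\<^sup>2\<close>\<close>

definition dense_subspace :: "real \<Rightarrow> real \<Rightarrow> (real \<Rightarrow> 'k::real_or_complex^'n) set \<Rightarrow> bool" where
  "dense_subspace a b Y \<longleftrightarrow>
     Y \<subseteq> L2 a b \<and>
     (\<forall>x\<in>Y. \<forall>y\<in>L2 a b. eq_ae a b x y \<longrightarrow> y \<in> Y) \<and>
     (\<lambda>\<zeta>. 0) \<in> Y \<and>
     (\<forall>x\<in>Y. \<forall>y\<in>Y. (\<lambda>\<zeta>. x \<zeta> + y \<zeta>) \<in> Y) \<and>
     (\<forall>c. \<forall>x\<in>Y. (\<lambda>\<zeta>. c *s x \<zeta>) \<in> Y) \<and>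
     (\<forall>x\<in>L2 a b. \<forall>\<epsilon>>0. \<exists>y\<in>Y. L2_norm a b (\<lambda>\<zeta>. x \<zeta> - y \<zeta>) < \<epsilon>)"

text \<open>
  In the following \<open>D t\<close> is the domain of the operator \<open>A t\<close>. The equation is required for all
  times after the initial time \<open>s\<close>, where \<open>u\<close> need not be differentiable.
\<close>

definition classical_solution ::
  "real \<Rightarrow> real \<Rightarrow> (real \<Rightarrow> (real \<Rightarrow> 'k::real_or_complex^'n) set)
    \<Rightarrow> (real \<Rightarrow> (real \<Rightarrow> 'k^'n) \<Rightarrow> real \<Rightarrow> 'k^'n)
    \<Rightarrow> real \<Rightarrow> (real \<Rightarrow> 'k^'n) \<Rightarrow> (real \<Rightarrow> real \<Rightarrow> 'k^'n) \<Rightarrow> bool" where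
  "classical_solution a b D A s x u \<longleftrightarrow>
     continuous_into (L2 a b) (L2_norm a b) {s..} u \<and>
     (\<forall>t\<ge>s. u t \<in> D t) \<and>
     (\<exists>u'. C1_into (L2 a b) (L2_norm a b) {s<..} u u' \<and>
           (\<forall>t>s. eq_ae a b (u' t) (A t (u t)))) \<and>
     eq_ae a b (u s) x"

definition extend_back :: "real \<Rightarrow> (real \<Rightarrow> 'v) \<Rightarrow> (real \<Rightarrow> real \<Rightarrow> 'v) \<Rightarrow> real \<Rightarrow> real \<Rightarrow> 'v" where
  "extend_back s x u t = (if s \<le> t then u t else x)"

definition C1_well_posed ::
  "real \<Rightarrow> real \<Rightarrow> (real \<Rightarrow> (real \<Rightarrow> 'k::real_or_complex^'n) set)
    \<Rightarrow> (real \<Rightarrow> (real \<Rightarrow> 'k^'n) \<Rightarrow> real \<Rightarrow> 'k^'n)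
    \<Rightarrow> (real \<Rightarrow> (real \<Rightarrow> 'k^'n) set) \<Rightarrow> bool" where
  "C1_well_posed a b D A Y \<longleftrightarrow>
     (\<forall>t\<ge>0. dense_subspace a b (Y t) \<and> Y t \<subseteq> D t) \<and>
     (\<forall>s\<ge>0. \<forall>x\<in>Y s.
        (\<exists>u. classical_solution a b D A s x u) \<and>
        (\<forall>u v. classical_solution a b D A s x u \<and> classical_solution a b D A s x v \<longrightarrow>
               (\<forall>t\<ge>s. eq_ae a b (u t) (v t))) \<and>
        (\<forall>u. classical_solution a b D A s x u \<longrightarrow> (\<forall>t\<ge>s. u t \<in> Y t))) \<and>
     (\<forall>sk xk uk s x u.
        (\<forall>k::nat. 0 \<le> sk k \<and> xk k \<in> Y (sk k) \<and> classical_solution a b D A (sk k) (xk k) (uk k)) \<and>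
        0 \<le> s \<and> x \<in> Y s \<and> classical_solution a b D A s x u \<and>
        sk \<longlonglongrightarrow> s \<and> (\<lambda>k. L2_norm a b (\<lambda>\<zeta>. xk k \<zeta> - x \<zeta>)) \<longlonglongrightarrow> 0 \<longrightarrow>
        (\<forall>C. compact C \<and> C \<subseteq> {0..} \<longrightarrow>
           uniform_limit C
             (\<lambda>k t. L2_norm a b (\<lambda>\<zeta>. extend_back (sk k) (xk k) (uk k) t \<zeta> - extend_back s x u t \<zeta>))
             (\<lambda>t. 0) sequentially))"


section \<open>Port-Hamiltonian systems\<close>

definition dom_A ::
  "real \<Rightarrow> real \<Rightarrow> 'k::real_or_complex^('n + 'n)^'n \<Rightarrow> (real \<Rightarrow> 'k^'n) set" where
  "dom_A a b W = {x \<in> H1 a b. W *v stack (H1_trace a b x b) (H1_trace a b x a) = 0}"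

definition op_A ::
  "real \<Rightarrow> real \<Rightarrow> 'k::real_or_complex^'n^'n \<Rightarrow> 'k^'n^'n
    \<Rightarrow> (real \<Rightarrow> 'k^'n) \<Rightarrow> real \<Rightarrow> 'k^'n" where
  "op_A a b P0 P1 x = (\<lambda>\<zeta>. P1 *v H1_deriv a b x \<zeta> + P0 *v x \<zeta>)"

definition dom_At ::
  "real \<Rightarrow> real \<Rightarrow> 'k::real_or_complex^('n + 'n)^'n \<Rightarrow> (real \<Rightarrow> real \<Rightarrow> 'k^'n^'n)
    \<Rightarrow> real \<Rightarrow> (real \<Rightarrow> 'k^'n) set" where
  "dom_At a b W H t = {x \<in> L2 a b. (\<lambda>\<zeta>. H t \<zeta> *v x \<zeta>) \<in> dom_A a b W}"

definition op_At ::
  "real \<Rightarrow> real \<Rightarrow> 'k::real_or_complex^'n^'n \<Rightarrow> 'k^'n^'n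
    \<Rightarrow> (real \<Rightarrow> real \<Rightarrow> 'k^'n^'n) \<Rightarrow> (real \<Rightarrow> real \<Rightarrow> 'k^'n^'n)
    \<Rightarrow> real \<Rightarrow> (real \<Rightarrow> 'k^'n) \<Rightarrow> real \<Rightarrow> 'k^'n" where
  "op_At a b P0 P1 H K t x =
     (\<lambda>\<zeta>. op_A a b P0 P1 (\<lambda>\<eta>. H t \<eta> *v x \<eta>) \<zeta> + K t \<zeta> *v x \<zeta>)"

definition regularity_space ::
  "real \<Rightarrow> real \<Rightarrow> 'k::real_or_complex^('n + 'n)^'n \<Rightarrow> (real \<Rightarrow> real \<Rightarrow> 'k^'n^'n)
    \<Rightarrow> real \<Rightarrow> (real \<Rightarrow> 'k^'n) set" where
  "regularity_space a b W H t =
     {x \<in> L2 a b. (\<lambda>\<zeta>. H t \<zeta> *v x \<zeta>) \<in> H1 a b \<and>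
        W *v stack (H1_trace a b (\<lambda>\<zeta>. H t \<zeta> *v x \<zeta>) b) (H1_trace a b (\<lambda>\<zeta>. H t \<zeta> *v x \<zeta>) a) = 0}"

definition energy_norm ::
  "real \<Rightarrow> real \<Rightarrow> (real \<Rightarrow> real \<Rightarrow> 'k::real_or_complex^'n^'n) \<Rightarrow> real \<Rightarrow> (real \<Rightarrow> 'k^'n) \<Rightarrow> real" where
  "energy_norm a b H t x = sqrt (LINT \<zeta>|lebesgue_on {a..b}. x \<zeta> \<bullet> (H t \<zeta> *v x \<zeta>))"

text \<open>\<open>Hd\<close> is the time derivative of \<open>H\<close>.\<close>

definition port_hamiltonian ::
  "real \<Rightarrow> real \<Rightarrow> 'k::real_or_complex^'n^'n \<Rightarrow> 'k^'n^'n \<Rightarrow> 'k^('n + 'n)^'n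
    \<Rightarrow> (real \<Rightarrow> real \<Rightarrow> 'k^'n^'n) \<Rightarrow> (real \<Rightarrow> real \<Rightarrow> 'k^'n^'n) \<Rightarrow> (real \<Rightarrow> real \<Rightarrow> 'k^'n^'n)
    \<Rightarrow> real \<Rightarrow> real \<Rightarrow> bool" where
  "port_hamiltonian a b P0 P1 W H Hd K m M \<longleftrightarrow>
     a < b \<and>
     loewner_le ((1 / 2) *\<^sub>R (P0 + ctranspose P0)) 0 \<and>
     invertible P1 \<and> ctranspose P1 = P1 \<and>
     pos_semidef (W_B P1 W ** Sigma_mat ** ctranspose (W_B P1 W)) \<and> rank W = CARD('n) \<and>
     C1_into (Linf a b) (Linf_norm a b) {0..} H Hd \<and>
     (\<exists>Hdd. C1_into (Linf a b) (Linf_norm a b) {0..} Hd Hdd) \<and>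
     0 < m \<and> 0 < M \<and>
     (\<forall>t\<ge>0. AE \<zeta> in lebesgue_on {a..b}.
        ctranspose (H t \<zeta>) = H t \<zeta> \<and>
        loewner_le (mat (of_real m)) (H t \<zeta>) \<and> loewner_le (H t \<zeta>) (mat (of_real M))) \<and>
     (\<exists>Kd. C1_into (Linf a b) (Linf_norm a b) {0..} K Kd)"


section \<open>The inner product\<close>

lemma mult_cconj_self: "x * cconj x = of_real ((norm (x::'k::real_or_complex))\<^sup>2)"
  by (simp add: mult_cconj_scaleR of_real_def)

lemma cconj_0: "cconj (0::'k::real_or_complex) = 0"
  using cconj_add[of "0::'k" 0] by simp

lemma cconj_1: "cconj (1::'k::real_or_complex) = 1"
  using mult_cconj_self[of "1::'k"] by simp

lemma cconj_cconj: "cconj (cconj x) = (x::'k::real_or_complex)"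
proof (cases "x = 0")
  case False
  have of_real: "cconj (of_real r) = (of_real r :: 'k)" for r
    using mult_cconj_self[of "of_real r :: 'k"]
    by (cases "r = 0") (auto simp: cconj_0 power2_eq_square)
  have "cconj x * cconj (cconj x) = x * cconj x"
    by (metis cconj_mult mult_cconj_self of_real)
  moreover have "cconj x \<noteq> 0"
    using mult_cconj_self[of x] False by auto
  ultimately show ?thesis by simp
qed (simp add: cconj_0)

lemma cconj_sum: "cconj (sum f A) = (\<Sum>i\<in>A. cconj (f i :: 'k::real_or_complex))"
  by (induction A rule: infinite_finite_induct) (auto simp: cconj_0 cconj_add)

lemma inner_scalar: "x * cconj y + y * cconj x = of_real (2 * (x \<bullet> (y::'k::real_or_complex)))"
proof -
  have "(norm (x + y))\<^sup>2 = (norm x)\<^sup>2 + (norm y)\<^sup>2 + 2 * (x \<bullet> y)"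
    by (simp add: power2_norm_eq_inner inner_add inner_commute)
  moreover have "of_real ((norm (x + y))\<^sup>2) =
      of_real ((norm x)\<^sup>2) + of_real ((norm y)\<^sup>2) + (x * cconj y + y * cconj x)"
    unfolding mult_cconj_self[symmetric] by (simp add: cconj_add algebra_simps)
  ultimately show ?thesis by (simp del: of_real_power)
qed

lemma inner_hermitian:
  fixes A :: "'k::real_or_complex^'n^'n"
  assumes "ctranspose A = A"
  shows "(\<Sum>i\<in>UNIV. x $ i * cconj ((A *v x) $ i)) = of_real (x \<bullet> (A *v x))"
proof -
  let ?s = "\<Sum>i\<in>UNIV. x $ i * cconj ((A *v x) $ i)"
  have A: "cconj (A $ i $ j) = A $ j $ i" for i j
    using assms unfolding ctranspose_def by (metis vec_lambda_beta)
  have "?s = (\<Sum>i\<in>UNIV. \<Sum>j\<in>UNIV. x $ i * (A $ j $ i * cconj (x $ j)))"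
    by (simp add: matrix_vector_mult_def cconj_sum cconj_mult A sum_distrib_left)
  also have "\<dots> = (\<Sum>j\<in>UNIV. (A *v x) $ j * cconj (x $ j))"
    by (subst sum.swap) (simp add: matrix_vector_mult_def sum_distrib_left sum_distrib_right mult_ac)
  finally have "2 * ?s = (\<Sum>i\<in>UNIV. x $ i * cconj ((A *v x) $ i) + (A *v x) $ i * cconj (x $ i))"
    by (simp add: sum.distrib)
  also have "\<dots> = 2 * of_real (x \<bullet> (A *v x))"
    by (simp add: inner_scalar inner_vec_def sum_distrib_left)
  finally show ?thesis by simp
qed

end

theory Submission
  imports Defs
begin

text \<open>
  Write \<open>A\<close> for \<open>P\<^sub>1 \<partial>/\<partial>\<zeta> + P\<^sub>0\<close> with its boundary condition and \<open>G(t)\<close> for the inverse of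
  \<open>H(t)\<close>. The domain of \<open>A H(t)\<close> moves with \<open>t\<close>, that of \<open>A\<close> does not. Hence \<open>x' = A H x + K x\<close>
  is solved for \<open>v = H x\<close>, which satisfies \<open>G v' = A v + C v\<close> with the bounded operators
  \<open>C = K G - G'\<close>: the time dependence now sits in front of the derivative, and the domain is constant.

  The operator \<open>A\<close> is m-dissipative. Integration by parts reduces \<open>Re (A x | x) \<le> 0\<close> to the sign of the
  boundary form \<open>(P\<^sub>1 x(b) | x(b)) - (P\<^sub>1 x(a) | x(a))\<close> (\<open>dissipation_integral\<close>), and that sign is what
  \<open>W\<^sub>B \<Sigma> W\<^sub>B* \<ge> 0\<close> together with the full rank of \<open>W\<close> provides (\<open>boundary_form_nonpos\<close>). The equation
  \<open>x - \<mu> A x = h\<close> is a boundary value problem for a linear differential equation on \<open>[a,b]\<close>. By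
  dissipativity the boundary condition is an injective linear condition on the finitely many free
  parameters, hence it can be satisfied (\<open>boundary_value_problem\<close>).

  Solutions of \<open>G v' = A v + C v\<close> are limits of solutions with the bounded Yosida approximations \<open>Y\<^sub>\<mu>\<close> in
  place of \<open>A\<close>. The
  energy \<open>(G v | v)\<close> of the latter is controlled uniformly in \<open>\<mu>\<close>, because \<open>Y\<^sub>\<mu>\<close> is dissipative
  too. The derivative \<open>z = v'\<close> satisfies \<open>G z' = Y\<^sub>\<mu> z + (C - G') z + C' v\<close>, an equation of the same
  form; so \<open>v'\<close>, and with it \<open>Y\<^sub>\<mu> v\<close>, is bounded uniformly in \<open>\<mu>\<close>. Since
  \<open>Re (Y\<^sub>\<mu> x - Y\<^sub>\<nu> y | x - y)\<close> is at most of order \<open>\<mu> + \<nu>\<close> as long as \<open>Y\<^sub>\<mu> x\<close> and \<open>Y\<^sub>\<nu> y\<close> stay bounded, the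
  approximations \<open>v\<close> form a Cauchy family (\<open>approx_sol_Cauchy_regular\<close>). So do their derivatives,
  by an approximation of the data in the equation for \<open>z\<close> (\<open>approx_sol_Cauchy\<close>). The limit is
  therefore continuously differentiable, and it solves the equation because \<open>A\<close> is closed
  (\<open>evolution_solution\<close>). The derivatives of \<open>C\<close> in this argument are the place where two
  derivatives of \<open>H\<close> and one of \<open>K\<close> enter.

  Along a solution, \<open>d/dt (H x | x) = 2 Re (A H x | H x) + 2 Re (H x | K x) + (H' x | x)\<close>,
  and the first term is nonpositive. Both energy inequalities follow with Gronwall's lemma, and so do
  uniqueness and the dependence on the initial value at a fixed initial time. For varying initial times
  a solution is compared with the curve \<open>G(t) y\<close> through its initial value: it lies in the moving
  domain at all times and solves the equation up to a bounded error (\<open>solution_near_G\<close>).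

  The part on evolution equations is about a type that is a Hilbert space, whereas \<open>a\<close> and \<open>b\<close> are
  values. That part is applied to \<open>L\<^sup>2(\<real>)\<close>, which contains \<open>L\<^sup>2(a,b)\<close> through extension by zero. Outside
  \<open>[a,b]\<close> the operators \<open>A\<close> and \<open>K\<close> act as \<open>0\<close> and \<open>H(t)\<close> acts as \<open>m\<close>, which keeps all assumptions
  valid. Inner products are real, that is, real parts of the complex ones.
\<close>

section \<open>Differential inequalities and linear differential equations\<close>

text \<open>
  The derivative of \<open>exp (- k (r - s)) E r - d (r - s)\<close> is nonpositive. The sharp bound has
  \<open>d (1 - exp (- k (t - s))) / k\<close> in place of \<open>d (t - s)\<close>, which makes \<open>k = 0\<close> a special case.
\<close>

lemma gronwall_differential:
  fixes E E' :: "real \<Rightarrow> real"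
  assumes st: "s \<le> t" and cont: "continuous_on {s..t} E"
    and deriv: "\<And>r. r \<in> {s<..<t} \<Longrightarrow> (E has_real_derivative E' r) (at r)"
    and le: "\<And>r. r \<in> {s<..<t} \<Longrightarrow> E' r \<le> k * E r + d"
    and k: "0 \<le> k" and d: "0 \<le> d"
  shows "E t \<le> exp (k * (t - s)) * (E s + d * (t - s))"
proof -
  define F where "F r = exp (- k * (r - s)) * E r - d * (r - s)" for r
  have "F t \<le> F s"
  proof (rule DERIV_nonpos_imp_decreasing_open[OF st])
    show "continuous_on {s..t} F"
      unfolding F_def using cont by (intro continuous_intros)
    fix r assume r: "s < r" "r < t"
    define F' where "F' = exp (- k * (r - s)) * (E' r - k * E r) - d"
    have "(F has_real_derivative F') (at r)"
      unfolding F_def F'_def using r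
      by (auto intro!: derivative_eq_intros deriv simp: algebra_simps)
    moreover have "F' \<le> 0"
    proof -
      have "E' r - k * E r \<le> d" using le[of r] r by simp
      then have "exp (- k * (r - s)) * (E' r - k * E r) \<le> exp (- k * (r - s)) * d"
        by (intro mult_left_mono) auto
      also have "\<dots> \<le> 1 * d"
        using k d r by (intro mult_right_mono) auto
      finally show ?thesis by (simp add: F'_def)
    qed
    ultimately show "\<exists>y. (F has_real_derivative y) (at r) \<and> y \<le> 0" by blast
  qed
  then have "exp (- k * (t - s)) * E t \<le> E s + d * (t - s)"
    by (simp add: F_def)
  then have "exp (k * (t - s)) * (exp (- k * (t - s)) * E t) \<le> exp (k * (t - s)) * (E s + d * (t - s))"
    by (intro mult_left_mono) auto
  then show ?thesis
    by (simp add: mult.assoc[symmetric] exp_add[symmetric])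
qed

lemma integral_exp_weight:
  fixes \<kappa> :: real
  assumes "0 < \<kappa>" "s \<le> c"
  shows "((\<lambda>r. exp (\<kappa> * (r - s))) has_integral ((exp (\<kappa> * (c - s)) - 1) / \<kappa>)) {s..c}"
proof -
  have "((\<lambda>r. exp (\<kappa> * (r - s))) has_integral (exp (\<kappa> * (c - s)) / \<kappa> - exp (\<kappa> * (s - s)) / \<kappa>)) {s..c}"
    by (rule fundamental_theorem_of_calculus)
      (use assms in \<open>auto intro!: derivative_eq_intros simp flip: has_real_derivative_iff_has_vector_derivative\<close>)
  then show ?thesis by (simp add: diff_divide_distrib)
qed

text \<open>
  Picard iteration is a contraction with constant \<open>1/2\<close> on the whole interval in the sup norm
  with weight \<open>exp (- 2 l (t - s))\<close>, where \<open>l\<close> bounds the norm of \<open>L\<close>.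
\<close>

lemma linear_ode_solution:
  fixes L :: "real \<Rightarrow> 'a::banach \<Rightarrow>\<^sub>L 'a" and f :: "real \<Rightarrow> 'a"
  assumes sT: "s < T" and L: "continuous_on {s..T} L" and f: "continuous_on {s..T} f"
  obtains v where "v s = v0"
    "\<And>t. t \<in> {s..T} \<Longrightarrow> (v has_vector_derivative blinfun_apply (L t) (v t) + f t) (at t within {s..T})"
proof -
  \<comment> \<open>bounded continuous functions live on the whole line, so times are clamped to \<open>[s,T]\<close>\<close>
  define c where "c t = max s (min t T)" for t :: real
  have c[simp]: "c t \<in> {s..T}" "s \<le> c t" "c t \<le> T" for t using sT by (auto simp: c_def)
  have ct[simp]: "c t = t" if "t \<in> {s..T}" for t using that by (auto simp: c_def)
  have cc: "continuous_on UNIV c" unfolding c_def by (intro continuous_intros)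
  obtain l where l: "0 < l" "\<And>t. t \<in> {s..T} \<Longrightarrow> norm (L t) \<le> l"
    using compact_imp_bounded[OF compact_continuous_image[OF L compact_Icc]]
    unfolding bounded_pos by auto
  define \<kappa> where "\<kappa> = 2 * l"
  have \<kappa>: "0 < \<kappa>" using l by (simp add: \<kappa>_def)
  \<comment> \<open>the fixed point \<open>y\<close> of \<open>\<Phi>\<close> is the solution divided by the weight \<open>exp (\<kappa> (t - s))\<close>\<close>
  define g where "g y r = exp (\<kappa> * (r - s)) *\<^sub>R (L r (y r)) + f r" for y :: "real \<Rightarrow> 'a" and r
  define \<Phi> where "\<Phi> y t = exp (- \<kappa> * (c t - s)) *\<^sub>R (v0 + integral {s..c t} (g y))" for y t
  have g_cont: "continuous_on {s..T} (g y)" if "continuous_on {s..T} y" for y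
    unfolding g_def by (intro continuous_intros L f that)
  have I_cont: "continuous_on {s..T} (\<lambda>t. integral {s..t} (g y))" if "continuous_on {s..T} y" for y
    using g_cont[OF that] indefinite_integral_continuous_1 integrable_continuous_real by blast
  have \<Phi>_cont: "continuous_on UNIV (\<Phi> y)" if "continuous_on {s..T} y" for y
    unfolding \<Phi>_def
    by (intro continuous_intros cc continuous_on_compose2[OF I_cont[OF that] cc]) auto
  have \<Phi>_bcont: "\<Phi> y \<in> bcontfun" if "continuous_on {s..T} y" for y
  proof -
    have "range (\<Phi> y) \<subseteq> \<Phi> y ` {s..T}"
    proof safe
      fix t
      have "\<Phi> y t = \<Phi> y (c t)" by (simp add: \<Phi>_def)
      then show "\<Phi> y t \<in> \<Phi> y ` {s..T}" by (metis c(1) imageI)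
    qed
    moreover have "bounded (\<Phi> y ` {s..T})"
      by (intro compact_imp_bounded compact_continuous_image continuous_on_subset[OF \<Phi>_cont[OF that]]) auto
    ultimately show ?thesis
      using \<Phi>_cont[OF that] bounded_subset by (auto simp: bcontfun_def)
  qed
  define \<Psi> where "\<Psi> y = Bcontfun (\<Phi> (apply_bcontfun y))" for y
  have \<Psi>: "apply_bcontfun (\<Psi> y) = \<Phi> (apply_bcontfun y)" for y
    unfolding \<Psi>_def by (intro Bcontfun_inverse \<Phi>_bcont) simp
  have "dist (\<Psi> y) (\<Psi> z) \<le> (1/2) * dist y z" for y z
  proof (rule dist_bound)
    fix t
    let ?t = "c t"
    have t: "?t \<in> {s..T}" by simp
    have sub: "{s..?t} \<subseteq> {s..T}" using t by auto
    have int: "g (apply_bcontfun y) integrable_on {s..?t}" for y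
      by (intro integrable_continuous_real continuous_on_subset[OF g_cont sub]) simp
    have "norm (integral {s..?t} (\<lambda>r. g y r - g z r)) \<le> integral {s..?t} (\<lambda>r. (l * dist y z) * exp (\<kappa> * (r - s)))"
    proof (rule integral_norm_bound_integral)
      show "(\<lambda>r. g y r - g z r) integrable_on {s..?t}"
        using int by (intro integrable_diff) auto
      show "(\<lambda>r. (l * dist y z) * exp (\<kappa> * (r - s))) integrable_on {s..?t}"
        by (intro integrable_continuous_real continuous_intros)
      fix r assume r: "r \<in> {s..?t}"
      have "g y r - g z r = exp (\<kappa> * (r - s)) *\<^sub>R (L r (y r - z r))"
        by (simp add: g_def blinfun.bilinear_simps algebra_simps)
      then have "norm (g y r - g z r) = exp (\<kappa> * (r - s)) * norm (L r (y r - z r))" by simp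
      also have "\<dots> \<le> exp (\<kappa> * (r - s)) * (l * dist y z)"
      proof (intro mult_left_mono)
        have "norm (L r (y r - z r)) \<le> norm (L r) * norm (y r - z r)" by (rule norm_blinfun)
        also have "\<dots> \<le> l * dist y z"
          using l(1) l(2)[of r] r c(3)[of t] dist_bounded[of y r z]
            by (intro mult_mono) (auto simp: dist_norm simp del: c)
        finally show "norm (L r (y r - z r)) \<le> l * dist y z" .
      qed simp
      finally show "norm (g y r - g z r) \<le> (l * dist y z) * exp (\<kappa> * (r - s))" by (simp add: mult.commute)
    qed
    also have "\<dots> = (l * dist y z) * ((exp (\<kappa> * (?t - s)) - 1) / \<kappa>)"
      using integral_unique[OF integral_exp_weight[OF \<kappa>, of s ?t]] t by simp
    also have "\<dots> \<le> (l * dist y z) * (exp (\<kappa> * (?t - s)) / \<kappa>)"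
      using \<kappa> l by (intro mult_left_mono divide_right_mono) auto
    also have "\<dots> = exp (\<kappa> * (?t - s)) * ((1/2) * dist y z)"
      using l by (simp add: \<kappa>_def)
    finally have *: "norm (integral {s..?t} (g y) - integral {s..?t} (g z)) \<le> exp (\<kappa> * (?t - s)) * ((1/2) * dist y z)"
      using int by (subst (asm) integral_diff) auto
    have "dist (\<Psi> y t) (\<Psi> z t) = exp (- \<kappa> * (?t - s)) * norm (integral {s..?t} (g y) - integral {s..?t} (g z))"
      by (simp add: \<Psi> \<Phi>_def dist_norm flip: scaleR_diff_right)
    also have "\<dots> \<le> exp (- \<kappa> * (?t - s)) * (exp (\<kappa> * (?t - s)) * ((1/2) * dist y z))"
      using * by (intro mult_left_mono) auto
    also have "\<dots> = (1/2) * dist y z"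
      by (simp add: mult.assoc[symmetric] exp_add[symmetric])
    finally show "dist (\<Psi> y t) (\<Psi> z t) \<le> (1/2) * dist y z" .
  qed
  then have "\<exists>!y. \<Psi> y = y" by (intro banach_fix_type[of "1/2"]) auto
  then obtain y where y: "\<Psi> y = y" by blast
  then have yt: "y t = \<Phi> y t" for t using \<Psi>[of y] by simp
  define v where "v t = v0 + integral {s..t} (g y)" for t
  have yv: "exp (\<kappa> * (t - s)) *\<^sub>R y t = v t" if "t \<in> {s..T}" for t
    using yt[of t] that by (simp add: \<Phi>_def v_def flip: exp_add)
  show ?thesis
  proof
    show "v s = v0" by (simp add: v_def)
    fix t assume t: "t \<in> {s..T}"
    have "(v has_vector_derivative g y t) (at t within {s..T})"
      unfolding v_def
      using integral_has_vector_derivative[OF g_cont[of y] t]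
      by (auto intro!: derivative_eq_intros)
    moreover have "g y t = L t (v t) + f t"
      by (simp add: g_def blinfun.scaleR_right flip: yv[OF t])
    ultimately show "(v has_vector_derivative L t (v t) + f t) (at t within {s..T})" by simp
  qed
qed

text \<open>
  The moving averages of \<open>f\<close> over \<open>[t, t + h]\<close> are continuously differentiable and, by uniform
  continuity, close to \<open>f\<close> for small \<open>h\<close>.
\<close>

lemma continuous_on_approx_C1:
  fixes f :: "real \<Rightarrow> 'a::banach"
  assumes sT: "s < T" and f: "continuous_on {s..T} f" and e: "0 < e"
  obtains g g' where "continuous_on {s..T} g'"
    "\<And>t. t \<in> {s..T} \<Longrightarrow> (g has_vector_derivative g' t) (at t within {s..T})"
    "\<And>t. t \<in> {s..T} \<Longrightarrow> norm (g t - f t) \<le> e"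
proof -
  \<comment> \<open>the average reaches beyond \<open>T\<close>, so \<open>f\<close> is extended by its boundary values\<close>
  define c where "c t = max s (min t T)" for t :: real
  have c[simp]: "c t \<in> {s..T}" "s \<le> c t" "c t \<le> T" for t using sT by (auto simp: c_def)
  have ct[simp]: "c t = t" if "t \<in> {s..T}" for t using that by (auto simp: c_def)
  have cc: "continuous_on UNIV c" unfolding c_def by (intro continuous_intros)
  have cl: "\<bar>c r - c t\<bar> \<le> \<bar>r - t\<bar>" for r t by (auto simp: c_def)
  define F where "F t = f (c t)" for t
  have F: "continuous_on S F" for S
    unfolding F_def by (intro continuous_on_compose2[OF f] continuous_on_subset[OF cc]) auto
  have "uniformly_continuous_on {s..T} f"
    by (intro compact_uniformly_continuous f compact_Icc)
  then obtain d where d: "0 < d"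
    "\<And>x y. x \<in> {s..T} \<Longrightarrow> y \<in> {s..T} \<Longrightarrow> dist y x < d \<Longrightarrow> dist (f y) (f x) < e"
    using e unfolding uniformly_continuous_on_def by metis
  define h where "h = d / 2"
  have h: "0 < h" "h < d" using d by (auto simp: h_def)
  define P where "P t = integral {s..t} F" for t
  have P: "(P has_vector_derivative F t) (at t within {s..T+h})" if "t \<in> {s..T+h}" for t
    unfolding P_def by (intro integral_has_vector_derivative F that)
  define g where "g t = (P (t + h) - P t) /\<^sub>R h" for t
  define g' where "g' t = (F (t + h) - F t) /\<^sub>R h" for t
  show ?thesis
  proof (rule that)
    show "continuous_on {s..T} g'"
      unfolding g'_def
      by (intro continuous_intros continuous_on_compose2[OF F[of UNIV]] F) auto
    fix t assume t: "t \<in> {s..T}"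
    have 1: "(P has_vector_derivative F t) (at t within {s..T})"
      using P[of t] t h by (auto intro: has_vector_derivative_within_subset)
    have 2: "((\<lambda>t. P (t + h)) has_vector_derivative F (t + h)) (at t within {s..T})"
    proof -
      have "(P \<circ> (\<lambda>t. t + h) has_vector_derivative (1 *\<^sub>R F (t + h))) (at t within {s..T})"
      proof (rule vector_diff_chain_within)
        show "((\<lambda>t. t + h) has_vector_derivative 1) (at t within {s..T})"
          by (auto intro!: derivative_eq_intros)
        show "(P has_vector_derivative F (t + h)) (at (t + h) within (\<lambda>t. t + h) ` {s..T})"
          by (rule has_vector_derivative_within_subset[OF P]) (use t h in auto)
      qed
      then show ?thesis by (simp add: o_def)
    qed
    show "(g has_vector_derivative g' t) (at t within {s..T})"
      unfolding g_def g'_def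
      by (auto intro!: derivative_eq_intros 1 2 simp: scaleR_diff_right)
    have int: "F integrable_on {x..y}" for x y by (intro integrable_continuous_real F)
    have "P (t + h) - P t = integral {t..t+h} F"
      using Henstock_Kurzweil_Integration.integral_combine[of s t "t+h" F] int t h by (simp add: P_def algebra_simps)
    also have "\<dots> = integral {t..t+h} (\<lambda>r. F r - F t) + h *\<^sub>R F t"
      using int h by (subst integral_diff) auto
    finally have "g t - f t = integral {t..t+h} (\<lambda>r. F r - F t) /\<^sub>R h"
      using h t by (simp add: g_def scaleR_add_right F_def)
    moreover have "norm (integral {t..t+h} (\<lambda>r. F r - F t)) \<le> e * (t + h - t)"
    proof (rule integral_bound)
      show "continuous_on {t..t+h} (\<lambda>r. F r - F t)" by (intro continuous_intros F)
      fix r assume "r \<in> {t..t+h}"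
      then have "dist (c r) (c t) < d" using cl[of r t] h by (auto simp: dist_real_def)
      then show "norm (F r - F t) \<le> e"
        using d(2)[of "c t" "c r"] by (simp add: F_def dist_norm)
    qed (use h in auto)
    ultimately show "norm (g t - f t) \<le> e"
      using h by (simp add: field_simps)
  qed
qed

lemma has_vector_derivative_uniform_limit:
  fixes v :: "nat \<Rightarrow> real \<Rightarrow> 'a::banach"
  assumes z: "\<And>n t. t \<in> {s..T} \<Longrightarrow> (v n has_vector_derivative z n t) (at t within {s..T})"
    and v_lim: "uniform_limit {s..T} v w sequentially"
    and z_lim: "uniform_limit {s..T} z y sequentially"
    and t: "t \<in> {s..T}"
  shows "(w has_vector_derivative y t) (at t within {s..T})"
proof -
  have "\<exists>g. \<forall>x\<in>{s..T}. (\<lambda>n. v n x) \<longlonglongrightarrow> g x \<and> (g has_derivative (\<lambda>h. h *\<^sub>R y x)) (at x within {s..T})"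
  proof (rule has_derivative_sequence)
    show "convex {s..T}" by simp
    show "(v n has_derivative (\<lambda>h. h *\<^sub>R z n x)) (at x within {s..T})" if "x \<in> {s..T}" for n x
      using z[OF that] by (simp add: has_vector_derivative_def)
    show "\<forall>\<^sub>F n in sequentially. \<forall>x\<in>{s..T}. \<forall>h. norm (h *\<^sub>R z n x - h *\<^sub>R y x) \<le> e * norm h"
      if "0 < e" for e
      using uniform_limitD[OF z_lim that]
    proof eventually_elim
      case (elim n)
      show ?case
      proof safe
        fix x and h :: real assume "x \<in> {s..T}"
        then have "norm (z n x - y x) \<le> e" using elim by (auto simp: dist_norm less_imp_le)
        then have "norm h * norm (z n x - y x) \<le> norm h * e" by (intro mult_left_mono) auto
        then show "norm (h *\<^sub>R z n x - h *\<^sub>R y x) \<le> e * norm h"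
          by (simp add: mult.commute[of e] flip: scaleR_diff_right)
      qed
    qed
    show "t \<in> {s..T}" by fact
    show "(\<lambda>n. v n t) \<longlonglongrightarrow> w t" using tendsto_uniform_limitI[OF v_lim t] .
  qed
  then obtain g where g: "\<And>x. x \<in> {s..T} \<Longrightarrow> (\<lambda>n. v n x) \<longlonglongrightarrow> g x"
    "\<And>x. x \<in> {s..T} \<Longrightarrow> (g has_vector_derivative y x) (at x within {s..T})"
    unfolding has_vector_derivative_def by blast
  have "g x = w x" if "x \<in> {s..T}" for x
    using LIMSEQ_unique[OF g(1)[OF that] tendsto_uniform_limitI[OF v_lim that]] .
  then show ?thesis
    using g(2)[OF t] has_vector_derivative_transform[OF t, of w g] by auto
qed

section \<open>m-dissipative operators and their Yosida approximations\<close>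

locale m_dissipative =
  fixes D :: "'a::{real_inner,banach} set" and A :: "'a \<Rightarrow> 'a"
  assumes subspace_D: "subspace D"
    and A_add: "x \<in> D \<Longrightarrow> y \<in> D \<Longrightarrow> A (x + y) = A x + A y"
    and A_scaleR: "x \<in> D \<Longrightarrow> A (r *\<^sub>R x) = r *\<^sub>R A x"
    and dissipative: "x \<in> D \<Longrightarrow> A x \<bullet> x \<le> 0"
    and range_resolvent: "0 < \<mu> \<Longrightarrow> \<exists>x\<in>D. x - \<mu> *\<^sub>R A x = y"
begin

lemma D_add: "x \<in> D \<Longrightarrow> y \<in> D \<Longrightarrow> x + y \<in> D"
  and D_scaleR: "x \<in> D \<Longrightarrow> r *\<^sub>R x \<in> D"
  and D_diff: "x \<in> D \<Longrightarrow> y \<in> D \<Longrightarrow> x - y \<in> D"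
  and D_0: "0 \<in> D"
  using subspace_D by (auto simp: subspace_add subspace_scale subspace_diff subspace_0)

lemma A_diff: "x \<in> D \<Longrightarrow> y \<in> D \<Longrightarrow> A (x - y) = A x - A y"
  using A_add[of x "(-1) *\<^sub>R y"] A_scaleR[of y "-1"] D_scaleR[of y "-1"] by simp

lemma norm_le_resolvent:
  assumes x: "x \<in> D" and \<mu>: "0 \<le> \<mu>"
  shows "norm x \<le> norm (x - \<mu> *\<^sub>R A x)"
proof -
  have "(norm x)\<^sup>2 \<le> (x - \<mu> *\<^sub>R A x) \<bullet> x"
    using mult_nonneg_nonpos[OF \<mu> dissipative[OF x]] by (simp add: power2_norm_eq_inner inner_diff_left)
  also have "\<dots> \<le> norm (x - \<mu> *\<^sub>R A x) * norm x" by (rule norm_cauchy_schwarz)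
  finally show ?thesis
    by (cases "norm x = 0") (auto simp: power2_eq_square)
qed

lemma resolvent_unique:
  assumes "x \<in> D" "y \<in> D" "0 \<le> \<mu>" "x - \<mu> *\<^sub>R A x = y - \<mu> *\<^sub>R A y"
  shows "x = y"
  using norm_le_resolvent[OF D_diff[OF assms(1,2)] assms(3)] assms(4)
  by (simp add: A_diff[OF assms(1,2)] algebra_simps)

text \<open>
  \<open>J \<mu>\<close> is the resolvent \<open>(1 - \<mu> A)^-1\<close>.
\<close>

definition J :: "real \<Rightarrow> 'a \<Rightarrow> 'a" where
  "J \<mu> y = (THE x. x \<in> D \<and> x - \<mu> *\<^sub>R A x = y)"

lemma J:
  assumes "0 < \<mu>"
  shows J_in_D: "J \<mu> y \<in> D" and J_eq: "J \<mu> y - \<mu> *\<^sub>R A (J \<mu> y) = y"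
proof -
  have "\<exists>!x. x \<in> D \<and> x - \<mu> *\<^sub>R A x = y"
    using range_resolvent[OF assms, of y] resolvent_unique[of _ _ \<mu>] assms by (metis less_imp_le)
  then have "J \<mu> y \<in> D \<and> J \<mu> y - \<mu> *\<^sub>R A (J \<mu> y) = y"
    unfolding J_def by (rule theI')
  then show "J \<mu> y \<in> D" "J \<mu> y - \<mu> *\<^sub>R A (J \<mu> y) = y" by auto
qed

lemma J_eqI: "0 < \<mu> \<Longrightarrow> x \<in> D \<Longrightarrow> x - \<mu> *\<^sub>R A x = y \<Longrightarrow> J \<mu> y = x"
  using resolvent_unique[OF J_in_D, of \<mu> x \<mu> y] J_eq[of \<mu> y] by simp

lemma norm_J_le: "0 < \<mu> \<Longrightarrow> norm (J \<mu> y) \<le> norm y"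
  using norm_le_resolvent[OF J_in_D, of \<mu> \<mu> y] J_eq[of \<mu> y] by simp

lemma bounded_linear_J:
  assumes \<mu>: "0 < \<mu>"
  shows "bounded_linear (J \<mu>)"
proof (rule bounded_linear_intro[where K=1])
  note J = J_in_D[OF \<mu>] J_eq[OF \<mu>]
  show "J \<mu> (x + y) = J \<mu> x + J \<mu> y" for x y
  proof (rule J_eqI[OF \<mu>])
    show "J \<mu> x + J \<mu> y \<in> D" by (intro D_add J)
    have "J \<mu> x + J \<mu> y - \<mu> *\<^sub>R A (J \<mu> x + J \<mu> y) = (J \<mu> x - \<mu> *\<^sub>R A (J \<mu> x)) + (J \<mu> y - \<mu> *\<^sub>R A (J \<mu> y))"
      by (simp add: A_add J(1) algebra_simps)
    then show "J \<mu> x + J \<mu> y - \<mu> *\<^sub>R A (J \<mu> x + J \<mu> y) = x + y" by (simp only: J(2))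
  qed
  show "J \<mu> (r *\<^sub>R x) = r *\<^sub>R J \<mu> x" for r x
  proof (rule J_eqI[OF \<mu>])
    show "r *\<^sub>R J \<mu> x \<in> D" by (intro D_scaleR J)
    have "r *\<^sub>R J \<mu> x - \<mu> *\<^sub>R A (r *\<^sub>R J \<mu> x) = r *\<^sub>R (J \<mu> x - \<mu> *\<^sub>R A (J \<mu> x))"
      by (simp add: A_scaleR J(1) algebra_simps)
    then show "r *\<^sub>R J \<mu> x - \<mu> *\<^sub>R A (r *\<^sub>R J \<mu> x) = r *\<^sub>R x" by (simp only: J(2))
  qed
  show "norm (J \<mu> x) \<le> norm x * 1" for x using norm_J_le[OF \<mu>] by simp
qed

text \<open>
  The Yosida approximation \<open>A J\<^sub>\<mu>\<close>, a bounded operator, see \<open>Y_eq_A_J\<close>.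
\<close>

definition Y :: "real \<Rightarrow> 'a \<Rightarrow>\<^sub>L 'a" where
  "Y \<mu> = Blinfun (\<lambda>x. (J \<mu> x - x) /\<^sub>R \<mu>)"

lemma Y_apply:
  assumes \<mu>: "0 < \<mu>"
  shows "Y \<mu> x = (J \<mu> x - x) /\<^sub>R \<mu>"
proof -
  have "bounded_linear (\<lambda>x. (J \<mu> x - x) /\<^sub>R \<mu>)"
    by (intro bounded_linear_intros bounded_linear_compose[OF bounded_linear_scaleR_right] bounded_linear_sub bounded_linear_J[OF \<mu>])
  then show ?thesis by (simp add: Y_def bounded_linear_Blinfun_apply)
qed

lemma Y_eq_A_J:
  assumes "0 < \<mu>" shows "Y \<mu> x = A (J \<mu> x)"
proof -
  have "J \<mu> x - x = \<mu> *\<^sub>R A (J \<mu> x)" using J_eq[OF assms, of x] by (simp add: algebra_simps)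
  then show ?thesis using assms by (simp add: Y_apply)
qed

lemma J_minus_Y: "0 < \<mu> \<Longrightarrow> x = J \<mu> x - \<mu> *\<^sub>R Y \<mu> x"
  by (simp add: Y_apply)

lemma A_monotone: "x \<in> D \<Longrightarrow> y \<in> D \<Longrightarrow> (A x - A y) \<bullet> (x - y) \<le> 0"
  using dissipative[OF D_diff] by (simp add: A_diff)

lemma Y_dissipative:
  assumes \<mu>: "0 < \<mu>" shows "Y \<mu> x \<bullet> x \<le> 0"
proof -
  have "Y \<mu> x \<bullet> x = A (J \<mu> x) \<bullet> J \<mu> x - \<mu> * (norm (Y \<mu> x))\<^sup>2"
    using arg_cong[OF J_minus_Y[OF \<mu>, of x], of "\<lambda>z. Y \<mu> x \<bullet> z"]
    by (simp add: power2_norm_eq_inner inner_diff_right flip: Y_eq_A_J[OF \<mu>])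
  then show ?thesis using dissipative[OF J_in_D[OF \<mu>, of x]] \<mu>
    by (smt (verit) mult_nonneg_nonneg zero_le_power2)
qed

text \<open>
  Because of \<open>x = J\<^sub>\<mu> x - \<mu> Y\<^sub>\<mu> x\<close>, replacing \<open>x - y\<close> by \<open>J\<^sub>\<mu> x - J\<^sub>\<nu> y\<close> costs terms of order \<open>\<mu>\<close> and \<open>\<nu>\<close>,
  and what remains has a sign since \<open>A\<close> is monotone. This compares solutions that belong to
  different approximations.
\<close>

lemma Y_monotone_error:
  assumes \<mu>: "0 < \<mu>" and \<nu>: "0 < \<nu>" and R: "norm (Y \<mu> x) \<le> R" "norm (Y \<nu> y) \<le> R"
  shows "(Y \<mu> x - Y \<nu> y) \<bullet> (x - y) \<le> 2 * R\<^sup>2 * (\<mu> + \<nu>)"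
proof -
  have R0: "0 \<le> R" using R norm_ge_zero order_trans by blast
  let ?d = "Y \<mu> x - Y \<nu> y"
  have "x - y = (J \<mu> x - J \<nu> y) + (\<nu> *\<^sub>R Y \<nu> y - \<mu> *\<^sub>R Y \<mu> x)"
    using arg_cong2[OF J_minus_Y[OF \<mu>, of x] J_minus_Y[OF \<nu>, of y], of "(-)"] by (simp add: algebra_simps)
  then have "?d \<bullet> (x - y) = ?d \<bullet> (J \<mu> x - J \<nu> y) + ?d \<bullet> (\<nu> *\<^sub>R Y \<nu> y - \<mu> *\<^sub>R Y \<mu> x)"
    by (simp add: inner_add_right)
  also have "?d \<bullet> (J \<mu> x - J \<nu> y) \<le> 0"
    using A_monotone[OF J_in_D[OF \<mu>] J_in_D[OF \<nu>]] by (simp add: Y_eq_A_J \<mu> \<nu>)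
  also have "?d \<bullet> (\<nu> *\<^sub>R Y \<nu> y - \<mu> *\<^sub>R Y \<mu> x) \<le> norm ?d * norm (\<nu> *\<^sub>R Y \<nu> y - \<mu> *\<^sub>R Y \<mu> x)"
    by (rule norm_cauchy_schwarz)
  also have "\<dots> \<le> (R + R) * (\<nu> * R + \<mu> * R)"
  proof (rule mult_mono)
    show "norm ?d \<le> R + R" using R norm_triangle_ineq4 by (smt (verit))
    have "norm (\<nu> *\<^sub>R Y \<nu> y - \<mu> *\<^sub>R Y \<mu> x) \<le> norm (\<nu> *\<^sub>R Y \<nu> y) + norm (\<mu> *\<^sub>R Y \<mu> x)"
      by (rule norm_triangle_ineq4)
    also have "\<dots> \<le> \<nu> * R + \<mu> * R"
      using R \<mu> \<nu> by (intro add_mono) auto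
    finally show "norm (\<nu> *\<^sub>R Y \<nu> y - \<mu> *\<^sub>R Y \<mu> x) \<le> \<nu> * R + \<mu> * R" .
  qed (use R0 in auto)
  finally show ?thesis by (simp add: power2_eq_square algebra_simps)
qed

lemma Y_eq_J_A:
  assumes \<mu>: "0 < \<mu>" and x: "x \<in> D" shows "Y \<mu> x = J \<mu> (A x)"
proof -
  interpret bounded_linear "J \<mu>" by (rule bounded_linear_J[OF \<mu>])
  have "J \<mu> (x - \<mu> *\<^sub>R A x) = x" by (rule J_eqI[OF \<mu> x]) simp
  then have "J \<mu> x - x = \<mu> *\<^sub>R J \<mu> (A x)" by (simp add: diff scaleR algebra_simps)
  then show ?thesis using \<mu> by (simp add: Y_apply)
qed

text \<open>
  Density of the domain is a consequence of the range condition, and this lemma is its source. By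
  monotonicity of \<open>A\<close> the errors \<open>e\<^sub>n = J (\<mu>\<^sub>n) x - x\<close> satisfy \<open>|e\<^sub>n - e\<^sub>m|\<^sup>2 \<le> |e\<^sub>n|\<^sup>2 - |e\<^sub>m|\<^sup>2\<close> for \<open>n \<le> m\<close>, so
  they converge. Their limit \<open>l\<close> is orthogonal to the domain, and dissipativity at the solution of
  \<open>y - A y = l\<close> forces \<open>l = 0\<close>.
\<close>

lemma J_tendsto_of_decseq:
  assumes \<mu>: "\<And>n. 0 < \<mu> n" "\<mu> \<longlonglongrightarrow> 0" and dec: "decseq \<mu>"
  shows "(\<lambda>n. J (\<mu> n) x) \<longlonglongrightarrow> x"
proof -
  define e where "e n = J (\<mu> n) x - x" for n
  have e_mono: "p = inverse (\<mu> n) \<Longrightarrow> q = inverse (\<mu> m) \<Longrightarrow> n \<le> m \<Longrightarrow>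
     (p + q) * (norm (e n - e m))\<^sup>2 \<le> (q - p) * ((norm (e n))\<^sup>2 - (norm (e m))\<^sup>2)" for n m p q
  proof -
    assume pq: "p = inverse (\<mu> n)" "q = inverse (\<mu> m)"
    have "(A (J (\<mu> n) x) - A (J (\<mu> m) x)) \<bullet> (J (\<mu> n) x - J (\<mu> m) x) \<le> 0"
      by (intro A_monotone J_in_D \<mu>)
    moreover have "A (J (\<mu> n) x) = inverse (\<mu> n) *\<^sub>R e n" for n
      using Y_eq_A_J[OF \<mu>(1), of n x] by (simp add: Y_apply[OF \<mu>(1)] e_def)
    ultimately have "(p *\<^sub>R e n - q *\<^sub>R e m) \<bullet> (e n - e m) \<le> 0"
      using pq by (simp add: e_def)
    then have "p * (e n \<bullet> e n) + q * (e m \<bullet> e m) \<le> (p + q) * (e n \<bullet> e m)"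
      by (simp add: inner_diff_left inner_diff_right inner_commute[of "e m" "e n"] algebra_simps)
    moreover have "(norm (e n - e m))\<^sup>2 = e n \<bullet> e n + e m \<bullet> e m - 2 * (e n \<bullet> e m)"
      by (simp add: power2_norm_eq_inner inner_diff_left inner_diff_right inner_commute[of "e m" "e n"])
    ultimately show "(p + q) * (norm (e n - e m))\<^sup>2 \<le> (q - p) * ((norm (e n))\<^sup>2 - (norm (e m))\<^sup>2)"
      by (simp add: power2_norm_eq_inner algebra_simps)
  qed
  have e_le: "(norm (e n - e m))\<^sup>2 \<le> (norm (e n))\<^sup>2 - (norm (e m))\<^sup>2" if "n \<le> m" for n m
  proof -
    define p q where "p = inverse (\<mu> n)" and "q = inverse (\<mu> m)"
    have "p > 0" "q > 0" using \<mu>(1) by (auto simp: p_def q_def)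
    moreover have "p \<le> q" unfolding p_def q_def
      using decseqD[OF dec that] \<mu>(1) by (simp add: le_imp_inverse_le)
    moreover have *: "(p + q) * (norm (e n - e m))\<^sup>2 \<le> (q - p) * ((norm (e n))\<^sup>2 - (norm (e m))\<^sup>2)"
      by (rule e_mono) (auto simp: p_def q_def that)
    show ?thesis
    proof (cases "q = p")
      case True
      then have "e n = e m" using * \<open>p > 0\<close> by (simp add: mult_le_0_iff)
      then show ?thesis by simp
    next
      case False
      let ?X = "(norm (e n))\<^sup>2 - (norm (e m))\<^sup>2"
      have "0 \<le> (q - p) * ?X" by (rule order_trans[OF _ *]) (use \<open>p > 0\<close> \<open>q > 0\<close> in auto)
      then have X: "0 \<le> ?X" using False \<open>p \<le> q\<close> by (simp add: zero_le_mult_iff)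
      have "(p + q) * (norm (e n - e m))\<^sup>2 \<le> (p + q) * ?X"
        by (rule order_trans[OF *], rule mult_right_mono[OF _ X]) (use \<open>p > 0\<close> in auto)
      then show ?thesis using \<open>p > 0\<close> \<open>q > 0\<close> by (simp add: mult_le_cancel_left)
    qed
  qed
  have "decseq (\<lambda>n. (norm (e n))\<^sup>2)"
    unfolding decseq_def using e_le by (smt (verit) zero_le_power2)
  then have "convergent (\<lambda>n. (norm (e n))\<^sup>2)"
    by (intro decseq_bounded[where B=0, THEN Bseq_monoseq_convergent] decseq_imp_monoseq) auto
  then have Cn: "Cauchy (\<lambda>n. (norm (e n))\<^sup>2)" by (rule convergent_Cauchy)
  have "Cauchy e"
  proof (rule CauchyI')
    fix r :: real assume "0 < r"
    then obtain N where N: "\<And>m n. m \<ge> N \<Longrightarrow> n \<ge> N \<Longrightarrow> norm ((norm (e m))\<^sup>2 - (norm (e n))\<^sup>2) < r\<^sup>2"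
      using CauchyD[OF Cn, of "r\<^sup>2"] by auto
    have "norm (e n - e m) < r" if "n \<ge> N" "m > n" for n m
    proof -
      have "(norm (e n - e m))\<^sup>2 < r\<^sup>2" using e_le[of n m] N[of n m] that by auto
      then show ?thesis using \<open>0 < r\<close> by (simp add: power_less_imp_less_base)
    qed
    then show "\<exists>M. \<forall>m\<ge>M. \<forall>n>m. dist (e m) (e n) < r" by (auto simp: dist_norm)
  qed
  then obtain l where l: "e \<longlonglongrightarrow> l" using Cauchy_convergent convergent_def by blast
  have J_lim: "(\<lambda>n. J (\<mu> n) x) \<longlonglongrightarrow> x + l"
    using tendsto_add[OF tendsto_const[of x] l] by (simp add: e_def)
  \<comment> \<open>the limit of \<open>(\<mu>\<^sub>n A (J x) - \<mu>\<^sub>n A y | J x - y) \<le> 0\<close>\<close>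
  have neg: "l \<bullet> (x + l - y) \<le> 0" if y: "y \<in> D" for y
  proof (rule tendsto_upperbound)
    show "(\<lambda>n. (e n - \<mu> n *\<^sub>R A y) \<bullet> (J (\<mu> n) x - y)) \<longlonglongrightarrow> l \<bullet> (x + l - y)"
      using tendsto_inner[OF tendsto_diff[OF l tendsto_scaleR[OF \<mu>(2) tendsto_const[of "A y"]]]
          tendsto_diff[OF J_lim tendsto_const[of y]]] by simp
    have "(e n - \<mu> n *\<^sub>R A y) \<bullet> (J (\<mu> n) x - y) \<le> 0" for n
    proof -
      have "e n = \<mu> n *\<^sub>R A (J (\<mu> n) x)"
        using J_eq[OF \<mu>(1), of n x] by (simp add: e_def algebra_simps)
      then have "(e n - \<mu> n *\<^sub>R A y) \<bullet> (J (\<mu> n) x - y) = \<mu> n * ((A (J (\<mu> n) x) - A y) \<bullet> (J (\<mu> n) x - y))"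
        by (simp add: inner_diff_left algebra_simps)
      then show ?thesis
        using A_monotone[OF J_in_D[OF \<mu>(1)] y, of n x] \<mu>(1)[of n] by (simp add: mult_le_0_iff)
    qed
    then show "\<forall>\<^sub>F n in sequentially. (e n - \<mu> n *\<^sub>R A y) \<bullet> (J (\<mu> n) x - y) \<le> 0" by simp
  qed simp
  \<comment> \<open>\<open>neg\<close> bounds a function that is affine on the line spanned by \<open>y\<close>, so its slope vanishes\<close>
  have orth: "l \<bullet> y = 0" if y: "y \<in> D" for y
  proof (rule ccontr)
    assume ne: "l \<bullet> y \<noteq> 0"
    define r where "r = (l \<bullet> (x + l) - 1) / (l \<bullet> y)"
    have "l \<bullet> (x + l - r *\<^sub>R y) \<le> 0" by (rule neg[OF D_scaleR[OF y]])
    then show False using ne by (simp add: r_def inner_diff_right)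
  qed
  obtain y where y: "y \<in> D" "y - 1 *\<^sub>R A y = l" using range_resolvent[of 1 l] by auto
  have "(norm y)\<^sup>2 \<le> l \<bullet> y"
    using dissipative[OF y(1)] unfolding y(2)[symmetric] by (simp add: power2_norm_eq_inner inner_diff_left)
  then have "y = 0" using orth[OF y(1)] by simp
  then have "l = 0" using y(2) A_scaleR[of 0 0] D_0 by simp
  then show ?thesis using J_lim by simp
qed

lemma J_tendsto: "(\<lambda>n. J (inverse (real (Suc n))) x) \<longlonglongrightarrow> x"
proof (rule J_tendsto_of_decseq)
  show "decseq (\<lambda>n. inverse (real (Suc n)))"
    unfolding decseq_def by (intro allI impI le_imp_inverse_le) simp_all
  show "(\<lambda>n. inverse (real (Suc n))) \<longlonglongrightarrow> 0" by (rule LIMSEQ_inverse_real_of_nat)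
qed simp

lemma D_dense:
  assumes "0 < e" obtains y where "y \<in> D" "norm (y - x) < e"
proof -
  obtain n where "norm (J (inverse (real (Suc n))) x - x) < e"
    using LIMSEQ_D[OF J_tendsto assms] by blast
  then show ?thesis using that J_in_D by (meson inverse_positive_iff_positive of_nat_0_less_iff zero_less_Suc)
qed

lemma closed_A:
  assumes x: "\<And>n. x n \<in> D" "x \<longlonglongrightarrow> l" and A: "(\<lambda>n. A (x n)) \<longlonglongrightarrow> y"
  shows "l \<in> D" "A l = y"
proof -
  interpret bounded_linear "J 1" by (rule bounded_linear_J) simp
  have "(\<lambda>n. J 1 (x n - 1 *\<^sub>R A (x n))) \<longlonglongrightarrow> J 1 (l - 1 *\<^sub>R y)"
    by (intro tendsto tendsto_diff x tendsto_scaleR tendsto_const A)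
  moreover have "J 1 (x n - 1 *\<^sub>R A (x n)) = x n" for n
    by (rule J_eqI) (use x in auto)
  ultimately have "x \<longlonglongrightarrow> J 1 (l - 1 *\<^sub>R y)" by (simp only:)
  then have "J 1 (l - y) = l" using LIMSEQ_unique[OF x(2)] by (metis scaleR_one)
  then show "l \<in> D" "A l = y" using J_in_D[of 1 "l - y"] J_eq[of 1 "l - y"] by auto
qed

end

section \<open>Evolution equations with constant domain\<close>

lemma energy_has_derivative:
  fixes G :: "real \<Rightarrow> 'a::real_inner \<Rightarrow>\<^sub>L 'a"
  assumes G: "(G has_vector_derivative G1) (at t within S)"
    and w: "(w has_vector_derivative w1) (at t within S)"
    and sym: "\<And>x y. G t x \<bullet> y = x \<bullet> G t y"
  shows "((\<lambda>r. G r (w r) \<bullet> w r) has_real_derivative (2 * (G t w1 \<bullet> w t) + G1 (w t) \<bullet> w t)) (at t within S)"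
proof -
  have Gw: "((\<lambda>r. G r (w r)) has_vector_derivative (G t w1 + G1 (w t))) (at t within S)"
    by (rule bounded_bilinear.has_vector_derivative[OF bounded_bilinear_blinfun_apply G w])
  have "((\<lambda>r. G r (w r) \<bullet> w r) has_vector_derivative (G t (w t) \<bullet> w1 + (G t w1 + G1 (w t)) \<bullet> w t)) (at t within S)"
    by (rule bounded_bilinear.has_vector_derivative[OF bounded_bilinear_inner Gw w])
  moreover have "G t (w t) \<bullet> w1 + (G t w1 + G1 (w t)) \<bullet> w t = 2 * (G t w1 \<bullet> w t) + G1 (w t) \<bullet> w t"
    using sym[of "w t" w1] by (simp add: inner_add_left inner_add_right inner_commute)
  ultimately show ?thesis by (simp add: has_real_derivative_iff_has_vector_derivative)
qed

lemma energy_estimate: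
  fixes G G1 :: "real \<Rightarrow> 'a::real_inner \<Rightarrow>\<^sub>L 'a"
  assumes st: "s \<le> t" and w: "continuous_on {s..t} w" and G: "continuous_on {s..t} G"
    and w1: "\<And>r. r \<in> {s<..<t} \<Longrightarrow> (w has_vector_derivative w1 r) (at r)"
    and G1: "\<And>r. r \<in> {s<..<t} \<Longrightarrow> (G has_vector_derivative G1 r) (at r)"
    and sym: "\<And>r x y. r \<in> {s<..<t} \<Longrightarrow> G r x \<bullet> y = x \<bullet> G r y"
    and le: "\<And>r. r \<in> {s<..<t} \<Longrightarrow> 2 * (G r (w1 r) \<bullet> w r) + G1 r (w r) \<bullet> w r \<le> k * (G r (w r) \<bullet> w r) + d"
    and k: "0 \<le> k" and d: "0 \<le> d"
  shows "G t (w t) \<bullet> w t \<le> exp (k * (t - s)) * (G s (w s) \<bullet> w s + d * (t - s))"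
  by (rule gronwall_differential[OF st _ energy_has_derivative[OF G1 w1 sym] le k d])
    (auto intro!: continuous_intros w G)

lemma bounded_on_compact_interval:
  fixes f :: "real \<Rightarrow> 'b::real_normed_vector"
  assumes "continuous_on {s..T} f"
  obtains B where "0 \<le> B" "\<And>t. t \<in> {s..T} \<Longrightarrow> norm (f t) \<le> B"
proof -
  obtain b where "0 < b" "\<And>t. t \<in> {s..T} \<Longrightarrow> norm (f t) \<le> b"
    using compact_imp_bounded[OF compact_continuous_image[OF assms compact_Icc]]
    unfolding bounded_pos by auto
  with that[of b] show ?thesis by simp
qed

text \<open>
  The setting for \<open>G(t) v' = A v + C(t) v\<close> on \<open>[s,T]\<close>. The operators \<open>G(t)\<close> define equivalent inner
  products, with \<open>\<gamma>\<close> as lower bound; \<open>H(t)\<close> is the inverse of \<open>G(t)\<close>.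
\<close>

locale evolution = m_dissipative D A for D :: "'a::{real_inner,banach} set" and A +
  fixes s T \<gamma> :: real and H G G1 G2 :: "real \<Rightarrow> 'a \<Rightarrow>\<^sub>L 'a"
  assumes sT: "s < T"
    and GH: "t \<in> {s..T} \<Longrightarrow> G t (H t x) = x" and HG: "t \<in> {s..T} \<Longrightarrow> H t (G t x) = x"
    and G_deriv: "t \<in> {s..T} \<Longrightarrow> (G has_vector_derivative G1 t) (at t within {s..T})"
    and G1_deriv: "t \<in> {s..T} \<Longrightarrow> (G1 has_vector_derivative G2 t) (at t within {s..T})"
    and G2_cont: "continuous_on {s..T} G2"
    and H_deriv: "t \<in> {s..T} \<Longrightarrow> (H has_vector_derivative - (H t o\<^sub>L G1 t o\<^sub>L H t)) (at t within {s..T})"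
    and sym: "t \<in> {s..T} \<Longrightarrow> G t x \<bullet> y = x \<bullet> G t y"
    and \<gamma>: "0 < \<gamma>" and coercive: "t \<in> {s..T} \<Longrightarrow> \<gamma> * (norm x)\<^sup>2 \<le> G t x \<bullet> x"
begin

lemma G_cont: "continuous_on {s..T} G"
  by (rule continuous_on_vector_derivative) (rule G_deriv)

lemma G1_cont: "continuous_on {s..T} G1"
  by (rule continuous_on_vector_derivative) (rule G1_deriv)

lemma H_cont: "continuous_on {s..T} H"
  by (rule continuous_on_vector_derivative) (rule H_deriv)

text \<open>
  The constant comes first because it has to serve all approximations at once. Of the equation
  solved by \<open>w\<close> it takes only a one-sided bound on \<open>(G w' | w)\<close>: the norms of the operators \<open>Y\<^sub>\<mu>\<close> are
  not bounded as \<open>\<mu>\<close> tends to \<open>0\<close>, but all of them are dissipative.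
\<close>

lemma energy_uniform_bound:
  assumes c: "0 \<le> c"
  shows "\<exists>N\<ge>0. \<forall>w w' \<delta>. 0 \<le> \<delta> \<longrightarrow>
    (\<forall>t\<in>{s..T}. (w has_vector_derivative w' t) (at t within {s..T}) \<and> G t (w' t) \<bullet> w t \<le> c * (norm (w t))\<^sup>2 + \<delta>) \<longrightarrow>
    (\<forall>t\<in>{s..T}. (norm (w t))\<^sup>2 \<le> N * ((norm (w s))\<^sup>2 + \<delta>))"
proof -
  obtain g0 where g0: "0 \<le> g0" "\<And>t. t \<in> {s..T} \<Longrightarrow> norm (G t) \<le> g0"
    using bounded_on_compact_interval[OF G_cont] by auto
  obtain g1 where g1: "0 \<le> g1" "\<And>t. t \<in> {s..T} \<Longrightarrow> norm (G1 t) \<le> g1"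
    using bounded_on_compact_interval[OF G1_cont] by auto
  define k where "k = (2 * c + g1) / \<gamma>"
  have k: "0 \<le> k" using c g1 \<gamma> by (simp add: k_def)
  define N where "N = exp (k * (T - s)) * (g0 + 2 * (T - s)) / \<gamma>"
  have "0 \<le> N" using g0 \<gamma> sT by (simp add: N_def)
  have le_quad: "M x \<bullet> x \<le> B * (norm x)\<^sup>2" if "norm M \<le> B" for M :: "'a \<Rightarrow>\<^sub>L 'a" and B x
  proof -
    have "M x \<bullet> x \<le> norm (M x) * norm x" by (rule norm_cauchy_schwarz)
    also have "\<dots> \<le> (norm M * norm x) * norm x" by (intro mult_right_mono norm_blinfun) auto
    also have "\<dots> \<le> B * (norm x)\<^sup>2" using that by (simp add: power2_eq_square mult_right_mono mult.assoc)
    finally show ?thesis .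
  qed
  show ?thesis
  proof (intro exI[of _ N] conjI allI impI ballI)
    fix w w' and \<delta> t :: real
    assume \<delta>: "0 \<le> \<delta>" and t: "t \<in> {s..T}"
    assume *: "\<forall>t\<in>{s..T}. (w has_vector_derivative w' t) (at t within {s..T}) \<and> G t (w' t) \<bullet> w t \<le> c * (norm (w t))\<^sup>2 + \<delta>"
    have w_cont: "continuous_on {s..T} w"
      using * by (intro continuous_on_vector_derivative) auto
    have at: "at r within {s..T} = at r" if "r \<in> {s<..<t}" for r
      using that t by (intro at_within_interior) auto
    have "G t (w t) \<bullet> w t \<le> exp (k * (t - s)) * (G s (w s) \<bullet> w s + (2 * \<delta>) * (t - s))"
    proof (rule energy_estimate[where ?w1.0 = w' and ?G1.0 = G1])
      fix r assume r: "r \<in> {s<..<t}"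
      then have rI: "r \<in> {s..T}" using t by auto
      show "(w has_vector_derivative w' r) (at r)" using bspec[OF * rI] at[OF r] by simp
      show "(G has_vector_derivative G1 r) (at r)" using G_deriv[OF rI] at[OF r] by simp
      show "G r x \<bullet> y = x \<bullet> G r y" for x y by (rule sym[OF rI])
      have "G r (w' r) \<bullet> w r \<le> c * (norm (w r))\<^sup>2 + \<delta>" using bspec[OF * rI] by simp
      moreover have "G1 r (w r) \<bullet> w r \<le> g1 * (norm (w r))\<^sup>2" by (rule le_quad[OF g1(2)[OF rI]])
      ultimately have "2 * (G r (w' r) \<bullet> w r) + G1 r (w r) \<bullet> w r \<le> (2 * c + g1) * (norm (w r))\<^sup>2 + 2 * \<delta>"
        by (simp add: algebra_simps)
      also have "(2 * c + g1) * (norm (w r))\<^sup>2 = k * (\<gamma> * (norm (w r))\<^sup>2)" using \<gamma> by (simp add: k_def)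
      also have "\<dots> \<le> k * (G r (w r) \<bullet> w r)" by (intro mult_left_mono coercive rI k)
      finally show "2 * (G r (w' r) \<bullet> w r) + G1 r (w r) \<bullet> w r \<le> k * (G r (w r) \<bullet> w r) + 2 * \<delta>" by simp
    qed (use t k \<delta> in \<open>auto intro: continuous_on_subset[OF w_cont] continuous_on_subset[OF G_cont]\<close>)
    also have "\<dots> \<le> exp (k * (T - s)) * (g0 * (norm (w s))\<^sup>2 + (2 * \<delta>) * (T - s))"
    proof (rule mult_mono)
      show "exp (k * (t - s)) \<le> exp (k * (T - s))" using k t by (simp add: mult_left_mono)
      show "G s (w s) \<bullet> w s + (2 * \<delta>) * (t - s) \<le> g0 * (norm (w s))\<^sup>2 + (2 * \<delta>) * (T - s)"
        using le_quad[OF g0(2)[of s]] sT t \<delta> by (intro add_mono mult_left_mono) auto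
      have "0 \<le> \<gamma> * (norm (w s))\<^sup>2" using \<gamma> by simp
      also have "\<dots> \<le> G s (w s) \<bullet> w s" using coercive[of s "w s"] sT by simp
      finally show "0 \<le> G s (w s) \<bullet> w s + (2 * \<delta>) * (t - s)"
        using \<delta> t by (intro add_nonneg_nonneg) auto
    qed simp
    also have "\<dots> \<le> exp (k * (T - s)) * ((g0 + 2 * (T - s)) * ((norm (w s))\<^sup>2 + \<delta>))"
    proof (intro mult_left_mono)
      have "0 \<le> g0 * \<delta>" "0 \<le> (T - s) * (norm (w s))\<^sup>2" using g0(1) sT \<delta> by simp_all
      then show "g0 * (norm (w s))\<^sup>2 + (2 * \<delta>) * (T - s) \<le> (g0 + 2 * (T - s)) * ((norm (w s))\<^sup>2 + \<delta>)"
        by (simp add: algebra_simps)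
    qed simp
    also have "\<dots> = \<gamma> * (N * ((norm (w s))\<^sup>2 + \<delta>))" using \<gamma> by (simp add: N_def)
    finally have "\<gamma> * (norm (w t))\<^sup>2 \<le> \<gamma> * (N * ((norm (w s))\<^sup>2 + \<delta>))"
      using coercive[OF t, of "w t"] by linarith
    then show "(norm (w t))\<^sup>2 \<le> N * ((norm (w s))\<^sup>2 + \<delta>)" using \<gamma> by simp
  qed fact
qed

text \<open>
  \<open>v\<close> solves \<open>G v' = Y\<^sub>\<mu> v + C v + f\<close>. The derivative \<open>z\<close> is a parameter, since it solves an equation
  of the same kind.
\<close>

definition approx_sol :: "real \<Rightarrow> (real \<Rightarrow> 'a \<Rightarrow>\<^sub>L 'a) \<Rightarrow> (real \<Rightarrow> 'a) \<Rightarrow> (real \<Rightarrow> 'a) \<Rightarrow> (real \<Rightarrow> 'a) \<Rightarrow> bool" where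
  "approx_sol \<mu> C f v z \<longleftrightarrow>
     (\<forall>t\<in>{s..T}. (v has_vector_derivative z t) (at t within {s..T}) \<and> G t (z t) = Y \<mu> (v t) + C t (v t) + f t)"

lemma approx_sol_exists:
  assumes C: "continuous_on {s..T} C" and f: "continuous_on {s..T} f"
  obtains v z where "approx_sol \<mu> C f v z" "v s = x"
proof -
  have "continuous_on {s..T} (\<lambda>t. H t o\<^sub>L (Y \<mu> + C t))" "continuous_on {s..T} (\<lambda>t. H t (f t))"
    by (intro bounded_bilinear.continuous_on[OF bounded_bilinear_blinfun_compose]
        bounded_bilinear.continuous_on[OF bounded_bilinear_blinfun_apply] continuous_intros H_cont C f)+
  from linear_ode_solution[OF sT this, of x] obtain v where v: "v s = x"
    "\<And>t. t \<in> {s..T} \<Longrightarrow> (v has_vector_derivative (H t o\<^sub>L (Y \<mu> + C t)) (v t) + H t (f t)) (at t within {s..T})"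
    by blast
  have "approx_sol \<mu> C f v (\<lambda>t. H t (Y \<mu> (v t) + C t (v t) + f t))"
    unfolding approx_sol_def using v(2) by (auto simp: GH blinfun.bilinear_simps)
  with v(1) that show ?thesis by blast
qed

lemma approx_sol_D:
  assumes "approx_sol \<mu> C f v z" "t \<in> {s..T}"
  shows "(v has_vector_derivative z t) (at t within {s..T})" "G t (z t) = Y \<mu> (v t) + C t (v t) + f t"
  using assms by (auto simp: approx_sol_def)

lemma approx_sol_cont: "approx_sol \<mu> C f v z \<Longrightarrow> continuous_on {s..T} v"
  by (rule continuous_on_vector_derivative) (rule approx_sol_D(1))

lemma approx_sol_z:
  assumes "approx_sol \<mu> C f v z" "t \<in> {s..T}"
  shows "z t = H t (Y \<mu> (v t) + C t (v t) + f t)"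
  using arg_cong[OF approx_sol_D(2)[OF assms], of "H t"] HG[OF assms(2)] by simp

lemma approx_sol_diff:
  "approx_sol \<mu> C f v z \<Longrightarrow> approx_sol \<mu> C g w y \<Longrightarrow>
    approx_sol \<mu> C (\<lambda>t. f t - g t) (\<lambda>t. v t - w t) (\<lambda>t. z t - y t)"
  unfolding approx_sol_def
  by (auto intro!: derivative_intros simp: blinfun.bilinear_simps)

text \<open>
  Differentiating \<open>G z = Y\<^sub>\<mu> v + C v + f\<close> gives \<open>G z' = Y\<^sub>\<mu> z + (C - G') z + (C' v + f')\<close>.
\<close>

lemma approx_sol_deriv:
  assumes v: "approx_sol \<mu> C f v z"
    and C: "\<And>t. t \<in> {s..T} \<Longrightarrow> (C has_vector_derivative C1 t) (at t within {s..T})"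
    and f: "\<And>t. t \<in> {s..T} \<Longrightarrow> (f has_vector_derivative f1 t) (at t within {s..T})"
  obtains y where "approx_sol \<mu> (\<lambda>t. C t - G1 t) (\<lambda>t. C1 t (v t) + f1 t) z y"
proof -
  define R where "R t = Y \<mu> (v t) + C t (v t) + f t" for t
  define R1 where "R1 t = Y \<mu> (z t) + (C t (z t) + C1 t (v t)) + f1 t" for t
  define y where "y t = H t (R1 t) + (- (H t o\<^sub>L G1 t o\<^sub>L H t)) (R t)" for t
  have "approx_sol \<mu> (\<lambda>t. C t - G1 t) (\<lambda>t. C1 t (v t) + f1 t) z y"
    unfolding approx_sol_def
  proof (intro ballI conjI)
    fix t assume t: "t \<in> {s..T}"
    have vd: "(v has_vector_derivative z t) (at t within {s..T})" using v t by (auto simp: approx_sol_def)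
    have "(R has_vector_derivative R1 t) (at t within {s..T})"
      unfolding R_def R1_def
      by (intro has_vector_derivative_add f t bounded_bilinear.has_vector_derivative[OF bounded_bilinear_blinfun_apply C vd]
          bounded_linear.has_vector_derivative[OF blinfun.bounded_linear_right vd])
    then have "((\<lambda>t. H t (R t)) has_vector_derivative y t) (at t within {s..T})"
      unfolding y_def
      by (intro bounded_bilinear.has_vector_derivative[OF bounded_bilinear_blinfun_apply H_deriv] t)
    moreover have "z r = H r (R r)" if "r \<in> {s..T}" for r
      unfolding R_def by (rule approx_sol_z[OF v that])
    ultimately show "(z has_vector_derivative y t) (at t within {s..T})"
      using has_vector_derivative_transform[OF t, of z "\<lambda>t. H t (R t)"] by auto
    have "H t (R t) = z t" using approx_sol_z[OF v t] by (simp add: R_def)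
    then show "G t (y t) = Y \<mu> (z t) + (C t - G1 t) (z t) + (C1 t (v t) + f1 t)"
      unfolding y_def by (simp add: blinfun.bilinear_simps GH[OF t] R1_def)
  qed
  then show ?thesis by (rule that)
qed

lemma approx_sol_bound:
  assumes C: "continuous_on {s..T} C"
  shows "\<exists>N\<ge>0. \<forall>\<mu>>0. \<forall>f v z F. approx_sol \<mu> C f v z \<longrightarrow> (\<forall>t\<in>{s..T}. norm (f t) \<le> F) \<longrightarrow>
      (\<forall>t\<in>{s..T}. (norm (v t))\<^sup>2 \<le> N * ((norm (v s))\<^sup>2 + F\<^sup>2))"
proof -
  obtain c where c: "0 \<le> c" "\<And>t. t \<in> {s..T} \<Longrightarrow> norm (C t) \<le> c"
    using bounded_on_compact_interval[OF C] by auto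
  have "0 \<le> c + 1" using c by simp
  from energy_uniform_bound[OF this] obtain N where N: "0 \<le> N"
    "\<And>w w' \<delta>. 0 \<le> \<delta> \<Longrightarrow>
    (\<forall>t\<in>{s..T}. (w has_vector_derivative w' t) (at t within {s..T}) \<and> G t (w' t) \<bullet> w t \<le> (c+1) * (norm (w t))\<^sup>2 + \<delta>) \<Longrightarrow>
    (\<forall>t\<in>{s..T}. (norm (w t))\<^sup>2 \<le> N * ((norm (w s))\<^sup>2 + \<delta>))" by blast
  have "(norm (v t))\<^sup>2 \<le> N * ((norm (v s))\<^sup>2 + F\<^sup>2)"
    if \<mu>: "0 < \<mu>" and v: "approx_sol \<mu> C f v z" and F: "\<And>t. t \<in> {s..T} \<Longrightarrow> norm (f t) \<le> F" and t: "t \<in> {s..T}"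
    for \<mu> f v z F t
  proof -
    have "\<forall>t\<in>{s..T}. (v has_vector_derivative z t) (at t within {s..T}) \<and> G t (z t) \<bullet> v t \<le> (c+1) * (norm (v t))\<^sup>2 + F\<^sup>2"
    proof (intro ballI conjI)
      fix t assume t: "t \<in> {s..T}"
      show "(v has_vector_derivative z t) (at t within {s..T})" using v t by (auto simp: approx_sol_def)
      have "G t (z t) \<bullet> v t = Y \<mu> (v t) \<bullet> v t + C t (v t) \<bullet> v t + f t \<bullet> v t"
        using v t by (auto simp: approx_sol_def inner_add_left)
      also have "\<dots> \<le> 0 + c * (norm (v t))\<^sup>2 + ((norm (v t))\<^sup>2 + F\<^sup>2)"
      proof (intro add_mono Y_dissipative \<mu>)
        have "C t (v t) \<bullet> v t \<le> norm (C t (v t)) * norm (v t)" by (rule norm_cauchy_schwarz)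
        also have "\<dots> \<le> (c * norm (v t)) * norm (v t)"
          using norm_blinfun[of "C t" "v t"] c(2)[OF t] by (intro mult_right_mono order_trans[OF norm_blinfun]) auto
        finally show "C t (v t) \<bullet> v t \<le> c * (norm (v t))\<^sup>2" by (simp add: power2_eq_square)
        have "f t \<bullet> v t \<le> norm (f t) * norm (v t)" by (rule norm_cauchy_schwarz)
        also have "\<dots> \<le> F * norm (v t)" by (intro mult_right_mono F t) auto
        also have "\<dots> \<le> (norm (v t))\<^sup>2 + F\<^sup>2"
        proof -
          have "0 \<le> F" using F[OF t] norm_ge_zero[of "f t"] by linarith
          then have "0 \<le> F * norm (v t)" by simp
          then show ?thesis using sum_squares_bound[of F "norm (v t)"] by (simp add: mult.assoc)
        qed
        finally show "f t \<bullet> v t \<le> (norm (v t))\<^sup>2 + F\<^sup>2" .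
      qed
      finally show "G t (z t) \<bullet> v t \<le> (c+1) * (norm (v t))\<^sup>2 + F\<^sup>2" by (simp add: algebra_simps)
    qed
    from N(2)[OF _ this] t show ?thesis by simp
  qed
  with N(1) show ?thesis by blast
qed

lemma approx_sol_uniformly_bounded:
  assumes C: "continuous_on {s..T} C"
    and v: "\<And>n::nat. 0 < \<mu> n" "\<And>n. approx_sol (\<mu> n) C (f n) (v n) (z n)"
    and f: "\<And>n t. t \<in> {s..T} \<Longrightarrow> norm (f n t) \<le> F" and x: "\<And>n. norm (v n s) \<le> X"
  obtains R where "0 \<le> R" "\<And>n t. t \<in> {s..T} \<Longrightarrow> norm (v n t) \<le> R"
proof -
  obtain N where N: "0 \<le> N"
    "\<And>\<mu> f v z F t. 0 < \<mu> \<Longrightarrow> approx_sol \<mu> C f v z \<Longrightarrow> (\<forall>t\<in>{s..T}. norm (f t) \<le> F) \<Longrightarrow>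
      t \<in> {s..T} \<Longrightarrow> (norm (v t))\<^sup>2 \<le> N * ((norm (v s))\<^sup>2 + F\<^sup>2)"
    using approx_sol_bound[OF C] by blast
  have "norm (v n t) \<le> sqrt (N * (X\<^sup>2 + F\<^sup>2))" if "t \<in> {s..T}" for n t
  proof (rule real_le_rsqrt)
    have "(norm (v n t))\<^sup>2 \<le> N * ((norm (v n s))\<^sup>2 + F\<^sup>2)" using N(2)[OF v(1)[of n] v(2)[of n] _ that] f by blast
    also have "\<dots> \<le> N * (X\<^sup>2 + F\<^sup>2)"
      using x[of n] N(1) by (intro mult_left_mono add_right_mono power_mono) auto
    finally show "(norm (v n t))\<^sup>2 \<le> N * (X\<^sup>2 + F\<^sup>2)" .
  qed
  moreover have "0 \<le> sqrt (N * (X\<^sup>2 + F\<^sup>2))" using N(1) by simp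
  ultimately show ?thesis by (rule that[rotated])
qed

text \<open>
  For differentiable data and an initial value in the domain, the bounds on \<open>v\<close> and on its
  derivative \<open>z\<close> bound \<open>Y\<^sub>\<mu> v = G z - C v - f\<close> independently of \<open>\<mu>\<close>. Then \<open>Y_monotone_error\<close> is the bound
  that the energy estimate for the difference of two approximations asks for.
\<close>

lemma approx_sol_Cauchy_regular:
  assumes C: "\<And>t. t \<in> {s..T} \<Longrightarrow> (C has_vector_derivative C1 t) (at t within {s..T})" "continuous_on {s..T} C1"
    and f: "\<And>t. t \<in> {s..T} \<Longrightarrow> (f has_vector_derivative f1 t) (at t within {s..T})" "continuous_on {s..T} f1"
    and \<mu>: "\<And>n::nat. 0 < \<mu> n" "\<mu> \<longlonglongrightarrow> 0"
    and v: "\<And>n. approx_sol (\<mu> n) C f (v n) (z n)" and x: "x \<in> D" "\<And>n. v n s = x"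
  shows "uniformly_Cauchy_on {s..T} v"
proof -
  have C_cont: "continuous_on {s..T} C" and f_cont: "continuous_on {s..T} f"
    using continuous_on_vector_derivative[OF C(1)] continuous_on_vector_derivative[OF f(1)] by simp_all
  obtain F where F: "0 \<le> F" "\<And>t. t \<in> {s..T} \<Longrightarrow> norm (f t) \<le> F"
    using bounded_on_compact_interval[OF f_cont] by auto
  obtain F1 where F1: "0 \<le> F1" "\<And>t. t \<in> {s..T} \<Longrightarrow> norm (f1 t) \<le> F1"
    using bounded_on_compact_interval[OF f(2)] by auto
  obtain c where c: "0 \<le> c" "\<And>t. t \<in> {s..T} \<Longrightarrow> norm (C t) \<le> c"
    using bounded_on_compact_interval[OF C_cont] by auto
  obtain c1 where c1: "0 \<le> c1" "\<And>t. t \<in> {s..T} \<Longrightarrow> norm (C1 t) \<le> c1"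
    using bounded_on_compact_interval[OF C(2)] by auto
  obtain g where g: "0 \<le> g" "\<And>t. t \<in> {s..T} \<Longrightarrow> norm (G t) \<le> g"
    using bounded_on_compact_interval[OF G_cont] by auto
  obtain h where h: "0 \<le> h" "\<And>t. t \<in> {s..T} \<Longrightarrow> norm (H t) \<le> h"
    using bounded_on_compact_interval[OF H_cont] by auto
  have apply_le: "norm (blinfun_apply L u) \<le> l * r" if "norm L \<le> l" "norm u \<le> r" for L :: "'a \<Rightarrow>\<^sub>L 'a" and u l r
  proof -
    have "0 \<le> l" using that norm_ge_zero order_trans by blast
    then have "norm L * norm u \<le> l * r" using that by (intro mult_mono) auto
    then show ?thesis using norm_blinfun[of L u] by linarith
  qed
  have s_in: "s \<in> {s..T}" using sT by simp
  obtain R where R: "0 \<le> R" "\<And>n t. t \<in> {s..T} \<Longrightarrow> norm (v n t) \<le> R"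
  proof (rule approx_sol_uniformly_bounded[OF C_cont, of \<mu> "\<lambda>_. f" v z F "norm x"])
    show "norm (v n s) \<le> norm x" for n by (simp add: x(2))
  qed (use \<mu>(1) v F in blast)+
  have "\<exists>y. approx_sol (\<mu> n) (\<lambda>t. C t - G1 t) (\<lambda>t. C1 t (v n t) + f1 t) (z n) y" for n
    by (rule approx_sol_deriv[OF v C(1) f(1)]) blast+
  then obtain y where y: "\<And>n. approx_sol (\<mu> n) (\<lambda>t. C t - G1 t) (\<lambda>t. C1 t (v n t) + f1 t) (z n) (y n)"
    by metis
  have "continuous_on {s..T} (\<lambda>t. C t - G1 t)" by (intro continuous_intros C_cont G1_cont)
  then obtain Z where Z: "0 \<le> Z" "\<And>n t. t \<in> {s..T} \<Longrightarrow> norm (z n t) \<le> Z"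
  proof (rule approx_sol_uniformly_bounded[where \<mu> = \<mu> and C = "\<lambda>t. C t - G1 t" and v = z and z = y])
    show "approx_sol (\<mu> n) (\<lambda>t. C t - G1 t) (\<lambda>t. C1 t (v n t) + f1 t) (z n) (y n)" for n by (rule y)
    show "0 < \<mu> n" for n by (rule \<mu>(1))
    show "norm (C1 t (v n t) + f1 t) \<le> c1 * R + F1" if "t \<in> {s..T}" for n t
      using that by (intro norm_triangle_le add_mono apply_le c1 R F1)
    \<comment> \<open>the initial velocity is bounded because \<open>x\<close> is in the domain, where \<open>Y\<^sub>\<mu> x = J\<^sub>\<mu> (A x)\<close>\<close>
    show "norm (z n s) \<le> h * (norm (A x) + c * R + F)" for n
    proof -
      have "norm (Y (\<mu> n) x) \<le> norm (A x)"
        using norm_J_le[OF \<mu>(1)] by (simp add: Y_eq_J_A[OF \<mu>(1) x(1)])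
      then have "norm (Y (\<mu> n) (v n s) + C s (v n s) + f s) \<le> norm (A x) + c * R + F"
        using s_in by (intro norm_triangle_le add_mono apply_le c R F) (auto simp: x(2))
      then show ?thesis
        unfolding approx_sol_z[OF v s_in] by (intro apply_le h s_in)
    qed
  qed (rule that)
  define Q where "Q = g * Z + c * R + F"
  have Q: "norm (Y (\<mu> n) (v n t)) \<le> Q" if t: "t \<in> {s..T}" for n t
  proof -
    have "Y (\<mu> n) (v n t) = G t (z n t) - C t (v n t) - f t"
      using v[of n] t by (auto simp: approx_sol_def)
    also have "norm \<dots> \<le> Q"
      unfolding Q_def using t by (intro order_trans[OF norm_triangle_ineq4] add_mono apply_le g Z c R F)
    finally show ?thesis .
  qed
  from energy_uniform_bound[OF c(1)] obtain N where N: "0 \<le> N"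
    "\<And>w w' \<delta>. 0 \<le> \<delta> \<Longrightarrow>
    (\<forall>t\<in>{s..T}. (w has_vector_derivative w' t) (at t within {s..T}) \<and> G t (w' t) \<bullet> w t \<le> c * (norm (w t))\<^sup>2 + \<delta>) \<Longrightarrow>
    (\<forall>t\<in>{s..T}. (norm (w t))\<^sup>2 \<le> N * ((norm (w s))\<^sup>2 + \<delta>))" by blast
  have diff: "(norm (v n t - v m t))\<^sup>2 \<le> N * (2 * Q\<^sup>2 * (\<mu> n + \<mu> m))" if t: "t \<in> {s..T}" for n m t
  proof -
    have "\<forall>t\<in>{s..T}. ((\<lambda>t. v n t - v m t) has_vector_derivative (z n t - z m t)) (at t within {s..T}) \<and>
      G t (z n t - z m t) \<bullet> (v n t - v m t) \<le> c * (norm (v n t - v m t))\<^sup>2 + 2 * Q\<^sup>2 * (\<mu> n + \<mu> m)"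
    proof (intro ballI conjI)
      fix t assume t: "t \<in> {s..T}"
      show "((\<lambda>t. v n t - v m t) has_vector_derivative (z n t - z m t)) (at t within {s..T})"
        using v[of n] v[of m] t by (auto simp: approx_sol_def intro: derivative_intros)
      have "G t (z n t - z m t) = (Y (\<mu> n) (v n t) - Y (\<mu> m) (v m t)) + C t (v n t - v m t)"
        using v[of n] v[of m] t by (auto simp: approx_sol_def blinfun.bilinear_simps)
      then have "G t (z n t - z m t) \<bullet> (v n t - v m t) =
        (Y (\<mu> n) (v n t) - Y (\<mu> m) (v m t)) \<bullet> (v n t - v m t) + C t (v n t - v m t) \<bullet> (v n t - v m t)"
        by (simp add: inner_add_left)
      also have "\<dots> \<le> 2 * Q\<^sup>2 * (\<mu> n + \<mu> m) + c * (norm (v n t - v m t))\<^sup>2"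
      proof (intro add_mono Y_monotone_error \<mu> Q t)
        have "C t (v n t - v m t) \<bullet> (v n t - v m t) \<le> norm (C t (v n t - v m t)) * norm (v n t - v m t)"
          by (rule norm_cauchy_schwarz)
        also have "\<dots> \<le> (c * norm (v n t - v m t)) * norm (v n t - v m t)"
          by (intro mult_right_mono apply_le c t) auto
        finally show "C t (v n t - v m t) \<bullet> (v n t - v m t) \<le> c * (norm (v n t - v m t))\<^sup>2"
          by (simp add: power2_eq_square)
      qed
      finally show "G t (z n t - z m t) \<bullet> (v n t - v m t) \<le> c * (norm (v n t - v m t))\<^sup>2 + 2 * Q\<^sup>2 * (\<mu> n + \<mu> m)"
        by simp
    qed
    moreover have "0 \<le> 2 * Q\<^sup>2 * (\<mu> n + \<mu> m)" using \<mu>(1)[of n] \<mu>(1)[of m] by simp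
    ultimately show ?thesis using N(2)[of "2 * Q\<^sup>2 * (\<mu> n + \<mu> m)" "\<lambda>t. v n t - v m t" "\<lambda>t. z n t - z m t"] t x(2)
      by auto
  qed
  show ?thesis
    unfolding uniformly_Cauchy_on_def
  proof (intro allI impI)
    fix e :: real assume e: "0 < e"
    define P where "P = N * (2 * Q\<^sup>2) + 1"
    have P: "0 < P" using N by (simp add: P_def add_nonneg_pos)
    have "0 < e\<^sup>2 / (2 * P)" using e P by simp
    from order_tendstoD(2)[OF \<mu>(2) this] obtain M where M: "\<And>n. n \<ge> M \<Longrightarrow> \<mu> n < e\<^sup>2 / (2 * P)"
      by (auto simp: eventually_sequentially)
    have "dist (v m t) (v n t) < e" if "t \<in> {s..T}" "m \<ge> M" "n \<ge> M" for t m n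
    proof -
      have "(norm (v m t - v n t))\<^sup>2 \<le> N * (2 * Q\<^sup>2) * (\<mu> m + \<mu> n)" using diff[OF that(1), of m n] by (simp add: mult.assoc)
      also have "\<dots> \<le> P * (\<mu> m + \<mu> n)"
        using \<mu>(1)[of m] \<mu>(1)[of n] by (intro mult_right_mono) (auto simp: P_def)
      also have "\<dots> < P * (e\<^sup>2 / (2 * P) + e\<^sup>2 / (2 * P))"
        using M[OF that(2)] M[OF that(3)] P by (intro mult_strict_left_mono add_strict_mono)
      also have "\<dots> = e\<^sup>2" using P by simp
      finally show ?thesis using e by (simp add: dist_norm power_less_imp_less_base)
    qed
    then show "\<exists>M. \<forall>t\<in>{s..T}. \<forall>m\<ge>M. \<forall>n\<ge>M. dist (v m t) (v n t) < e" by blast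
  qed
qed

text \<open>
  This version applies to the derivatives of approximations: their inhomogeneities merely
  converge to a continuous function, and their initial values converge but need not lie in the
  domain. With regular data at distance \<open>d\<close> from the limits, \<open>approx_sol_bound\<close> keeps the
  solutions within a multiple of \<open>d\<close> that does not depend on \<open>n\<close>.
\<close>

lemma approx_sol_Cauchy:
  assumes C: "\<And>t. t \<in> {s..T} \<Longrightarrow> (C has_vector_derivative C1 t) (at t within {s..T})" "continuous_on {s..T} C1"
    and f: "uniform_limit {s..T} f F sequentially" "continuous_on {s..T} F"
    and \<mu>: "\<And>n::nat. 0 < \<mu> n" "\<mu> \<longlonglongrightarrow> 0"
    and v: "\<And>n. approx_sol (\<mu> n) C (f n) (v n) (z n)" and x: "(\<lambda>n. v n s) \<longlonglongrightarrow> x"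
  shows "uniformly_Cauchy_on {s..T} v"
  unfolding uniformly_Cauchy_on_def
proof (intro allI impI)
  fix e :: real assume e: "0 < e"
  have C_cont: "continuous_on {s..T} C"
    using C(1) by (rule continuous_on_vector_derivative)
  obtain N where N: "0 \<le> N"
    "\<And>\<mu> f v z F t. 0 < \<mu> \<Longrightarrow> approx_sol \<mu> C f v z \<Longrightarrow> (\<forall>t\<in>{s..T}. norm (f t) \<le> F) \<Longrightarrow>
      t \<in> {s..T} \<Longrightarrow> (norm (v t))\<^sup>2 \<le> N * ((norm (v s))\<^sup>2 + F\<^sup>2)"
    using approx_sol_bound[OF C_cont] by blast
  \<comment> \<open>both data errors are at most \<open>2 d\<close>, which moves a solution by at most \<open>sqrt (8 N) d < e / 3\<close>\<close>
  define d where "d = e / (9 * (sqrt N + 1))"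
  have d: "0 < d" using e N by (simp add: d_def add_nonneg_pos)
  obtain x' where x': "x' \<in> D" "norm (x' - x) < d" using D_dense[OF d] by blast
  obtain g g' where g: "continuous_on {s..T} g'"
    "\<And>t. t \<in> {s..T} \<Longrightarrow> (g has_vector_derivative g' t) (at t within {s..T})"
    "\<And>t. t \<in> {s..T} \<Longrightarrow> norm (g t - F t) \<le> d"
    proof (rule continuous_on_approx_C1[OF sT f(2) d]) qed (rule that)
  have g_cont: "continuous_on {s..T} g"
    using g(2) by (rule continuous_on_vector_derivative)
  have "\<exists>w y. approx_sol (\<mu> n) C g w y \<and> w s = x'" for n
    by (rule approx_sol_exists[OF C_cont g_cont, of "\<mu> n" x']) blast
  then have "\<forall>n. \<exists>w y. approx_sol (\<mu> n) C g w y \<and> w s = x'" ..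
  then obtain w where "\<forall>n. \<exists>y. approx_sol (\<mu> n) C g (w n) y \<and> w n s = x'"
    using choice[of "\<lambda>n w. \<exists>y. approx_sol (\<mu> n) C g w y \<and> w s = x'"] by auto
  then obtain y where "\<forall>n. approx_sol (\<mu> n) C g (w n) (y n) \<and> w n s = x'"
    using choice[of "\<lambda>n y. approx_sol (\<mu> n) C g (w n) y \<and> w n s = x'"] by auto
  then have w: "\<And>n. approx_sol (\<mu> n) C g (w n) (y n)" "\<And>n. w n s = x'" by auto
  have "uniformly_Cauchy_on {s..T} w"
    by (rule approx_sol_Cauchy_regular[where C = C and ?C1.0 = C1 and f = g and ?f1.0 = g' and \<mu> = \<mu> and z = y and x = x'])
      (fact C g \<mu> w x'(1))+
  then have "\<forall>e>0. \<exists>M. \<forall>t\<in>{s..T}. \<forall>m\<ge>M. \<forall>n\<ge>M. dist (w m t) (w n t) < e"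
    unfolding uniformly_Cauchy_on_def .
  moreover have "0 < e / 3" using e by simp
  ultimately have "\<exists>M. \<forall>t\<in>{s..T}. \<forall>m\<ge>M. \<forall>n\<ge>M. dist (w m t) (w n t) < e / 3" by blast
  then obtain M1 where M1: "\<And>t m n. t \<in> {s..T} \<Longrightarrow> m \<ge> M1 \<Longrightarrow> n \<ge> M1 \<Longrightarrow> dist (w m t) (w n t) < e / 3"
    by blast
  obtain M2 where M2: "\<And>n. n \<ge> M2 \<Longrightarrow> norm (v n s - x) < d" using LIMSEQ_D[OF x d] by blast
  obtain M3 where M3: "\<And>n t. n \<ge> M3 \<Longrightarrow> t \<in> {s..T} \<Longrightarrow> norm (f n t - F t) < d"
    using uniform_limitD[OF f(1) d] unfolding eventually_sequentially dist_norm by blast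
  have close: "norm (v n t - w n t) < e / 3" if n: "n \<ge> M2" "n \<ge> M3" and t: "t \<in> {s..T}" for n t
  proof -
    have "norm (f n t - g t) \<le> 2 * d" if "t \<in> {s..T}" for t
      using norm_triangle_ineq4[of "f n t - F t" "g t - F t"] M3[OF n(2) that] g(3)[OF that] by simp
    then have "(norm (v n t - w n t))\<^sup>2 \<le> N * ((norm (v n s - w n s))\<^sup>2 + (2 * d)\<^sup>2)"
      using N(2)[OF \<mu>(1) approx_sol_diff[OF v[of n] w(1)[of n]] _ t] by blast
    also have "\<dots> \<le> N * ((2 * d)\<^sup>2 + (2 * d)\<^sup>2)"
    proof -
      have "norm (v n s - w n s) \<le> 2 * d"
        using norm_triangle_ineq4[of "v n s - x" "x' - x"] M2[OF n(1)] x'(2) by (simp add: w(2))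
      then show ?thesis using N(1) by (intro mult_left_mono add_right_mono power_mono) auto
    qed
    also have "\<dots> = 8 * N * d\<^sup>2" by (simp add: power2_eq_square)
    also have "\<dots> < 9 * (sqrt N + 1)\<^sup>2 * d\<^sup>2"
    proof (rule mult_strict_right_mono)
      have "(sqrt N + 1)\<^sup>2 = N + 2 * sqrt N + 1" using N(1) by (simp add: power2_eq_square algebra_simps)
      then show "8 * N < 9 * (sqrt N + 1)\<^sup>2" using N(1) by (smt (verit) real_sqrt_ge_zero)
    qed (use d in simp)
    also have "\<dots> = (3 * (sqrt N + 1) * d)\<^sup>2" by (simp only: power_mult_distrib) simp
    finally have "norm (v n t - w n t) < 3 * (sqrt N + 1) * d"
      by (rule power_less_imp_less_base) (use d N in \<open>auto intro!: mult_nonneg_nonneg add_nonneg_nonneg\<close>)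
    also have "3 * (sqrt N + 1) * d = e / 3"
    proof -
      have "sqrt N + 1 > 0" using N(1) by (simp add: add_nonneg_pos)
      then show ?thesis by (simp add: d_def field_simps)
    qed
    finally show ?thesis .
  qed
  have "dist (v m t) (v n t) < e" if "t \<in> {s..T}" "m \<ge> max M1 (max M2 M3)" "n \<ge> max M1 (max M2 M3)" for t m n
  proof -
    have "norm (v m t - v n t) \<le> norm (v m t - w m t) + norm (w m t - w n t) + norm (v n t - w n t)"
      using norm_triangle_ineq[of "v m t - w m t" "w m t - v n t"] norm_triangle_ineq[of "w m t - w n t" "w n t - v n t"]
        norm_minus_commute[of "w n t" "v n t"] by simp
    also have "\<dots> < e / 3 + e / 3 + e / 3"
      using close[of m t] close[of n t] M1[of t m n] that by (intro add_strict_mono) (auto simp: dist_norm)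
    finally show ?thesis by (simp add: dist_norm)
  qed
  then show "\<exists>M. \<forall>t\<in>{s..T}. \<forall>m\<ge>M. \<forall>n\<ge>M. dist (v m t) (v n t) < e" by blast
qed

text \<open>
  The approximations and their derivatives converge uniformly, and \<open>A (J\<^sub>\<mu> v) = Y\<^sub>\<mu> v = G z - C v\<close>
  converges while \<open>J\<^sub>\<mu> v = v + \<mu> Y\<^sub>\<mu> v\<close> has the same limit as \<open>v\<close>. So closedness of \<open>A\<close> applies.
\<close>

theorem evolution_solution:
  fixes C C1 :: "real \<Rightarrow> 'a \<Rightarrow>\<^sub>L 'a"
  assumes C: "\<And>t. t \<in> {s..T} \<Longrightarrow> (C has_vector_derivative C1 t) (at t within {s..T})" "continuous_on {s..T} C1"
    and x: "x \<in> D"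
  obtains v z where "v s = x" "continuous_on {s..T} z"
    "\<And>t. t \<in> {s..T} \<Longrightarrow> (v has_vector_derivative z t) (at t within {s..T})"
    "\<And>t. t \<in> {s..T} \<Longrightarrow> v t \<in> D \<and> G t (z t) = A (v t) + C t (v t)"
proof -
  define \<mu> where "\<mu> n = inverse (real (Suc n))" for n
  have \<mu>: "\<And>n. 0 < \<mu> n" "\<mu> \<longlonglongrightarrow> 0"
    using LIMSEQ_inverse_real_of_nat by (simp_all add: \<mu>_def[abs_def])
  have s_in: "s \<in> {s..T}" using sT by simp
  have C_cont: "continuous_on {s..T} C"
    using C(1) by (rule continuous_on_vector_derivative)
  have zero_cont: "continuous_on {s..T} (\<lambda>t. 0 :: 'a)" by simp
  have zero_deriv: "((\<lambda>t. 0 :: 'a) has_vector_derivative 0) (at t within {s..T})" for t by simp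
  have "\<exists>v z. approx_sol (\<mu> n) C (\<lambda>t. 0) v z \<and> v s = x" for n
    by (rule approx_sol_exists[OF C_cont zero_cont, of "\<mu> n" x]) blast
  then have "\<forall>n. \<exists>v z. approx_sol (\<mu> n) C (\<lambda>t. 0) v z \<and> v s = x" ..
  then obtain v z where v: "\<And>n. approx_sol (\<mu> n) C (\<lambda>t. 0) (v n) (z n)" "\<And>n. v n s = x" by metis
  have "\<exists>y. approx_sol (\<mu> n) (\<lambda>t. C t - G1 t) (\<lambda>t. C1 t (v n t) + 0) (z n) y" for n
    by (rule approx_sol_deriv[OF v(1) C(1) zero_deriv]) blast+
  then obtain y where y: "\<And>n. approx_sol (\<mu> n) (\<lambda>t. C t - G1 t) (\<lambda>t. C1 t (v n t) + 0) (z n) (y n)"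
    by metis
  have "uniformly_Cauchy_on {s..T} v"
    by (rule approx_sol_Cauchy_regular[where C = C and ?C1.0 = C1 and f = "\<lambda>_. 0" and ?f1.0 = "\<lambda>_. 0" and \<mu> = \<mu> and z = z and x = x])
      (rule C zero_deriv zero_cont \<mu> v x | assumption)+
  then obtain w where w: "uniform_limit {s..T} v w sequentially"
    using Cauchy_uniformly_convergent uniformly_convergent_on_def by blast
  have w_cont: "continuous_on {s..T} w"
    using approx_sol_cont[OF v(1)] by (intro uniform_limit_theorem[OF _ w]) auto
  have z_s: "(\<lambda>n. z n s) \<longlonglongrightarrow> H s (A x + C s x)"
  proof -
    have "z n s = H s (J (\<mu> n) (A x) + C s x)" for n
      using approx_sol_z[OF v(1) s_in, of n] by (simp add: v(2) Y_eq_J_A[OF \<mu>(1) x])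
    moreover have "(\<lambda>n. H s (J (\<mu> n) (A x) + C s x)) \<longlonglongrightarrow> H s (A x + C s x)"
      unfolding \<mu>_def
      by (intro bounded_linear.tendsto[OF blinfun.bounded_linear_right] tendsto_add J_tendsto tendsto_const)
    ultimately show ?thesis by simp
  qed
  have "uniformly_Cauchy_on {s..T} z"
  proof (rule approx_sol_Cauchy[where C = "\<lambda>t. C t - G1 t" and ?C1.0 = "\<lambda>t. C1 t - G2 t"
        and f = "\<lambda>n t. C1 t (v n t) + 0" and F = "\<lambda>t. C1 t (w t)" and \<mu> = \<mu> and z = y])
    show "((\<lambda>t. C t - G1 t) has_vector_derivative C1 t - G2 t) (at t within {s..T})" if "t \<in> {s..T}" for t
      by (intro derivative_intros C G1_deriv that)
    show "continuous_on {s..T} (\<lambda>t. C1 t - G2 t)" by (intro continuous_intros C G2_cont)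
    show "continuous_on {s..T} (\<lambda>t. C1 t (w t))" by (intro continuous_intros C w_cont)
    show "uniform_limit {s..T} (\<lambda>n t. C1 t (v n t) + 0) (\<lambda>t. C1 t (w t)) sequentially"
    proof -
      have "bounded (C1 ` {s..T})" "bounded (w ` {s..T})"
        by (intro compact_imp_bounded compact_continuous_image C w_cont compact_Icc)+
      then have "uniform_limit {s..T} (\<lambda>n t. C1 t (v n t)) (\<lambda>t. C1 t (w t)) sequentially"
        by (intro bounded_bilinear.bounded_uniform_limit[OF bounded_bilinear_blinfun_apply] uniform_limit_const w)
      then show ?thesis by simp
    qed
  qed (fact \<mu> y z_s)+
  then obtain q where q: "uniform_limit {s..T} z q sequentially"
    using Cauchy_uniformly_convergent uniformly_convergent_on_def by blast
  show ?thesis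
  proof (rule that)
    show "continuous_on {s..T} q"
      using approx_sol_cont[OF y] by (intro uniform_limit_theorem[OF _ q]) auto
    have "(\<lambda>n. v n s) \<longlonglongrightarrow> w s" using tendsto_uniform_limitI[OF w s_in] .
    then show "w s = x" by (simp add: v(2) LIMSEQ_const_iff)
    fix t assume t: "t \<in> {s..T}"
    show "(w has_vector_derivative q t) (at t within {s..T})"
      by (rule has_vector_derivative_uniform_limit[OF approx_sol_D(1)[OF v(1)] w q t])
    have v_lim: "(\<lambda>n. v n t) \<longlonglongrightarrow> w t" and z_lim: "(\<lambda>n. z n t) \<longlonglongrightarrow> q t"
      using tendsto_uniform_limitI[OF w t] tendsto_uniform_limitI[OF q t] .
    have Y_eq: "Y (\<mu> n) (v n t) = G t (z n t) - C t (v n t)" for n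
      using approx_sol_D(2)[OF v(1) t, of n] by simp
    have Y_lim: "(\<lambda>n. Y (\<mu> n) (v n t)) \<longlonglongrightarrow> G t (q t) - C t (w t)"
      unfolding Y_eq
      by (intro tendsto_diff bounded_linear.tendsto[OF blinfun.bounded_linear_right] v_lim z_lim)
    have "(\<lambda>n. v n t + \<mu> n *\<^sub>R Y (\<mu> n) (v n t)) \<longlonglongrightarrow> w t + 0 *\<^sub>R (G t (q t) - C t (w t))"
      by (intro tendsto_add tendsto_scaleR v_lim \<mu> Y_lim)
    moreover have "v n t + \<mu> n *\<^sub>R Y (\<mu> n) (v n t) = J (\<mu> n) (v n t)" for n
      using J_minus_Y[OF \<mu>(1), of "v n t" n] by (simp add: algebra_simps)
    ultimately have J_lim: "(\<lambda>n. J (\<mu> n) (v n t)) \<longlonglongrightarrow> w t" by simp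
    have A_lim: "(\<lambda>n. A (J (\<mu> n) (v n t))) \<longlonglongrightarrow> G t (q t) - C t (w t)"
      using Y_lim by (simp add: Y_eq_A_J[OF \<mu>(1)])
    show "w t \<in> D \<and> G t (q t) = A (w t) + C t (w t)"
      using closed_A[OF J_in_D[OF \<mu>(1)] J_lim A_lim] by simp
  qed
qed

end

section \<open>Evolution equations with moving domain\<close>

lemma has_vector_derivative_iff_norm_tendsto:
  "(f has_vector_derivative D) (at t within S) \<longleftrightarrow>
     ((\<lambda>r. norm ((f r - f t) /\<^sub>R (r - t) - D)) \<longlongrightarrow> 0) (at t within S)"
proof -
  have eq: "norm (f r - f t - (r - t) *\<^sub>R D) / norm (r - t) = norm ((f r - f t) /\<^sub>R (r - t) - D)" if "r \<noteq> t" for r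
  proof -
    have "(f r - f t) /\<^sub>R (r - t) - D = (f r - f t - (r - t) *\<^sub>R D) /\<^sub>R (r - t)"
      using that by (simp add: scaleR_diff_right)
    then show ?thesis by (simp add: divide_inverse mult.commute)
  qed
  have "(f has_vector_derivative D) (at t within S) \<longleftrightarrow>
     ((\<lambda>r. norm (f r - f t - (r - t) *\<^sub>R D) / norm (r - t)) \<longlongrightarrow> 0) (at t within S)"
    by (simp add: has_vector_derivative_def has_derivative_iff_norm bounded_linear_scaleR_left)
  also have "\<dots> \<longleftrightarrow> ((\<lambda>r. norm ((f r - f t) /\<^sub>R (r - t) - D)) \<longlongrightarrow> 0) (at t within S)"
    by (rule tendsto_cong) (simp add: eventually_at_filter eq del: real_norm_def)
  finally show ?thesis .
qed

text \<open>
  \<open>x \<mapsto> x - \<rho> (H x - y)\<close> is a contraction for \<open>\<rho> = m / L\<^sup>2\<close>, and its fixed point solves \<open>H x = y\<close>.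
\<close>

lemma coercive_inverse:
  fixes H :: "'a::{real_inner,banach} \<Rightarrow>\<^sub>L 'a"
  assumes m: "0 < m" and coercive: "\<And>x. m * (norm x)\<^sup>2 \<le> H x \<bullet> x"
  obtains G where "\<And>x. blinfun_apply G (H x) = x" "\<And>x. H (blinfun_apply G x) = x" "norm G \<le> 1 / m"
proof -
  have lower: "m * norm x \<le> norm (H x)" for x
  proof (cases "x = 0")
    case False
    have "m * (norm x)\<^sup>2 \<le> norm (H x) * norm x"
      using coercive[of x] norm_cauchy_schwarz[of "H x" x] by linarith
    then show ?thesis using False by (simp add: power2_eq_square)
  qed simp
  have inj: "H x = H y \<Longrightarrow> x = y" for x y
    using lower[of "x - y"] m by (simp add: blinfun.diff_right mult_le_0_iff)
  have surj: "\<exists>x. H x = y" for y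
  proof -
    \<comment> \<open>at least the norm of \<open>H\<close> and at least \<open>m\<close>, so that \<open>m\<^sup>2 / L\<^sup>2 \<le> 1\<close>\<close>
    define L where "L = norm H + m"
    define \<rho> where "\<rho> = m / L\<^sup>2"
    define q where "q = sqrt (1 - m\<^sup>2 / L\<^sup>2)"
    have L: "0 < L" "norm H \<le> L" "m \<le> L" using m by (auto simp: L_def add_nonneg_pos)
    have \<rho>: "0 < \<rho>" using m L by (simp add: \<rho>_def)
    have ml: "m\<^sup>2 / L\<^sup>2 \<le> 1" using m L by (simp add: divide_le_eq power_mono)
    have q: "0 \<le> q" "q < 1" using ml m L by (auto simp: q_def)
    have contr: "norm (x - \<rho> *\<^sub>R H x) \<le> q * norm x" for x
    proof (rule power2_le_imp_le)
      have "(norm (x - \<rho> *\<^sub>R H x))\<^sup>2 = (norm x)\<^sup>2 - 2 * \<rho> * (H x \<bullet> x) + \<rho>\<^sup>2 * (norm (H x))\<^sup>2"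
        by (simp add: power2_norm_eq_inner inner_diff_left inner_diff_right inner_commute power2_eq_square[of \<rho>] algebra_simps)
      also have "\<dots> \<le> (norm x)\<^sup>2 - 2 * \<rho> * (m * (norm x)\<^sup>2) + \<rho>\<^sup>2 * (L * norm x)\<^sup>2"
      proof (intro add_mono diff_mono mult_left_mono coercive power_mono)
        show "norm (H x) \<le> L * norm x"
          using norm_blinfun[of H x] mult_right_mono[OF L(2) norm_ge_zero[of x]] by linarith
      qed (use \<rho> in auto)
      also have "\<dots> = (1 - m\<^sup>2 / L\<^sup>2) * (norm x)\<^sup>2"
        using L by (simp add: \<rho>_def field_simps power2_eq_square)
      also have "\<dots> = (q * norm x)\<^sup>2" using ml by (simp add: q_def power_mult_distrib)
      finally show "(norm (x - \<rho> *\<^sub>R H x))\<^sup>2 \<le> (q * norm x)\<^sup>2" .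
    qed (use q in simp)
    have "\<exists>!x. x - \<rho> *\<^sub>R (H x - y) = x"
    proof (rule banach_fix_type[OF q], intro allI)
      fix x z
      have eq: "(x - \<rho> *\<^sub>R (H x - y)) - (z - \<rho> *\<^sub>R (H z - y)) = (x - z) - \<rho> *\<^sub>R H (x - z)"
        by (simp add: blinfun.diff_right algebra_simps)
      show "dist (x - \<rho> *\<^sub>R (H x - y)) (z - \<rho> *\<^sub>R (H z - y)) \<le> q * dist x z"
        unfolding dist_norm eq by (rule contr)
    qed
    then obtain x where "x - \<rho> *\<^sub>R (H x - y) = x" by blast
    then show ?thesis using \<rho> by auto
  qed
  define g where "g y = (THE x. H x = y)" for y
  have Hg: "H (g y) = y" for y
    unfolding g_def using surj[of y] inj by (metis (mono_tags, lifting) theI')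
  have gH: "g (H x) = x" for x using inj[OF Hg] .
  have g_norm: "norm (g y) \<le> norm y * (1 / m)" for y
    using lower[of "g y"] m by (simp add: Hg field_simps)
  have "bounded_linear g"
  proof (rule bounded_linear_intro[where K = "1 / m"])
    show "g (x + y) = g x + g y" for x y by (rule inj) (simp add: Hg blinfun.add_right)
    show "g (r *\<^sub>R x) = r *\<^sub>R g x" for r x by (rule inj) (simp add: Hg blinfun.scaleR_right)
  qed (rule g_norm)
  note app = bounded_linear_Blinfun_apply[OF this]
  show ?thesis
  proof (rule that)
    show "norm (Blinfun g) \<le> 1 / m"
      using g_norm m by (intro norm_blinfun_bound) (simp_all add: app mult.commute)
  qed (simp_all add: app Hg gH)
qed

text \<open>
  Evaluate the nonnegative form at \<open>x - H x / M\<close>. This turns the bound on the quadratic form into a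
  bound on the norm with the same constant, on which the growth rate of the energy depends.
\<close>

lemma norm_le_of_symmetric_bounded:
  fixes H :: "'a::real_inner \<Rightarrow>\<^sub>L 'a"
  assumes sym: "\<And>x y. H x \<bullet> y = x \<bullet> H y" and pos: "\<And>x. 0 \<le> H x \<bullet> x"
    and upper: "\<And>x. H x \<bullet> x \<le> M * (norm x)\<^sup>2" and M: "0 < M"
  shows "norm (H x) \<le> M * norm x"
proof (rule power2_le_imp_le)
  define y where "y = x - (1 / M) *\<^sub>R H x"
  have "0 \<le> H y \<bullet> y" by (rule pos)
  also have "H y \<bullet> y = H x \<bullet> x - (2 / M) * (norm (H x))\<^sup>2 + (1 / M)\<^sup>2 * (H (H x) \<bullet> H x)"
    unfolding y_def using sym[of "H x" x]
    by (simp add: blinfun.bilinear_simps inner_diff_left inner_diff_right power2_norm_eq_inner inner_commute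
        power2_eq_square[of M] power2_eq_square[of "1/M"] algebra_simps)
  also have "\<dots> \<le> M * (norm x)\<^sup>2 - (2 / M) * (norm (H x))\<^sup>2 + (1 / M)\<^sup>2 * (M * (norm (H x))\<^sup>2)"
    using upper[of x] upper[of "H x"] M by (intro add_mono diff_mono mult_left_mono) auto
  also have "\<dots> = (M\<^sup>2 * (norm x)\<^sup>2 - (norm (H x))\<^sup>2) / M"
    using M by (simp add: field_simps power2_eq_square)
  finally show "(norm (H x))\<^sup>2 \<le> (M * norm x)\<^sup>2"
    using M by (simp add: zero_le_divide_iff power_mult_distrib)
qed (use M in simp)

text \<open>
  The abstract form of the system: \<open>u' = A H(t) u + K(t) u\<close>, with \<open>H1\<close>, \<open>H2\<close>, \<open>K1\<close> the time derivatives.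
\<close>

locale hamiltonian_evolution = m_dissipative D A for D :: "'a::{real_inner,banach} set" and A +
  fixes m M :: real and H H1 H2 K K1 :: "real \<Rightarrow> 'a \<Rightarrow>\<^sub>L 'a"
  assumes m: "0 < m" and M: "0 < M"
    and H_deriv: "0 \<le> t \<Longrightarrow> (H has_vector_derivative H1 t) (at t within {0..})"
    and H1_deriv: "0 \<le> t \<Longrightarrow> (H1 has_vector_derivative H2 t) (at t within {0..})"
    and H2_cont: "continuous_on {0..} H2"
    and K_deriv: "0 \<le> t \<Longrightarrow> (K has_vector_derivative K1 t) (at t within {0..})"
    and K1_cont: "continuous_on {0..} K1"
    and H_sym: "0 \<le> t \<Longrightarrow> H t x \<bullet> y = x \<bullet> H t y"
    and H_lower: "0 \<le> t \<Longrightarrow> m * (norm x)\<^sup>2 \<le> H t x \<bullet> x"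
    and H_upper: "0 \<le> t \<Longrightarrow> H t x \<bullet> x \<le> M * (norm x)\<^sup>2"
begin

lemma H_cont: "continuous_on {0..} H"
  by (rule continuous_on_vector_derivative) (rule H_deriv, simp)

lemma H1_cont: "continuous_on {0..} H1"
  by (rule continuous_on_vector_derivative) (rule H1_deriv, simp)

lemma K_cont: "continuous_on {0..} K"
  by (rule continuous_on_vector_derivative) (rule K_deriv, simp)

lemma norm_H_le: assumes "0 \<le> t" shows "norm (H t x) \<le> M * norm x"
proof (rule norm_le_of_symmetric_bounded[OF H_sym[OF assms] _ H_upper[OF assms] M])
  fix x :: 'a
  have "0 \<le> m * (norm x)\<^sup>2" using m by simp
  then show "0 \<le> H t x \<bullet> x" using H_lower[OF assms, of x] by linarith
qed

definition G :: "real \<Rightarrow> 'a \<Rightarrow>\<^sub>L 'a" where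
  "G t = (SOME g :: 'a \<Rightarrow>\<^sub>L 'a. (\<forall>x. blinfun_apply g (blinfun_apply (H t) x) = x) \<and> (\<forall>x. blinfun_apply (H t) (blinfun_apply g x) = x) \<and> norm g \<le> 1 / m)"

lemma G:
  assumes "0 \<le> t"
  shows GH: "G t (H t x) = x" and HG: "H t (G t x) = x" and norm_G: "norm (G t) \<le> 1 / m"
proof -
  have "\<exists>g :: 'a \<Rightarrow>\<^sub>L 'a. (\<forall>x. blinfun_apply g (blinfun_apply (H t) x) = x) \<and> (\<forall>x. blinfun_apply (H t) (blinfun_apply g x) = x) \<and> norm g \<le> 1 / m"
    by (rule coercive_inverse[OF m H_lower[OF assms]]) blast
  from someI_ex[OF this] show "G t (H t x) = x" "H t (G t x) = x" "norm (G t) \<le> 1 / m"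
    unfolding G_def by auto
qed

lemma G_diff: "0 \<le> r \<Longrightarrow> 0 \<le> t \<Longrightarrow> G r - G t = - (G r o\<^sub>L (H r - H t) o\<^sub>L G t)"
  by (rule blinfun_eqI) (simp add: blinfun.bilinear_simps GH HG)

lemma G_cont: "continuous_on {0..} G"
  unfolding continuous_on_def
proof
  fix t :: real assume t: "t \<in> {0..}"
  have "(H \<longlongrightarrow> H t) (at t within {0..})" using H_cont t by (auto simp: continuous_on_def)
  then have "((\<lambda>r. (1/m) * norm (H r - H t) * (1/m)) \<longlongrightarrow> (1/m) * norm (H t - H t) * (1/m)) (at t within {0..})"
    by (intro tendsto_intros)
  then have lim: "((\<lambda>r. (1/m) * norm (H r - H t) * (1/m)) \<longlongrightarrow> 0) (at t within {0..})" by simp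
  have "\<forall>\<^sub>F r in at t within {0..}. norm (G r - G t) \<le> (1/m) * norm (H r - H t) * (1/m)"
    unfolding eventually_at_filter
  proof (rule always_eventually, intro allI impI)
    fix r :: real assume "r \<in> {0..}"
    then have r: "0 \<le> r" by simp
    have "norm (G r - G t) = norm (G r o\<^sub>L (H r - H t) o\<^sub>L G t)" using G_diff[OF r, of t] t by simp
    also have "\<dots> \<le> norm (G r) * norm (H r - H t) * norm (G t)"
      by (intro order_trans[OF norm_blinfun_compose] mult_right_mono norm_blinfun_compose) auto
    also have "\<dots> \<le> (1/m) * norm (H r - H t) * (1/m)"
      using m t r norm_G by (intro mult_mono) auto
    finally show "norm (G r - G t) \<le> (1/m) * norm (H r - H t) * (1/m)" .
  qed
  from Lim_null_comparison[OF this lim] show "(G \<longlongrightarrow> G t) (at t within {0..})" by (simp add: LIM_zero_cancel)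
qed

definition G1 where "G1 t = - (G t o\<^sub>L H1 t o\<^sub>L G t)"

lemmas compose_deriv = bounded_bilinear.has_vector_derivative[OF bounded_bilinear_blinfun_compose]
lemmas apply_deriv = bounded_bilinear.has_vector_derivative[OF bounded_bilinear_blinfun_apply]
lemmas compose_cont = bounded_bilinear.continuous_on[OF bounded_bilinear_blinfun_compose]
lemmas apply_cont = bounded_bilinear.continuous_on[OF bounded_bilinear_blinfun_apply]

lemma G_deriv:
  assumes t: "0 \<le> t" shows "(G has_vector_derivative G1 t) (at t within {0..})"
  unfolding has_vector_derivative_iff_norm_tendsto
proof -
  have "((\<lambda>r. norm ((H r - H t) /\<^sub>R (r - t) - H1 t)) \<longlongrightarrow> 0) (at t within {0..})"
    using H_deriv[OF t] unfolding has_vector_derivative_iff_norm_tendsto .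
  then have Q: "((\<lambda>r. (H r - H t) /\<^sub>R (r - t)) \<longlongrightarrow> H1 t) (at t within {0..})"
    by (simp add: tendsto_norm_zero_iff LIM_zero_iff)
  have Gt: "(G \<longlongrightarrow> G t) (at t within {0..})" using G_cont t by (auto simp: continuous_on_def)
  note compose_tendsto = bounded_bilinear.tendsto[OF bounded_bilinear_blinfun_compose]
  have "((\<lambda>r. - (G r o\<^sub>L ((H r - H t) /\<^sub>R (r - t)) o\<^sub>L G t) - G1 t) \<longlongrightarrow> - (G t o\<^sub>L H1 t o\<^sub>L G t) - G1 t) (at t within {0..})"
    by (intro tendsto_diff tendsto_minus compose_tendsto Gt Q tendsto_const)
  then have "((\<lambda>r. - (G r o\<^sub>L ((H r - H t) /\<^sub>R (r - t)) o\<^sub>L G t) - G1 t) \<longlongrightarrow> 0) (at t within {0..})"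
    by (simp add: G1_def)
  moreover have "\<forall>\<^sub>F r in at t within {0..}. - (G r o\<^sub>L ((H r - H t) /\<^sub>R (r - t)) o\<^sub>L G t) - G1 t = (G r - G t) /\<^sub>R (r - t) - G1 t"
    unfolding eventually_at_filter
    using t by (intro always_eventually) (auto simp: G_diff intro!: blinfun_eqI simp: blinfun.bilinear_simps)
  ultimately have "((\<lambda>r. (G r - G t) /\<^sub>R (r - t) - G1 t) \<longlongrightarrow> 0) (at t within {0..})"
    by (rule Lim_transform_eventually)
  then show "((\<lambda>r. norm ((G r - G t) /\<^sub>R (r - t) - G1 t)) \<longlongrightarrow> 0) (at t within {0..})"
    by (simp add: tendsto_norm_zero_iff)
qed

definition G2 where
  "G2 t = - (((G t o\<^sub>L H1 t) o\<^sub>L G1 t) + (((G t o\<^sub>L H2 t) + (G1 t o\<^sub>L H1 t)) o\<^sub>L G t))"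

lemma G1_deriv:
  assumes t: "0 \<le> t" shows "(G1 has_vector_derivative G2 t) (at t within {0..})"
  using has_vector_derivative_minus[OF compose_deriv[OF compose_deriv[OF G_deriv[OF t] H1_deriv[OF t]] G_deriv[OF t]]]
  unfolding G1_def[abs_def, symmetric] G2_def[symmetric] .

lemma G1_cont: "continuous_on {0..} G1"
  by (rule continuous_on_vector_derivative) (rule G1_deriv, simp)

lemma G2_cont: "continuous_on {0..} G2"
  unfolding G2_def
  by (intro continuous_on_minus continuous_on_add compose_cont G_cont G1_cont H1_cont H2_cont)

lemma G_sym: assumes "0 \<le> t" shows "G t x \<bullet> y = x \<bullet> G t y"
  using H_sym[OF assms, of "G t x" "G t y"] by (simp add: HG assms)

lemma G_coercive: assumes t: "0 \<le> t" shows "m / M\<^sup>2 * (norm x)\<^sup>2 \<le> G t x \<bullet> x"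
proof -
  have "norm x \<le> M * norm (G t x)" using norm_H_le[OF t, of "G t x"] by (simp add: HG t)
  then have "(norm x)\<^sup>2 \<le> (M * norm (G t x))\<^sup>2" by (intro power_mono) auto
  then have "m / M\<^sup>2 * (norm x)\<^sup>2 \<le> m / M\<^sup>2 * (M * norm (G t x))\<^sup>2" using m by (intro mult_left_mono) auto
  also have "\<dots> = m * (norm (G t x))\<^sup>2" using M by (simp add: power_mult_distrib)
  also have "\<dots> \<le> H t (G t x) \<bullet> G t x" by (rule H_lower[OF t])
  finally show ?thesis by (simp add: HG t inner_commute)
qed

lemma evolution_on_interval:
  assumes "0 \<le> s" "s < T"
  shows "evolution D A s T (m / M\<^sup>2) H G G1 G2"
proof
  have sub: "{s..T} \<subseteq> {0..}" using assms by auto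
  fix t assume "t \<in> {s..T}"
  then have t: "0 \<le> t" using assms by auto
  show "(G has_vector_derivative G1 t) (at t within {s..T})"
    "(G1 has_vector_derivative G2 t) (at t within {s..T})"
    using G_deriv[OF t] G1_deriv[OF t] sub has_vector_derivative_within_subset by blast+
  have "H t o\<^sub>L G1 t o\<^sub>L H t = - H1 t"
    by (rule blinfun_eqI) (simp add: G1_def blinfun.bilinear_simps GH HG t)
  then show "(H has_vector_derivative - (H t o\<^sub>L G1 t o\<^sub>L H t)) (at t within {s..T})"
    using has_vector_derivative_within_subset[OF H_deriv[OF t] sub] by simp
qed (use assms m M in \<open>auto simp: GH HG simp del: times_divide_eq_left intro: continuous_on_subset[OF G2_cont] intro!: G_sym G_coercive\<close>)

text \<open>
  With \<open>u = G v\<close> the equation becomes \<open>G v' = A v + (K G - G') v\<close>, whose domain does not move.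
\<close>

lemma local_solution:
  assumes s: "0 \<le> s" "s < T" and x: "H s x \<in> D"
  obtains u u1 where "u s = x" "continuous_on {s..T} u1"
    "\<And>t. t \<in> {s..T} \<Longrightarrow> (u has_vector_derivative u1 t) (at t within {s..T})"
    "\<And>t. t \<in> {s..T} \<Longrightarrow> H t (u t) \<in> D \<and> u1 t = A (H t (u t)) + K t (u t)"
proof -
  interpret E: evolution D A s T "m / M\<^sup>2" H G G1 G2 by (rule evolution_on_interval[OF s])
  have sub: "{s..T} \<subseteq> {0..}" using s by auto
  define C where "C t = (K t o\<^sub>L G t) - G1 t" for t
  define C1 where "C1 t = ((K t o\<^sub>L G1 t) + (K1 t o\<^sub>L G t)) - G2 t" for t
  have C: "(C has_vector_derivative C1 t) (at t within {s..T})" if "t \<in> {s..T}" for t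
  proof -
    have t: "0 \<le> t" using that sub by auto
    have "(C has_vector_derivative C1 t) (at t within {0..})"
      unfolding C_def[abs_def] C1_def
      by (rule has_vector_derivative_diff[OF compose_deriv[OF K_deriv[OF t] G_deriv[OF t]] G1_deriv[OF t]])
    then show ?thesis using sub has_vector_derivative_within_subset by blast
  qed
  have C1: "continuous_on {s..T} C1"
    unfolding C1_def
    by (intro continuous_on_diff continuous_on_add compose_cont continuous_on_subset[OF K_cont sub] continuous_on_subset[OF K1_cont sub]
        continuous_on_subset[OF G_cont sub] continuous_on_subset[OF G1_cont sub] continuous_on_subset[OF G2_cont sub])
  obtain v z where v: "v s = H s x" "continuous_on {s..T} z"
    "\<And>t. t \<in> {s..T} \<Longrightarrow> (v has_vector_derivative z t) (at t within {s..T})"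
    "\<And>t. t \<in> {s..T} \<Longrightarrow> v t \<in> D \<and> G t (z t) = A (v t) + C t (v t)"
  proof (rule E.evolution_solution[OF C C1 x]) qed (assumption | rule that)+
  have v_cont: "continuous_on {s..T} v" using v(3) by (rule continuous_on_vector_derivative)
  show ?thesis
  proof (rule that)
    show "(\<lambda>t. G t (v t)) s = x" using v(1) s by (simp add: GH)
    show "continuous_on {s..T} (\<lambda>t. G t (z t) + G1 t (v t))"
      by (intro continuous_on_add apply_cont v_cont v continuous_on_subset[OF G_cont sub] continuous_on_subset[OF G1_cont sub])
    fix t assume t: "t \<in> {s..T}"
    then have t0: "0 \<le> t" using sub by auto
    show "((\<lambda>t. G t (v t)) has_vector_derivative (G t (z t) + G1 t (v t))) (at t within {s..T})"
      by (rule apply_deriv[OF E.G_deriv[OF t] v(3)[OF t]])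
    show "H t (G t (v t)) \<in> D \<and> G t (z t) + G1 t (v t) = A (H t (G t (v t))) + K t (G t (v t))"
      using v(4)[OF t] by (simp add: HG t0 C_def blinfun.bilinear_simps)
  qed
qed

section \<open>Energy estimates, uniqueness and continuous dependence\<close>

text \<open>
  The inhomogeneity \<open>g\<close> is present because differences between a solution and a curve \<open>G(t) y\<close>
  solve such an equation.
\<close>

definition solves_on :: "real \<Rightarrow> real \<Rightarrow> (real \<Rightarrow> 'a) \<Rightarrow> (real \<Rightarrow> 'a) \<Rightarrow> bool" where
  "solves_on s t g w \<longleftrightarrow> continuous_on {s..t} w \<and>
     (\<forall>r\<in>{s<..<t}. H r (w r) \<in> D \<and> (w has_vector_derivative A (H r (w r)) + K r (w r) + g r) (at r))"

lemma solves_onD: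
  assumes "solves_on s t g w"
  shows "continuous_on {s..t} w" "r \<in> {s<..<t} \<Longrightarrow> H r (w r) \<in> D"
    "r \<in> {s<..<t} \<Longrightarrow> (w has_vector_derivative A (H r (w r)) + K r (w r) + g r) (at r)"
  using assms by (simp_all add: solves_on_def)

lemma solves_on_diff:
  assumes u: "solves_on s t g u" and v: "solves_on s t h v"
  shows "solves_on s t (\<lambda>r. g r - h r) (\<lambda>r. u r - v r)"
  unfolding solves_on_def
proof (intro conjI ballI)
  show "continuous_on {s..t} (\<lambda>r. u r - v r)"
    by (intro continuous_on_diff solves_onD(1)[OF u] solves_onD(1)[OF v])
  fix r assume r: "r \<in> {s<..<t}"
  note u' = solves_onD(2,3)[OF u r] and v' = solves_onD(2,3)[OF v r]
  show "H r (u r - v r) \<in> D" using D_diff[OF u'(1) v'(1)] by (simp add: blinfun.diff_right)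
  have "A (H r (u r)) + K r (u r) + g r - (A (H r (v r)) + K r (v r) + h r) =
      A (H r (u r - v r)) + K r (u r - v r) + (g r - h r)"
    by (simp add: blinfun.diff_right A_diff[OF u'(1) v'(1)])
  with has_vector_derivative_diff[OF u'(2) v'(2)]
  show "((\<lambda>r. u r - v r) has_vector_derivative A (H r (u r - v r)) + K r (u r - v r) + (g r - h r)) (at r)"
    by (simp only:)
qed

lemma solves_on_G:
  assumes s: "0 \<le> s" and y: "y \<in> D"
  shows "solves_on s t (\<lambda>r. G1 r y - A y - K r (G r y)) (\<lambda>r. G r y)"
  unfolding solves_on_def
proof (intro conjI ballI)
  show "continuous_on {s..t} (\<lambda>r. G r y)"
    by (intro apply_cont continuous_on_const continuous_on_subset[OF G_cont]) (use s in auto)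
  fix r assume r: "r \<in> {s<..<t}"
  then have r0: "0 \<le> r" using s by auto
  show "H r (G r y) \<in> D" using y by (simp add: HG r0)
  have "at r within {0..} = at r" using r s by (intro at_within_interior) auto
  then have "(G has_vector_derivative G1 r) (at r)" using G_deriv[OF r0] by simp
  then have "((\<lambda>t. G t y) has_vector_derivative G r 0 + G1 r y) (at r)"
    by (intro apply_deriv) simp_all
  then show "((\<lambda>r. G r y) has_vector_derivative A (H r (G r y)) + K r (G r y) + (G1 r y - A y - K r (G r y))) (at r)"
    by (simp add: HG r0)
qed

text \<open>
  In the derivative of \<open>(H w | w)\<close>, the term \<open>2 (H A H w | w) = 2 (A H w | H w)\<close> drops out by dissipativity.
\<close>

lemma solution_energy_estimate:
  assumes s: "0 \<le> s" "s \<le> t" and w: "solves_on s t g w"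
    and le: "\<And>r. r \<in> {s<..<t} \<Longrightarrow>
      2 * (H r (w r) \<bullet> (K r (w r) + g r)) + H1 r (w r) \<bullet> w r \<le> k * (H r (w r) \<bullet> w r) + d"
    and k: "0 \<le> k" and d: "0 \<le> d"
  shows "H t (w t) \<bullet> w t \<le> exp (k * (t - s)) * (H s (w s) \<bullet> w s + d * (t - s))"
proof (rule energy_estimate[where ?G1.0 = H1])
  show "continuous_on {s..t} H" by (rule continuous_on_subset[OF H_cont]) (use s in auto)
  fix r assume r: "r \<in> {s<..<t}"
  then have r0: "0 \<le> r" using s by auto
  show "(w has_vector_derivative A (H r (w r)) + K r (w r) + g r) (at r)" by (rule solves_onD(3)[OF w r])
  have "at r within {0..} = at r" using r s by (intro at_within_interior) auto
  then show "(H has_vector_derivative H1 r) (at r)" using H_deriv[OF r0] by simp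
  show "H r x \<bullet> y = x \<bullet> H r y" for x y by (rule H_sym[OF r0])
  have "H r (A (H r (w r)) + K r (w r) + g r) \<bullet> w r = (A (H r (w r)) + K r (w r) + g r) \<bullet> H r (w r)"
    by (rule H_sym[OF r0])
  also have "\<dots> = A (H r (w r)) \<bullet> H r (w r) + H r (w r) \<bullet> (K r (w r) + g r)"
    by (simp add: inner_add_left inner_add_right inner_commute)
  also have "\<dots> \<le> H r (w r) \<bullet> (K r (w r) + g r)" using dissipative[OF solves_onD(2)[OF w r]] by simp
  finally show "2 * (H r (A (H r (w r)) + K r (w r) + g r) \<bullet> w r) + H1 r (w r) \<bullet> w r \<le> k * (H r (w r) \<bullet> w r) + d"
    using le[OF r] by linarith
qed (use s solves_onD(1)[OF w] k d in auto)

text \<open>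
  The power supplied through \<open>K\<close> and through the change of \<open>H\<close>, in relation to the energy. The
  quotient is the growth rate of the energy.
\<close>

lemma power_estimate:
  assumes r: "0 \<le> r" and h: "norm (H1 r) \<le> h" and \<kappa>: "norm (K r) \<le> \<kappa>"
  shows "2 * (H r w \<bullet> K r w) + H1 r w \<bullet> w \<le> (h + 2 * M * \<kappa>) / m * (H r w \<bullet> w)"
proof -
  have "0 \<le> h" "0 \<le> \<kappa>" using h \<kappa> norm_ge_zero order_trans by blast+
  have "H r w \<bullet> K r w \<le> norm (H r w) * norm (K r w)" by (rule norm_cauchy_schwarz)
  also have "\<dots> \<le> (M * norm w) * (\<kappa> * norm w)"
    using M norm_blinfun[of "K r" w] \<kappa>
    by (intro mult_mono norm_H_le r order_trans[OF norm_blinfun] mult_right_mono) auto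
  finally have 1: "H r w \<bullet> K r w \<le> M * \<kappa> * (norm w)\<^sup>2" by (simp add: power2_eq_square mult_ac)
  have "H1 r w \<bullet> w \<le> norm (H1 r w) * norm w" by (rule norm_cauchy_schwarz)
  also have "\<dots> \<le> (h * norm w) * norm w"
    using h by (intro mult_right_mono order_trans[OF norm_blinfun]) auto
  finally have 2: "H1 r w \<bullet> w \<le> h * (norm w)\<^sup>2" by (simp add: power2_eq_square mult_ac)
  have "2 * (H r w \<bullet> K r w) + H1 r w \<bullet> w \<le> (h + 2 * M * \<kappa>) * (norm w)\<^sup>2"
    using 1 2 by (simp add: algebra_simps)
  also have "\<dots> = (h + 2 * M * \<kappa>) / m * (m * (norm w)\<^sup>2)" using m by simp
  also have "\<dots> \<le> (h + 2 * M * \<kappa>) / m * (H r w \<bullet> w)"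
    using H_lower[OF r, of w] m M \<open>0 \<le> h\<close> \<open>0 \<le> \<kappa>\<close> by (intro mult_left_mono) auto
  finally show ?thesis .
qed

text \<open>
  The constant \<open>S\<close> comes first because it has to serve all pairs of initial and final times below \<open>T\<close>.
  The condition on \<open>b\<close> says that an inhomogeneity of size \<open>\<beta>\<close> contributes \<open>\<beta> sqrt (t - s)\<close>, which is
  small on short intervals.
\<close>

lemma norm_estimate:
  assumes T: "0 \<le> T"
  shows "\<exists>S\<ge>1. \<forall>s t g w \<beta> b. 0 \<le> s \<longrightarrow> s \<le> t \<longrightarrow> t \<le> T \<longrightarrow> solves_on s t g w \<longrightarrow>
      (\<forall>r\<in>{s<..<t}. norm (g r) \<le> \<beta>) \<longrightarrow> 0 \<le> b \<longrightarrow> \<beta>\<^sup>2 * (t - s) \<le> b\<^sup>2 \<longrightarrow>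
      norm (w t) \<le> S * (norm (w s) + b)"
proof -
  obtain h where h: "0 \<le> h" "\<And>t. t \<in> {0..T} \<Longrightarrow> norm (H1 t) \<le> h"
    by (rule bounded_on_compact_interval[OF continuous_on_subset[OF H1_cont, of "{0..T}"]]) auto
  obtain \<kappa> where \<kappa>: "0 \<le> \<kappa>" "\<And>t. t \<in> {0..T} \<Longrightarrow> norm (K t) \<le> \<kappa>"
    by (rule bounded_on_compact_interval[OF continuous_on_subset[OF K_cont, of "{0..T}"]]) auto
  \<comment> \<open>\<open>M / m\<close> pays for the inhomogeneity, by \<open>2 (H w | g) \<le> M (|w|\<^sup>2 + \<beta>\<^sup>2)\<close>\<close>
  define k where "k = (h + 2 * M * \<kappa>) / m + M / m"
  have k: "0 \<le> k" using h \<kappa> m M by (simp add: k_def)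
  define S where "S = sqrt (exp (k * T) * M / m) + 1"
  have S: "1 \<le> S" "exp (k * T) * M / m \<le> S\<^sup>2"
  proof -
    have q: "0 \<le> exp (k * T) * M / m" using m M by simp
    then show "1 \<le> S" by (simp add: S_def)
    have "exp (k * T) * M / m = (sqrt (exp (k * T) * M / m))\<^sup>2" using q by simp
    also have "\<dots> \<le> S\<^sup>2" unfolding S_def using q by (intro power_mono) auto
    finally show "exp (k * T) * M / m \<le> S\<^sup>2" .
  qed
  show ?thesis
  proof (intro exI[of _ S] conjI allI impI S(1))
    fix s t \<beta> b :: real and g w
    assume s: "0 \<le> s" "s \<le> t" "t \<le> T" and w: "solves_on s t g w"
      and g': "\<forall>r\<in>{s<..<t}. norm (g r) \<le> \<beta>" and b: "0 \<le> b" "\<beta>\<^sup>2 * (t - s) \<le> b\<^sup>2"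
    note g = bspec[OF g']
    have "H t (w t) \<bullet> w t \<le> exp (k * (t - s)) * (H s (w s) \<bullet> w s + (M * \<beta>\<^sup>2) * (t - s))"
    proof (rule solution_energy_estimate[OF s(1,2) w _ k])
      fix r assume r: "r \<in> {s<..<t}"
      then have r0: "0 \<le> r" and rT: "r \<in> {0..T}" using s by auto
      have "2 * (H r (w r) \<bullet> g r) \<le> 2 * (norm (H r (w r)) * norm (g r))"
        by (intro mult_left_mono norm_cauchy_schwarz) simp
      also have "\<dots> \<le> 2 * ((M * norm (w r)) * \<beta>)"
        using M by (intro mult_left_mono mult_mono norm_H_le r0 g r) auto
      also have "\<dots> = M * (2 * norm (w r) * \<beta>)" by simp
      also have "\<dots> \<le> M * ((norm (w r))\<^sup>2 + \<beta>\<^sup>2)"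
        using M by (intro mult_left_mono sum_squares_bound) auto
      also have "\<dots> \<le> M / m * (H r (w r) \<bullet> w r) + M * \<beta>\<^sup>2"
      proof -
        have "M * (norm (w r))\<^sup>2 = M / m * (m * (norm (w r))\<^sup>2)" using m by simp
        also have "\<dots> \<le> M / m * (H r (w r) \<bullet> w r)" using m M by (intro mult_left_mono H_lower r0) auto
        finally show ?thesis by (simp add: distrib_left)
      qed
      finally show "2 * (H r (w r) \<bullet> (K r (w r) + g r)) + H1 r (w r) \<bullet> w r \<le> k * (H r (w r) \<bullet> w r) + M * \<beta>\<^sup>2"
        using power_estimate[OF r0 h(2)[OF rT] \<kappa>(2)[OF rT], of "w r"]
        by (simp add: k_def inner_add_right distrib_right)
    qed (use M in auto)
    also have "\<dots> \<le> exp (k * T) * (M * (norm (w s))\<^sup>2 + M * b\<^sup>2)"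
    proof (rule mult_mono)
      show "exp (k * (t - s)) \<le> exp (k * T)" using k s by (simp add: mult_left_mono)
      have "(M * \<beta>\<^sup>2) * (t - s) \<le> M * b\<^sup>2" using b M by (simp add: mult.assoc)
      then show "H s (w s) \<bullet> w s + (M * \<beta>\<^sup>2) * (t - s) \<le> M * (norm (w s))\<^sup>2 + M * b\<^sup>2"
        using H_upper[OF s(1)] by (intro add_mono) auto
      have "0 \<le> m * (norm (w s))\<^sup>2" using m by simp
      also have "\<dots> \<le> H s (w s) \<bullet> w s" by (rule H_lower[OF s(1)])
      finally show "0 \<le> H s (w s) \<bullet> w s + (M * \<beta>\<^sup>2) * (t - s)" using M s by simp
    qed simp
    finally have "m * (norm (w t))\<^sup>2 \<le> exp (k * T) * (M * ((norm (w s))\<^sup>2 + b\<^sup>2))"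
      using H_lower[of t "w t"] s by (simp add: distrib_left)
    then have "(norm (w t))\<^sup>2 \<le> exp (k * T) * M / m * ((norm (w s))\<^sup>2 + b\<^sup>2)"
      using m by (simp add: field_simps)
    also have "\<dots> \<le> S\<^sup>2 * (norm (w s) + b)\<^sup>2"
      using S b by (intro mult_mono) (auto simp: power2_sum)
    finally have "(norm (w t))\<^sup>2 \<le> (S * (norm (w s) + b))\<^sup>2" by (simp add: power_mult_distrib)
    then show "norm (w t) \<le> S * (norm (w s) + b)"
      by (rule power2_le_imp_le) (use S b in auto)
  qed
qed

definition solves :: "real \<Rightarrow> (real \<Rightarrow> 'a) \<Rightarrow> bool" where
  "solves s u \<longleftrightarrow> continuous_on {s..} u \<and> (\<forall>t\<ge>s. H t (u t) \<in> D) \<and>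
     (\<forall>t>s. (u has_vector_derivative A (H t (u t)) + K t (u t)) (at t))"

lemma solves_imp_solves_on:
  assumes "solves r u" "r \<le> s"
  shows "solves_on s t (\<lambda>_. 0) u"
  using assms by (auto simp: solves_def solves_on_def intro: continuous_on_subset)

lemma energy_exponential_bound:
  assumes u: "solves r u" and s: "0 \<le> r" "r \<le> s" "s \<le> t"
    and h: "\<And>r. r \<in> {s..t} \<Longrightarrow> norm (H1 r) \<le> h" and \<kappa>: "\<And>r. r \<in> {s..t} \<Longrightarrow> norm (K r) \<le> \<kappa>"
  shows "H t (u t) \<bullet> u t \<le> exp ((h + 2 * M * \<kappa>) / m * (t - s)) * (H s (u s) \<bullet> u s)"
proof -
  have h0: "0 \<le> h" by (rule order_trans[OF norm_ge_zero h[of s]]) (use s in simp)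
  have \<kappa>0: "0 \<le> \<kappa>" by (rule order_trans[OF norm_ge_zero \<kappa>[of s]]) (use s in simp)
  have "H t (u t) \<bullet> u t \<le> exp ((h + 2 * M * \<kappa>) / m * (t - s)) * (H s (u s) \<bullet> u s + 0 * (t - s))"
  proof (rule solution_energy_estimate[OF _ s(3) solves_imp_solves_on[OF u s(2)]])
    fix q assume q: "q \<in> {s<..<t}"
    then have "0 \<le> q" "q \<in> {s..t}" using s by auto
    from power_estimate[OF this(1) h[OF this(2)] \<kappa>[OF this(2)], of "u q"]
    show "2 * (H q (u q) \<bullet> (K q (u q) + 0)) + H1 q (u q) \<bullet> u q \<le> (h + 2 * M * \<kappa>) / m * (H q (u q) \<bullet> u q) + 0"
      by simp
  qed (use s h0 \<kappa>0 m M in auto)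
  then show ?thesis by simp
qed

lemma energy_nonincreasing:
  assumes u: "solves r u" and s: "0 \<le> r" "r \<le> s" "s \<le> t"
    and le: "\<And>r x. 0 \<le> r \<Longrightarrow> 2 * (H r x \<bullet> K r x) + H1 r x \<bullet> x \<le> 0"
  shows "H t (u t) \<bullet> u t \<le> H s (u s) \<bullet> u s"
proof -
  have "H t (u t) \<bullet> u t \<le> exp (0 * (t - s)) * (H s (u s) \<bullet> u s + 0 * (t - s))"
  proof (rule solution_energy_estimate[OF _ s(3) solves_imp_solves_on[OF u s(2)]])
    fix q assume "q \<in> {s<..<t}"
    then show "2 * (H q (u q) \<bullet> (K q (u q) + 0)) + H1 q (u q) \<bullet> u q \<le> 0 * (H q (u q) \<bullet> u q) + 0"
      using le[of q "u q"] s by simp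
  qed (use s in auto)
  then show ?thesis by simp
qed

lemma solves_on_stable:
  assumes T: "0 \<le> T"
  shows "\<exists>S\<ge>1. \<forall>s t u v. 0 \<le> s \<longrightarrow> s \<le> t \<longrightarrow> t \<le> T \<longrightarrow> solves_on s t (\<lambda>_. 0) u \<longrightarrow> solves_on s t (\<lambda>_. 0) v \<longrightarrow>
       norm (u t - v t) \<le> S * norm (u s - v s)"
proof -
  obtain S where S: "1 \<le> S" "\<And>s t g w \<beta> b. 0 \<le> s \<Longrightarrow> s \<le> t \<Longrightarrow> t \<le> T \<Longrightarrow> solves_on s t g w \<Longrightarrow>
      (\<forall>r\<in>{s<..<t}. norm (g r) \<le> \<beta>) \<Longrightarrow> 0 \<le> b \<Longrightarrow> \<beta>\<^sup>2 * (t - s) \<le> b\<^sup>2 \<Longrightarrow>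
      norm (w t) \<le> S * (norm (w s) + b)"
    using norm_estimate[OF T] by blast
  have "norm (u t - v t) \<le> S * (norm (u s - v s) + 0)"
    if "0 \<le> s" "s \<le> t" "t \<le> T" and u: "solves_on s t (\<lambda>_. 0) u" and v: "solves_on s t (\<lambda>_. 0) v" for s t u v
    by (rule S(2)[where w = "\<lambda>r. u r - v r" and \<beta> = 0, OF that(1-3) solves_on_diff[OF u v]]) auto
  then show ?thesis using S(1) by auto
qed

lemma solves_on_unique:
  assumes s: "0 \<le> s" "s \<le> t" and u: "solves_on s t (\<lambda>_. 0) u" and v: "solves_on s t (\<lambda>_. 0) v" and eq: "u s = v s"
  shows "u t = v t"
proof -
  have "0 \<le> t" using s by simp
  from solves_on_stable[OF this] obtain S where "norm (u t - v t) \<le> S * norm (u s - v s)"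
    using s u v by blast
  then show ?thesis using eq by simp
qed

lemma solves_unique:
  assumes "0 \<le> s" "s \<le> t" "solves s u" "solves s v" "u s = v s"
  shows "u t = v t"
  using solves_on_unique[OF assms(1,2) solves_imp_solves_on[OF assms(3)] solves_imp_solves_on[OF assms(4)] assms(5)]
  by simp

lemma solves_on_subinterval: "solves_on s T g u \<Longrightarrow> t \<le> T \<Longrightarrow> solves_on s t g u"
  by (auto simp: solves_on_def intro: continuous_on_subset)

text \<open>
  By uniqueness, the solutions on the intervals \<open>[s, s + 1 + n]\<close> fit together.
\<close>

lemma global_solution:
  assumes s: "0 \<le> s" and x: "H s x \<in> D"
  obtains u where "solves s u" "u s = x" "continuous_on {s..} (\<lambda>t. A (H t (u t)) + K t (u t))"
proof -
  define T where "T n = s + 1 + real n" for n :: nat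
  define P where "P n u \<longleftrightarrow> u s = x \<and> continuous_on {s..T n} (\<lambda>t. A (H t (u t)) + K t (u t)) \<and>
     (\<forall>t\<in>{s..T n}. H t (u t) \<in> D \<and>
        (u has_vector_derivative A (H t (u t)) + K t (u t)) (at t within {s..T n}))" for n :: nat and u
  have "\<exists>u. P n u" for n
  proof -
    have less: "s < T n" by (simp add: T_def)
    obtain u u1 where u: "u s = x" "continuous_on {s..T n} u1"
      "\<And>t. t \<in> {s..T n} \<Longrightarrow> (u has_vector_derivative u1 t) (at t within {s..T n})"
      "\<And>t. t \<in> {s..T n} \<Longrightarrow> H t (u t) \<in> D \<and> u1 t = A (H t (u t)) + K t (u t)"
    proof (rule local_solution[OF s less x]) qed (rule that)
    have "continuous_on {s..T n} (\<lambda>t. A (H t (u t)) + K t (u t))"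
      using u(2) by (rule continuous_on_eq) (use u(4) in blast)
    moreover have "H t (u t) \<in> D \<and>
        (u has_vector_derivative A (H t (u t)) + K t (u t)) (at t within {s..T n})"
      if "t \<in> {s..T n}" for t
      using u(3)[OF that] u(4)[OF that] by simp
    ultimately show ?thesis using u(1) unfolding P_def by blast
  qed
  then obtain v where v: "\<And>n. P n (v n)" by metis
  have v_deriv: "(v n has_vector_derivative A (H t (v n t)) + K t (v n t)) (at t within {s..T n})"
    and v_D: "H t (v n t) \<in> D" if "t \<in> {s..T n}" for n t
    using v[of n] that by (auto simp: P_def)
  have at: "at t within {s..T n} = at t" if "s < t" "t < T n" for t n
    using that by (intro at_within_interior) auto
  have v_solves: "solves_on s (T n) (\<lambda>_. 0) (v n)" for n
    unfolding solves_on_def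
  proof (intro conjI ballI)
    show "continuous_on {s..T n} (v n)" using v_deriv by (rule continuous_on_vector_derivative)
    fix r assume "r \<in> {s<..<T n}"
    then show "H r (v n r) \<in> D" "(v n has_vector_derivative A (H r (v n r)) + K r (v n r) + 0) (at r)"
      using v_D[of r n] v_deriv[of r n] at[of r n] by auto
  qed
  have v_agree: "v n t = v k t" if "t \<in> {s..T n}" "t \<in> {s..T k}" for n k t
    by (rule solves_on_unique[OF s _ solves_on_subinterval[OF v_solves] solves_on_subinterval[OF v_solves]])
      (use that v in \<open>auto simp: P_def\<close>)
  \<comment> \<open>index of an interval that contains \<open>t\<close> and a neighbourhood of it in \<open>[s,\<infinity>)\<close>\<close>
  define N where "N t = nat \<lceil>t - s\<rceil>" for t
  have N: "t < T (N t)" for t unfolding N_def T_def by linarith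
  define u where "u t = v (N t) t" for t
  have u_eq: "u t = v n t" if "t \<in> {s..T n}" for t n
    unfolding u_def by (rule v_agree) (use that N[of t] in auto)
  have local: "at t within {s..} = at t within {s..T (N t)}" if "s \<le> t" for t
    by (rule at_within_nhd[of _ "{..<T (N t)}"]) (use N[of t] in auto)
  show ?thesis
  proof (rule that[of u])
    show "u s = x" using u_eq[of s 0] v[of 0] by (simp add: T_def P_def)
    show "continuous_on {s..} (\<lambda>t. A (H t (u t)) + K t (u t))"
      unfolding continuous_on_eq_continuous_within
    proof
      fix t assume "t \<in> {s..}"
      then have t: "s \<le> t" "t \<in> {s..T (N t)}" using N[of t] by auto
      have "continuous_on {s..T (N t)} (\<lambda>r. A (H r (v (N t) r)) + K r (v (N t) r))"
        using v by (simp add: P_def)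
      then have "continuous_on {s..T (N t)} (\<lambda>r. A (H r (u r)) + K r (u r))"
        by (rule continuous_on_eq) (simp add: u_eq[where n = "N t"])
      then show "continuous (at t within {s..}) (\<lambda>t. A (H t (u t)) + K t (u t))"
        using t by (simp add: local continuous_on_eq_continuous_within)
    qed
    show "solves s u"
      unfolding solves_def
    proof (intro conjI allI impI)
      have deriv: "(u has_vector_derivative A (H t (u t)) + K t (u t)) (at t within {s..})" if "s \<le> t" for t
      proof -
        have t: "t \<in> {s..T (N t)}" using N[of t] that by auto
        have "(v (N t) has_vector_derivative A (H t (u t)) + K t (u t)) (at t within {s..T (N t)})"
          using v_deriv[OF t] by (simp add: u_eq[OF t])
        then have "(u has_vector_derivative A (H t (u t)) + K t (u t)) (at t within {s..T (N t)})"
          by (rule has_vector_derivative_transform[OF t, rotated]) (rule u_eq)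
        then show ?thesis using that by (simp add: local)
      qed
      then show "continuous_on {s..} u" by (intro continuous_on_vector_derivative) auto
      fix t
      show "H t (u t) \<in> D" if "s \<le> t"
        using v_D[of t "N t"] that N[of t] by (simp add: u_def)
      show "(u has_vector_derivative A (H t (u t)) + K t (u t)) (at t)" if "s < t"
      proof -
        have "at t within {s..} = at t" using that by (intro at_within_interior) auto
        then show ?thesis using deriv[of t] that by simp
      qed
    qed
  qed
qed

text \<open>
  Initial values at different times lie in different domains, and a solution starting at \<open>s\<close> need
  not extend to earlier times. The curve \<open>G(t) y\<close> is defined at all times and replaces it there.
\<close>

lemma solution_near_G:
  assumes T: "0 \<le> T" and y: "y \<in> D"
  shows "\<exists>\<beta>\<ge>0. \<exists>S\<ge>1. \<forall>s t u b. 0 \<le> s \<longrightarrow> s \<le> t \<longrightarrow> t \<le> T \<longrightarrow> solves_on s t (\<lambda>_. 0) u \<longrightarrow>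
      0 \<le> b \<longrightarrow> \<beta>\<^sup>2 * (t - s) \<le> b\<^sup>2 \<longrightarrow> norm (u t - G t y) \<le> S * (norm (u s - G s y) + b)"
proof -
  obtain S where S: "1 \<le> S" "\<And>s t g w \<beta> b. 0 \<le> s \<Longrightarrow> s \<le> t \<Longrightarrow> t \<le> T \<Longrightarrow> solves_on s t g w \<Longrightarrow>
      (\<forall>r\<in>{s<..<t}. norm (g r) \<le> \<beta>) \<Longrightarrow> 0 \<le> b \<Longrightarrow> \<beta>\<^sup>2 * (t - s) \<le> b\<^sup>2 \<Longrightarrow>
      norm (w t) \<le> S * (norm (w s) + b)"
    using norm_estimate[OF T] by blast
  define g where "g r = 0 - (G1 r y - A y - K r (G r y))" for r
  have sub: "{0..T} \<subseteq> {0..}" by auto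
  have "continuous_on {0..T} g"
    unfolding g_def
    by (intro continuous_on_diff continuous_on_const apply_cont
        continuous_on_subset[OF K_cont sub] continuous_on_subset[OF G_cont sub] continuous_on_subset[OF G1_cont sub])
  then obtain \<beta> where \<beta>: "0 \<le> \<beta>" "\<And>r. r \<in> {0..T} \<Longrightarrow> norm (g r) \<le> \<beta>"
    by (rule bounded_on_compact_interval) blast
  have "norm (u t - G t y) \<le> S * (norm (u s - G s y) + b)"
    if s: "0 \<le> s" "s \<le> t" "t \<le> T" and u: "solves_on s t (\<lambda>_. 0) u" and b: "0 \<le> b" "\<beta>\<^sup>2 * (t - s) \<le> b\<^sup>2" for s t u b
  proof (rule S(2)[OF s, where w = "\<lambda>r. u r - G r y" and g = g and \<beta> = \<beta>])
    show "solves_on s t g (\<lambda>r. u r - G r y)"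
      unfolding g_def by (rule solves_on_diff[OF u solves_on_G[OF s(1) y]])
    show "\<forall>r\<in>{s<..<t}. norm (g r) \<le> \<beta>" using \<beta>(2) s by auto
  qed (use b in auto)
  then show ?thesis using S(1) \<beta>(1) by blast
qed

text \<open>
  Between the two initial times \<open>sk k\<close> and \<open>s\<close> solutions hardly move: \<open>u\<close> by its continuity, and \<open>uk k\<close>,
  for which this has to be uniform in \<open>k\<close>, by comparison with \<open>G(t) y\<close>. From the later of
  the two times on, stability for equal initial times applies.
\<close>

lemma continuous_dependence:
  assumes sk: "\<And>k::nat. 0 \<le> sk k" "\<And>k. solves (sk k) (uk k)"
    and s: "0 \<le> s" and u: "solves s u"
    and sk_lim: "sk \<longlonglongrightarrow> s" and x_lim: "(\<lambda>k. uk k (sk k)) \<longlonglongrightarrow> u s" and e: "0 < e"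
  shows "\<forall>\<^sub>F k in sequentially. \<forall>t\<in>{0..T}.
    norm ((if sk k \<le> t then uk k t else uk k (sk k)) - (if s \<le> t then u t else u s)) < e"
proof -
  define T' where "T' = max T (s + 1)"
  have T': "0 \<le> T'" "T \<le> T'" "s + 1 \<le> T'" using s by (auto simp: T'_def)
  define y where "y = H s (u s)"
  have y: "y \<in> D" unfolding y_def using u by (simp add: solves_def)
  have G_s: "G s y = u s" using s by (simp add: y_def GH)
  obtain S1 where S1: "1 \<le> S1" "\<And>s t u v. 0 \<le> s \<Longrightarrow> s \<le> t \<Longrightarrow> t \<le> T' \<Longrightarrow> solves_on s t (\<lambda>_. 0) u \<Longrightarrow>
       solves_on s t (\<lambda>_. 0) v \<Longrightarrow> norm (u t - v t) \<le> S1 * norm (u s - v s)"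
    using solves_on_stable[OF T'(1)] by blast
  obtain \<beta> S2 where \<beta>: "0 \<le> \<beta>" and S2: "1 \<le> S2" "\<And>s t u b. 0 \<le> s \<Longrightarrow> s \<le> t \<Longrightarrow> t \<le> T' \<Longrightarrow>
      solves_on s t (\<lambda>_. 0) u \<Longrightarrow> 0 \<le> b \<Longrightarrow> \<beta>\<^sup>2 * (t - s) \<le> b\<^sup>2 \<Longrightarrow> norm (u t - G t y) \<le> S2 * (norm (u s - G s y) + b)"
    using solution_near_G[OF T'(1) y] by blast
  \<comment> \<open>in each of the five cases below, the error is at most \<open>4 S1 S2 d\<close>\<close>
  define d where "d = e / (5 * S1 * S2)"
  have SS: "1 \<le> S1 * S2" using mult_mono[of 1 S1 1 S2] S1(1) S2(1) by simp
  have d: "0 < d" using e S1(1) S2(1) by (simp add: d_def)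
  define q where "q = S1 * S2 * d"
  have e_eq: "e = 5 * q" using S1(1) S2(1) by (simp add: d_def q_def)
  have d_le: "d \<le> q" using mult_right_mono[OF SS, of d] d by (simp add: q_def)
  have S1d_le: "S1 * d \<le> q" and S2d_le: "S2 * d \<le> q" using S1 S2 d by (simp_all add: q_def)
  have "continuous_on {0..} (\<lambda>t. G t y)" by (rule apply_cont[OF G_cont continuous_on_const])
  then have "\<exists>\<delta>>0. \<forall>t\<in>{0..}. dist t s < \<delta> \<longrightarrow> dist (G t y) (G s y) < d"
    unfolding continuous_on_iff using s d by simp
  then obtain \<delta>1 where \<delta>1: "0 < \<delta>1"
    "\<And>t. 0 \<le> t \<Longrightarrow> \<bar>t - s\<bar> < \<delta>1 \<Longrightarrow> norm (G t y - u s) < d"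
    by (auto simp: dist_norm G_s)
  have "continuous_on {s..} u" using u by (simp add: solves_def)
  then have "\<exists>\<delta>>0. \<forall>t\<in>{s..}. dist t s < \<delta> \<longrightarrow> dist (u t) (u s) < d"
    unfolding continuous_on_iff using d by simp
  then obtain \<delta>2 where \<delta>2: "0 < \<delta>2"
    "\<And>t. s \<le> t \<Longrightarrow> \<bar>t - s\<bar> < \<delta>2 \<Longrightarrow> norm (u t - u s) < d"
    by (auto simp: dist_norm)
  define \<delta>3 where "\<delta>3 = d\<^sup>2 / (\<beta>\<^sup>2 + 1)"
  have b1: "0 < \<beta>\<^sup>2 + 1" by (simp add: add_nonneg_pos)
  have \<delta>3: "0 < \<delta>3" "r < \<delta>3 \<Longrightarrow> 0 \<le> r \<Longrightarrow> \<beta>\<^sup>2 * r \<le> d\<^sup>2" for r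
  proof -
    show "0 < \<delta>3" using d b1 by (simp add: \<delta>3_def)
    assume r: "r < \<delta>3" "0 \<le> r"
    then have "(\<beta>\<^sup>2 + 1) * r < d\<^sup>2" using b1 by (simp add: \<delta>3_def pos_less_divide_eq mult.commute)
    then show "\<beta>\<^sup>2 * r \<le> d\<^sup>2" using r by (simp add: distrib_right)
  qed
  define \<delta> where "\<delta> = min (min \<delta>1 \<delta>2) (min \<delta>3 1)"
  have \<delta>: "0 < \<delta>" using \<delta>1(1) \<delta>2(1) \<delta>3(1) by (simp add: \<delta>_def)
  have "\<forall>\<^sub>F k in sequentially. dist (sk k) s < \<delta>" "\<forall>\<^sub>F k in sequentially. dist (uk k (sk k)) (u s) < d"
    using tendstoD[OF sk_lim \<delta>] tendstoD[OF x_lim d] by auto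
  then show ?thesis
  proof eventually_elim
    case (elim k)
    have close: "\<bar>sk k - s\<bar> < \<delta>" and xk: "norm (uk k (sk k) - u s) < d"
      using elim by (auto simp: dist_norm)
    note uk = solves_imp_solves_on[OF sk(2)[of k]] and us = solves_imp_solves_on[OF u]
    \<comment> \<open>\<open>uk k\<close> before time \<open>s\<close>, where \<open>u\<close> need not solve the equation\<close>
    have early: "norm (uk k t - G t y) \<le> 3 * (S2 * d)" if t: "sk k \<le> t" "t \<le> s" for t
    proof -
      have "\<beta>\<^sup>2 * (t - sk k) \<le> d\<^sup>2" using close t by (intro \<delta>3) (auto simp: \<delta>_def)
      then have "norm (uk k t - G t y) \<le> S2 * (norm (uk k (sk k) - G (sk k) y) + d)"
        using t T' d by (intro S2(2)[OF sk(1)] uk) auto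
      also have "\<dots> \<le> S2 * (2 * d + d)"
      proof (intro mult_left_mono add_right_mono)
        have "norm (G (sk k) y - u s) < d" using close by (intro \<delta>1 sk) (auto simp: \<delta>_def)
        then show "norm (uk k (sk k) - G (sk k) y) \<le> 2 * d"
          using norm_triangle_ineq4[of "uk k (sk k) - u s" "G (sk k) y - u s"] xk by simp
      qed (use S2 in auto)
      finally show ?thesis by (simp add: algebra_simps)
    qed
    show ?case
    proof
      fix t assume t: "t \<in> {0..T}"
      consider "t < sk k" "t < s" | "sk k \<le> t" "t < s" | "t < sk k" "s \<le> t" | "sk k \<le> s" "s \<le> t" | "s \<le> sk k" "sk k \<le> t"
        by linarith
      then show "norm ((if sk k \<le> t then uk k t else uk k (sk k)) - (if s \<le> t then u t else u s)) < e"
      proof cases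
        case 1
        then show ?thesis using xk d d_le by (simp add: e_eq)
      next
        case 2
        have "norm (G t y - u s) < d" using close 2 t by (intro \<delta>1) (auto simp: \<delta>_def)
        moreover have "norm (uk k t - G t y) \<le> 3 * (S2 * d)" using 2 by (intro early) auto
        ultimately have "norm (uk k t - u s) < 3 * (S2 * d) + d"
          using norm_triangle_ineq[of "uk k t - G t y" "G t y - u s"] by simp
        then show ?thesis using 2 d_le S2d_le d by (simp add: e_eq)
      next
        case 3
        have "norm (u t - u s) < d" using close 3 by (intro \<delta>2) (auto simp: \<delta>_def)
        then have "norm (uk k (sk k) - u t) < d + d"
          using norm_triangle_ineq4[of "uk k (sk k) - u s" "u t - u s"] xk by simp
        then show ?thesis using 3 d_le d by (simp add: e_eq)
      next
        case 4
        have "norm (uk k t - u t) \<le> S1 * norm (uk k s - u s)"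
          using 4 t T' s by (intro S1(2) uk us) auto
        also have "\<dots> \<le> S1 * (3 * (S2 * d))"
          using early[of s] 4 S1(1) by (intro mult_left_mono) (auto simp: G_s)
        also have "\<dots> = 3 * q" by (simp add: q_def)
        also have "\<dots> < e" using d d_le by (simp add: e_eq)
        finally show ?thesis using 4 by simp
      next
        case 5
        have "norm (u (sk k) - u s) < d" using close 5 by (intro \<delta>2) (auto simp: \<delta>_def)
        then have "norm (uk k (sk k) - u (sk k)) \<le> 2 * d"
          using norm_triangle_ineq4[of "uk k (sk k) - u s" "u (sk k) - u s"] xk by simp
        then have "S1 * norm (uk k (sk k) - u (sk k)) \<le> S1 * (2 * d)"
          using S1(1) by (intro mult_left_mono) auto
        moreover have "norm (uk k t - u t) \<le> S1 * norm (uk k (sk k) - u (sk k))"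
          using 5 t T' sk by (intro S1(2) uk us) auto
        ultimately have "norm (uk k t - u t) \<le> 2 * (S1 * d)" by simp
        moreover have "0 < S1 * d" using S1(1) d by simp
        ultimately show ?thesis using 5 S1d_le by (simp add: e_eq)
      qed
    qed
  qed
qed

end

section \<open>The Hilbert space of square integrable functions on the line\<close>

text \<open>
  The interval \<open>[a,b]\<close> consists of values and cannot index a type, so the Hilbert space is formed of functions
  on the real line.
\<close>

definition sq_int :: "(real \<Rightarrow> 'v::euclidean_space) set" where
  "sq_int = {f. f \<in> borel_measurable lebesgue \<and> integrable lebesgue (\<lambda>x. (norm (f x))\<^sup>2)}"

lemma sq_int_measurable: "f \<in> sq_int \<Longrightarrow> f \<in> borel_measurable lebesgue"
  by (simp add: sq_int_def)

lemma sq_int_dominated: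
  assumes f: "f \<in> borel_measurable lebesgue" and g: "integrable lebesgue g"
    and le: "AE x in lebesgue. (norm (f x))\<^sup>2 \<le> g x"
  shows "f \<in> sq_int"
  unfolding sq_int_def
proof (intro CollectI conjI f)
  show "integrable lebesgue (\<lambda>x. (norm (f x))\<^sup>2)"
    by (rule Bochner_Integration.integrable_bound[OF g]) (use f le in auto)
qed

lemma sq_int_add:
  assumes "f \<in> sq_int" "g \<in> sq_int" shows "(\<lambda>x. f x + g x) \<in> sq_int"
proof (rule sq_int_dominated)
  show "(\<lambda>x. f x + g x) \<in> borel_measurable lebesgue" using assms by (auto simp: sq_int_def)
  show "integrable lebesgue (\<lambda>x. 2 * (norm (f x))\<^sup>2 + 2 * (norm (g x))\<^sup>2)" using assms by (auto simp: sq_int_def)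
  have "(norm (f x + g x))\<^sup>2 \<le> 2 * (norm (f x))\<^sup>2 + 2 * (norm (g x))\<^sup>2" for x
  proof -
    have "(norm (f x + g x))\<^sup>2 \<le> (norm (f x) + norm (g x))\<^sup>2" by (intro power_mono norm_triangle_ineq) auto
    also have "\<dots> \<le> 2 * (norm (f x))\<^sup>2 + 2 * (norm (g x))\<^sup>2"
      using sum_squares_bound[of "norm (f x)" "norm (g x)"] by (simp add: power2_sum)
    finally show ?thesis .
  qed
  then show "AE x in lebesgue. (norm (f x + g x))\<^sup>2 \<le> 2 * (norm (f x))\<^sup>2 + 2 * (norm (g x))\<^sup>2" by simp
qed

lemma sq_int_scaleR: "f \<in> sq_int \<Longrightarrow> (\<lambda>x. c *\<^sub>R f x) \<in> sq_int"
  by (auto simp: sq_int_def power_mult_distrib)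

lemma sq_int_uminus: "f \<in> sq_int \<Longrightarrow> (\<lambda>x. - f x) \<in> sq_int"
  by (auto simp: sq_int_def)

lemma sq_int_diff: "f \<in> sq_int \<Longrightarrow> g \<in> sq_int \<Longrightarrow> (\<lambda>x. f x - g x) \<in> sq_int"
  using sq_int_add[OF _ sq_int_uminus[of g], of f] by simp

lemma sq_int_0: "(\<lambda>x. 0) \<in> sq_int"
  by (simp add: sq_int_def)

lemma sq_int_inner_integrable:
  assumes "f \<in> sq_int" "g \<in> sq_int" shows "integrable lebesgue (\<lambda>x. f x \<bullet> g x)"
proof (rule Bochner_Integration.integrable_bound)
  show "integrable lebesgue (\<lambda>x. (norm (f x))\<^sup>2 + (norm (g x))\<^sup>2)" using assms by (auto simp: sq_int_def)
  show "(\<lambda>x. f x \<bullet> g x) \<in> borel_measurable lebesgue" using assms by (auto simp: sq_int_def)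
  have "\<bar>f x \<bullet> g x\<bar> \<le> (norm (f x))\<^sup>2 + (norm (g x))\<^sup>2" for x
  proof -
    have "\<bar>f x \<bullet> g x\<bar> \<le> norm (f x) * norm (g x)" by (rule Cauchy_Schwarz_ineq2)
    also have "\<dots> \<le> 2 * norm (f x) * norm (g x)" by simp
    also have "\<dots> \<le> (norm (f x))\<^sup>2 + (norm (g x))\<^sup>2" by (rule sum_squares_bound)
    finally show ?thesis .
  qed
  then show "AE x in lebesgue. norm (f x \<bullet> g x) \<le> norm ((norm (f x))\<^sup>2 + (norm (g x))\<^sup>2)" by simp
qed

quotient_type (overloaded) 'v l2 = "real \<Rightarrow> 'v::euclidean_space" / partial:
  "\<lambda>f g. f \<in> sq_int \<and> g \<in> sq_int \<and> (AE x in lebesgue. f x = g x)"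
proof (rule part_equivpI)
  show "\<exists>f :: real \<Rightarrow> 'v. f \<in> sq_int \<and> f \<in> sq_int \<and> (AE x in lebesgue. f x = f x)"
    using sq_int_0 by auto
qed (auto simp: symp_def transp_def elim: AE_mp)

instantiation l2 :: (euclidean_space) real_vector
begin

lift_definition zero_l2 :: "'a l2" is "\<lambda>x. 0" by (simp add: sq_int_0)
lift_definition plus_l2 :: "'a l2 \<Rightarrow> 'a l2 \<Rightarrow> 'a l2" is "\<lambda>f g x. f x + g x"
  by (auto intro: sq_int_add)
lift_definition minus_l2 :: "'a l2 \<Rightarrow> 'a l2 \<Rightarrow> 'a l2" is "\<lambda>f g x. f x - g x"
  by (auto intro: sq_int_diff)
lift_definition uminus_l2 :: "'a l2 \<Rightarrow> 'a l2" is "\<lambda>f x. - f x"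
  by (auto intro: sq_int_uminus)
lift_definition scaleR_l2 :: "real \<Rightarrow> 'a l2 \<Rightarrow> 'a l2" is "\<lambda>c f x. c *\<^sub>R f x"
  by (auto intro: sq_int_scaleR)

instance
  by (standard; transfer)
    (auto simp: algebra_simps intro: sq_int_add sq_int_scaleR sq_int_0 sq_int_diff sq_int_uminus)

end

instantiation l2 :: (euclidean_space) real_inner
begin

lift_definition inner_l2 :: "'a l2 \<Rightarrow> 'a l2 \<Rightarrow> real" is "\<lambda>f g. LINT x|lebesgue. f x \<bullet> g x"
  by (intro integral_cong_AE borel_measurable_inner sq_int_measurable) auto

definition norm_l2 :: "'a l2 \<Rightarrow> real" where "norm_l2 f = sqrt (f \<bullet> f)"
definition sgn_l2 :: "'a l2 \<Rightarrow> 'a l2" where "sgn_l2 f = f /\<^sub>R norm f"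
definition dist_l2 :: "'a l2 \<Rightarrow> 'a l2 \<Rightarrow> real" where "dist_l2 f g = norm (f - g)"
definition uniformity_l2 :: "('a l2 \<times> 'a l2) filter" where
  "uniformity_l2 = (INF e\<in>{0<..}. principal {(f, g). dist f g < e})"
definition open_l2 :: "'a l2 set \<Rightarrow> bool" where
  "open_l2 S \<longleftrightarrow> (\<forall>f\<in>S. \<forall>\<^sub>F (f', g) in uniformity. f' = f \<longrightarrow> g \<in> S)"

instance
proof
  fix f g h :: "'a l2" and c :: real
  show "f \<bullet> g = g \<bullet> f" by transfer (simp add: inner_commute)
  show "(f + g) \<bullet> h = f \<bullet> h + g \<bullet> h"
    by transfer (auto simp: inner_add_left intro!: Bochner_Integration.integral_add sq_int_inner_integrable)
  show "(c *\<^sub>R f) \<bullet> g = c * (f \<bullet> g)" by transfer simp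
  show "0 \<le> f \<bullet> f" by transfer simp
  show "f \<bullet> f = 0 \<longleftrightarrow> f = 0"
  proof transfer
    fix f :: "real \<Rightarrow> 'a"
    assume "f \<in> sq_int \<and> f \<in> sq_int \<and> (AE x in lebesgue. f x = f x)"
    then have f: "f \<in> sq_int" by simp
    have "(LINT x|lebesgue. f x \<bullet> f x) = 0 \<longleftrightarrow> (AE x in lebesgue. f x \<bullet> f x = 0)"
      by (intro integral_nonneg_eq_0_iff_AE sq_int_inner_integrable f) auto
    then show "((LINT x|lebesgue. f x \<bullet> f x) = 0) = (f \<in> sq_int \<and> (\<lambda>x. 0 :: 'a) \<in> sq_int \<and> (AE x in lebesgue. f x = 0))"
      using f by (simp add: sq_int_0)
  qed
qed (simp_all add: norm_l2_def sgn_l2_def dist_l2_def uniformity_l2_def open_l2_def)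

end

definition rep :: "'v::euclidean_space l2 \<Rightarrow> real \<Rightarrow> 'v" where "rep = rep_l2"
definition cls :: "(real \<Rightarrow> 'v::euclidean_space) \<Rightarrow> 'v l2" where "cls = abs_l2"

lemma rep_sq_int: "rep f \<in> sq_int"
  unfolding rep_def using Quotient_rep_reflp[OF Quotient_l2, of f] by simp

lemma cls_rep: "cls (rep f) = f"
  unfolding rep_def cls_def by (rule Quotient_abs_rep[OF Quotient_l2])

lemma cls_eq_iff: "f \<in> sq_int \<Longrightarrow> g \<in> sq_int \<Longrightarrow> cls f = cls g \<longleftrightarrow> (AE x in lebesgue. f x = g x)"
  unfolding cls_def using Quotient_rel[OF Quotient_l2, of f g] by auto

lemma rep_cls: "f \<in> sq_int \<Longrightarrow> AE x in lebesgue. rep (cls f) x = f x"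
  using cls_eq_iff[OF rep_sq_int, of f "cls f"] by (simp add: cls_rep)

lemma cls_add: "f \<in> sq_int \<Longrightarrow> g \<in> sq_int \<Longrightarrow> cls (\<lambda>x. f x + g x) = cls f + cls g"
  unfolding cls_def by (simp add: plus_l2.abs_eq)

lemma cls_diff: "f \<in> sq_int \<Longrightarrow> g \<in> sq_int \<Longrightarrow> cls (\<lambda>x. f x - g x) = cls f - cls g"
  unfolding cls_def by (simp add: minus_l2.abs_eq)

lemma cls_scaleR: "f \<in> sq_int \<Longrightarrow> cls (\<lambda>x. c *\<^sub>R f x) = c *\<^sub>R cls f"
  unfolding cls_def by (simp add: scaleR_l2.abs_eq)

lemma inner_cls: "f \<in> sq_int \<Longrightarrow> g \<in> sq_int \<Longrightarrow> cls f \<bullet> cls g = (LINT x|lebesgue. f x \<bullet> g x)"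
  unfolding cls_def by (simp add: inner_l2.abs_eq)

lemma norm_cls: "f \<in> sq_int \<Longrightarrow> (norm (cls f))\<^sup>2 = (LINT x|lebesgue. (norm (f x))\<^sup>2)"
  by (simp add: power2_norm_eq_inner inner_cls)

lemma rep_add: "AE x in lebesgue. rep (f + g) x = rep f x + rep g x"
  using rep_cls[OF sq_int_add[OF rep_sq_int[of f] rep_sq_int[of g]]]
  by (simp add: cls_add rep_sq_int cls_rep)

lemma rep_diff: "AE x in lebesgue. rep (f - g) x = rep f x - rep g x"
  using rep_cls[OF sq_int_diff[OF rep_sq_int[of f] rep_sq_int[of g]]]
  by (simp add: cls_diff rep_sq_int cls_rep)

lemma rep_scaleR: "AE x in lebesgue. rep (c *\<^sub>R f) x = c *\<^sub>R rep f x"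
  using rep_cls[OF sq_int_scaleR[OF rep_sq_int[of f]]]
  by (simp add: cls_scaleR rep_sq_int cls_rep)

lemma nn_integral_sq_int:
  assumes "f \<in> sq_int" shows "(\<integral>\<^sup>+x. ennreal ((norm (f x))\<^sup>2) \<partial>lebesgue) = ennreal ((norm (cls f))\<^sup>2)"
  using assms by (simp add: norm_cls nn_integral_eq_integral sq_int_def)

text \<open>
  The series \<open>\<Sum>n. 2\<^sup>n |f (n + 1) - f n|\<^sup>2\<close> has a finite integral and therefore bounded terms almost everywhere; so
  the increments are dominated by a geometric sequence.
\<close>

lemma rapid_Cauchy_AE_convergent:
  fixes f :: "nat \<Rightarrow> real \<Rightarrow> 'v::euclidean_space"
  assumes f: "\<And>n. f n \<in> sq_int"
    and rapid: "\<And>n. (\<integral>\<^sup>+x. ennreal ((norm (f (Suc n) x - f n x))\<^sup>2) \<partial>lebesgue) \<le> ennreal ((1/4)^n)"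
  shows "AE x in lebesgue. convergent (\<lambda>n. f n x)"
proof -
  have [measurable]: "f n \<in> borel_measurable lebesgue" for n by (rule sq_int_measurable[OF f])
  define h where "h n x = ennreal (2^n * (norm (f (Suc n) x - f n x))\<^sup>2)" for n x
  have [measurable]: "h n \<in> borel_measurable lebesgue" for n unfolding h_def by measurable
  have "(\<integral>\<^sup>+x. (\<Sum>n. h n x) \<partial>lebesgue) = (\<Sum>n. \<integral>\<^sup>+x. h n x \<partial>lebesgue)"
    by (rule nn_integral_suminf) simp
  also have "\<dots> \<le> (\<Sum>n. ennreal ((1/2)^n))"
  proof (rule suminf_le)
    fix n
    have "(\<integral>\<^sup>+x. h n x \<partial>lebesgue) = ennreal (2^n) * (\<integral>\<^sup>+x. ennreal ((norm (f (Suc n) x - f n x))\<^sup>2) \<partial>lebesgue)"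
      unfolding h_def by (simp add: ennreal_mult nn_integral_cmult)
    also have "\<dots> \<le> ennreal (2^n) * ennreal ((1/4)^n)" by (intro mult_left_mono rapid) simp
    also have "\<dots> = ennreal ((1/2)^n)"
      by (simp add: ennreal_mult[symmetric] power_mult_distrib[symmetric])
    finally show "(\<integral>\<^sup>+x. h n x \<partial>lebesgue) \<le> ennreal ((1/2)^n)" .
  qed auto
  also have "\<dots> = ennreal (\<Sum>n. (1/2)^n)"
    by (rule suminf_ennreal2) (auto intro: summable_geometric)
  also have "\<dots> < \<infinity>" by simp
  finally have "AE x in lebesgue. (\<Sum>n. h n x) \<noteq> \<infinity>"
    by (intro nn_integral_PInf_AE) auto
  then show ?thesis
  proof eventually_elim
    case (elim x)
    have "h n x \<le> (\<Sum>n. h n x)" for n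
      using sum_le_suminf[of "\<lambda>n. h n x" "{n}"] by simp
    moreover obtain C where C: "0 \<le> C" "(\<Sum>n. h n x) = ennreal C"
      using elim by (cases "\<Sum>n. h n x") auto
    ultimately have le: "2^n * (norm (f (Suc n) x - f n x))\<^sup>2 \<le> C" for n
      using C by (metis h_def ennreal_le_iff)
    have bound: "norm (f (Suc n) x - f n x) \<le> sqrt C * (sqrt (1/2))^n" for n
    proof (rule power2_le_imp_le)
      have "(norm (f (Suc n) x - f n x))\<^sup>2 \<le> C * (1/2)^n"
        using le[of n] by (simp add: field_simps power_divide)
      also have "\<dots> = (sqrt C * (sqrt (1/2))^n)\<^sup>2"
        using C by (simp add: power_mult_distrib power_mult[symmetric] mult.commute[of n]) (simp add: power_mult)
      finally show "(norm (f (Suc n) x - f n x))\<^sup>2 \<le> (sqrt C * (sqrt (1/2))^n)\<^sup>2" .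
    qed (use C in simp)
    have "sqrt (1/2) < (1::real)" by simp
    then have "summable (\<lambda>n. sqrt C * (sqrt (1/2))^n)"
      by (intro summable_mult summable_geometric) simp
    then have "summable (\<lambda>n. f (Suc n) x - f n x)"
      by (rule summable_comparison_test[rotated]) (use bound in auto)
    then have "convergent (\<lambda>n. \<Sum>k<n. f (Suc k) x - f k x)" by (simp add: summable_iff_convergent)
    then have "convergent (\<lambda>n. f n x - f 0 x)" by (simp add: sum_lessThan_telescope[of "\<lambda>n. f n x"])
    then have "convergent (\<lambda>n. (f n x - f 0 x) + f 0 x)" by (intro convergent_add convergent_const)
    then show ?case by simp
  qed
qed

text \<open>
  A rapidly converging subsequence has an almost everywhere limit, and Fatou's lemma shows that it
  is a limit in norm.
\<close>

instance l2 :: (euclidean_space) complete_space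
proof
  fix X :: "nat \<Rightarrow> 'a l2" assume X: "Cauchy X"
  have "\<forall>n. \<exists>N. \<forall>i\<ge>N. \<forall>j\<ge>N. norm (X i - X j) < (1/2)^n"
    using CauchyD[OF X] by (metis zero_less_divide_1_iff zero_less_numeral zero_less_power)
  then obtain N where N: "\<And>n i j. i \<ge> N n \<Longrightarrow> j \<ge> N n \<Longrightarrow> norm (X i - X j) < (1/2)^n" by metis
  \<comment> \<open>any strictly increasing sequence above \<open>N\<close> would do\<close>
  define r where "r n = n + (\<Sum>k\<le>n. N k)" for n
  have r: "N n \<le> r n" "r n < r (Suc n)" for n
    by (auto simp: r_def intro!: trans_le_add2 member_le_sum)
  have r_mono: "strict_mono r" using r(2) by (simp add: strict_mono_Suc_iff)
  define f where "f n = rep (X (r n))" for n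
  have f: "f n \<in> sq_int" for n by (simp add: f_def rep_sq_int)
  have [measurable]: "f n \<in> borel_measurable lebesgue" for n by (rule sq_int_measurable[OF f])
  have dist_f: "(\<integral>\<^sup>+x. ennreal ((norm (f i x - f j x))\<^sup>2) \<partial>lebesgue) = ennreal ((norm (X (r i) - X (r j)))\<^sup>2)" for i j
    using nn_integral_sq_int[OF sq_int_diff[OF f f], of i j] by (simp add: cls_diff f) (simp add: f_def cls_rep)
  have small: "norm (X (r i) - X (r j)) < (1/2)^n" if "n \<le> i" "n \<le> j" for n i j
    using that r(1)[of n] strict_mono_less_eq[OF r_mono] by (intro N) (meson order_trans)+
  have "AE x in lebesgue. convergent (\<lambda>n. f n x)"
  proof (rule rapid_Cauchy_AE_convergent[OF f])
    fix n
    have "(norm (X (r (Suc n)) - X (r n)))\<^sup>2 \<le> ((1/2)^n)\<^sup>2"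
      using small[of n "Suc n" n] by (intro power_mono) auto
    also have "\<dots> = (1/4)^n" by (simp add: power_divide power_mult[symmetric] mult.commute[of n]) (simp add: power_mult)
    finally show "(\<integral>\<^sup>+x. ennreal ((norm (f (Suc n) x - f n x))\<^sup>2) \<partial>lebesgue) \<le> ennreal ((1/4)^n)"
      unfolding dist_f by (rule ennreal_leI)
  qed
  then have lim: "AE x in lebesgue. (\<lambda>n. f n x) \<longlonglongrightarrow> lim (\<lambda>n. f n x)"
    by eventually_elim (simp add: convergent_LIMSEQ_iff)
  define g where "g x = lim (\<lambda>n. f n x)" for x
  have [measurable]: "g \<in> borel_measurable lebesgue" unfolding g_def by measurable
  have close: "(\<integral>\<^sup>+x. ennreal ((norm (g x - f n x))\<^sup>2) \<partial>lebesgue) \<le> ennreal (((1/2)^n)\<^sup>2)" for n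
  proof -
    have "(\<integral>\<^sup>+x. ennreal ((norm (g x - f n x))\<^sup>2) \<partial>lebesgue)
        = (\<integral>\<^sup>+x. liminf (\<lambda>i. ennreal ((norm (f i x - f n x))\<^sup>2)) \<partial>lebesgue)"
    proof (rule nn_integral_cong_AE)
      show "AE x in lebesgue. ennreal ((norm (g x - f n x))\<^sup>2) = liminf (\<lambda>i. ennreal ((norm (f i x - f n x))\<^sup>2))"
        using lim
      proof eventually_elim
        case (elim x)
        then have "(\<lambda>i. ennreal ((norm (f i x - f n x))\<^sup>2)) \<longlonglongrightarrow> ennreal ((norm (g x - f n x))\<^sup>2)"
          unfolding g_def by (intro tendsto_intros) auto
        then show ?case using lim_imp_Liminf[OF sequentially_bot] by metis
      qed
    qed
    also have "\<dots> \<le> liminf (\<lambda>i. \<integral>\<^sup>+x. ennreal ((norm (f i x - f n x))\<^sup>2) \<partial>lebesgue)"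
      by (rule nn_integral_liminf) measurable
    also have "\<dots> \<le> ennreal (((1/2)^n)\<^sup>2)"
    proof (rule Liminf_le)
      show "\<forall>\<^sub>F i in sequentially. (\<integral>\<^sup>+x. ennreal ((norm (f i x - f n x))\<^sup>2) \<partial>lebesgue) \<le> ennreal (((1/2)^n)\<^sup>2)"
        unfolding dist_f
        using eventually_ge_at_top[of n]
        by eventually_elim (intro ennreal_leI power_mono, use small in \<open>auto intro: less_imp_le\<close>)
    qed simp
    finally show ?thesis .
  qed
  have gf: "(\<lambda>x. g x - f n x) \<in> sq_int" for n
    unfolding sq_int_def
  proof (intro CollectI conjI)
    show "integrable lebesgue (\<lambda>x. (norm (g x - f n x))\<^sup>2)"
    proof (rule integrableI_bounded)
      have "(\<integral>\<^sup>+x. ennreal (norm ((norm (g x - f n x))\<^sup>2)) \<partial>lebesgue) \<le> ennreal (((1/2)^n)\<^sup>2)"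
        using close[of n] by simp
      also have "\<dots> < \<infinity>" by simp
      finally show "(\<integral>\<^sup>+x. ennreal (norm ((norm (g x - f n x))\<^sup>2)) \<partial>lebesgue) < \<infinity>" .
    qed measurable
  qed measurable
  have g: "g \<in> sq_int" using sq_int_add[OF gf[of 0] f[of 0]] by simp
  have "norm (cls g - X (r n)) \<le> (1/2)^n" for n
  proof (rule power2_le_imp_le)
    have "cls (\<lambda>x. g x - f n x) = cls g - X (r n)" by (simp add: cls_diff g f) (simp add: f_def cls_rep)
    then have "ennreal ((norm (cls g - X (r n)))\<^sup>2) \<le> ennreal (((1/2)^n)\<^sup>2)"
      using close[of n] nn_integral_sq_int[OF gf[of n]] by simp
    then show "(norm (cls g - X (r n)))\<^sup>2 \<le> ((1/2)^n)\<^sup>2" by simp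
  qed simp
  then have "(\<lambda>n. X (r n)) \<longlonglongrightarrow> cls g"
    unfolding tendsto_iff dist_norm
  proof (intro allI impI)
    fix e :: real assume "0 < e"
    have "(\<lambda>n. (1/2 :: real)^n) \<longlonglongrightarrow> 0" by (rule LIMSEQ_power_zero) simp
    from order_tendstoD(2)[OF this \<open>0 < e\<close>] show "\<forall>\<^sub>F n in sequentially. norm (X (r n) - cls g) < e"
    proof eventually_elim
      case (elim n)
      with \<open>norm (cls g - X (r n)) \<le> (1/2)^n\<close> show ?case by (simp add: norm_minus_commute)
    qed
  qed
  then have "X \<longlonglongrightarrow> cls g" using Cauchy_converges_subseq[OF X r_mono] by (simp add: o_def)
  then show "convergent X" by (auto simp: convergent_def)
qed

instance l2 :: (euclidean_space) banach ..

section \<open>The boundary form\<close>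

lemma inner_mult_cconj: "(c * x) \<bullet> y = x \<bullet> (cconj c * (y :: 'k::real_or_complex))"
proof -
  have "of_real (2 * ((c * x) \<bullet> y)) = (of_real (2 * (x \<bullet> (cconj c * y))) :: 'k)"
    unfolding inner_scalar[symmetric] by (simp add: cconj_mult cconj_cconj mult_ac)
  then show ?thesis unfolding of_real_eq_iff by simp
qed

lemma inner_ctranspose:
  fixes A :: "'k::real_or_complex^'n^'m"
  shows "(A *v x) \<bullet> y = x \<bullet> (ctranspose A *v y)"
proof -
  have "(A *v x) \<bullet> y = (\<Sum>i\<in>UNIV. \<Sum>j\<in>UNIV. (A $ i $ j * x $ j) \<bullet> y $ i)"
    by (simp add: inner_vec_def matrix_vector_mult_def inner_sum_left)
  also have "\<dots> = (\<Sum>j\<in>UNIV. \<Sum>i\<in>UNIV. x $ j \<bullet> (cconj (A $ i $ j) * y $ i))"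
    by (subst sum.swap) (simp add: inner_mult_cconj)
  also have "\<dots> = x \<bullet> (ctranspose A *v y)"
    by (simp add: inner_vec_def matrix_vector_mult_def inner_sum_right ctranspose_def)
  finally show ?thesis .
qed

lemma matrix_vector_scaleR: "(A :: 'k::real_or_complex^'n^'m) *v (c *\<^sub>R x) = c *\<^sub>R (A *v x)"
  by (simp add: matrix_vector_mult_def vec_eq_iff scaleR_sum_right)

lemma scaleR_matrix_vector: "(c *\<^sub>R (A :: 'k::real_or_complex^'n^'m)) *v x = c *\<^sub>R (A *v x)"
  by (simp add: matrix_vector_mult_def vec_eq_iff scaleR_sum_right)

lemma linear_matrix_vector: "linear ((*v) (A :: 'k::real_or_complex^'n^'m))"
  by (rule linearI) (simp_all add: matrix_vector_right_distrib matrix_vector_scaleR)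

lemma bounded_linear_matrix_vector: "bounded_linear ((*v) (A :: 'k::real_or_complex^'n^'m))"
  using linear_matrix_vector linear_conv_bounded_linear by blast

lemma matrix_vector_minus_left: "(- A) *v x = - ((A :: 'k::real_or_complex^'n^'m) *v x)"
  using scaleR_matrix_vector[of "-1" A x] by simp

lemma loewner_leD: "loewner_le A B \<Longrightarrow> x \<bullet> (A *v x) \<le> x \<bullet> (B *v x)"
  by (simp add: loewner_le_def pos_semidef_def matrix_vector_mult_diff_rdistrib inner_diff_right)

lemma mat_of_real_vector: "mat (of_real c) *v x = c *\<^sub>R (x :: 'k::real_or_complex^'n)"
proof -
  have "mat (of_real c) = c *\<^sub>R (mat 1 :: 'k^'n^'n)"
    by (simp add: mat_def vec_eq_iff of_real_def)
  then show ?thesis by (simp add: scaleR_matrix_vector)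
qed

lemma stack_inner: "stack u v \<bullet> stack u' v' = u \<bullet> u' + v \<bullet> (v' :: 'k::real_or_complex^'n)"
  unfolding inner_vec_def UNIV_sum
  by (subst sum.union_disjoint) (auto simp: sum.reindex stack_def)

lemma stack_cases: obtains u v where "y = stack u (v :: 'k::real_or_complex^'n)"
proof
  show "y = stack (\<chi> i. y $ Inl i) (\<chi> i. y $ Inr i)"
    by (auto simp: vec_eq_iff stack_def split: sum.split)
qed

lemma stack_eq_iff: "stack u v = stack u' v' \<longleftrightarrow> u = u' \<and> v = (v' :: 'k::real_or_complex^'n)"
  by (auto simp: vec_eq_iff stack_def split: sum.split)

lemma stack_add: "stack u v + stack u' v' = stack (u + u') (v + v' :: 'k::real_or_complex^'n)"
  by (auto simp: vec_eq_iff stack_def split: sum.split)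

lemma stack_scaleR: "c *\<^sub>R stack u v = stack (c *\<^sub>R u) (c *\<^sub>R v :: 'k::real_or_complex^'n)"
  by (auto simp: vec_eq_iff stack_def split: sum.split)

lemma stack_smult: "c *s stack u v = stack (c *s u) (c *s v :: 'k::real_or_complex^'n)"
  by (auto simp: vec_eq_iff stack_def split: sum.split)

lemma stack_0: "stack 0 (0 :: 'k::real_or_complex^'n) = 0"
  by (auto simp: vec_eq_iff stack_def split: sum.split)

lemma block_stack: "block A B C E *v stack u v = stack (A *v u + B *v v) (C *v u + E *v (v :: 'k::real_or_complex^'n))"
proof -
  have split: "(\<Sum>j\<in>UNIV. f j) = (\<Sum>j\<in>UNIV. f (Inl j)) + (\<Sum>j\<in>UNIV. f (Inr j))" for f :: "'n + 'n \<Rightarrow> 'k"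
    unfolding UNIV_sum by (subst sum.union_disjoint) (auto simp: sum.reindex)
  show ?thesis
    by (auto simp: vec_eq_iff block_def stack_def matrix_vector_mult_def split split: sum.split)
qed

lemma rank_right_inverse:
  fixes W :: "'k::field^'n^'m"
  assumes "rank W = CARD('m)"
  obtains B where "W ** B = mat 1"
proof -
  have "\<forall>c. (\<Sum>i\<in>UNIV. c i *s row i W) = 0 \<longrightarrow> (\<forall>i. c i = 0)"
  proof -
    have dim: "vec.dim (rows W) = CARD('m)" using assms by (simp add: row_rank_def_gen)
    have rows: "rows W = range (\<lambda>i. row i W)" by (auto simp: rows_def)
    have card: "card (rows W) \<le> CARD('m)" unfolding rows by (rule card_image_le) simp
    have fin: "finite (rows W)" unfolding rows by simp
    have card_eq: "card (rows W) = CARD('m)"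
      using card vec.dim_le_card'[OF fin] dim by simp
    then have inj: "inj (\<lambda>i. row i W)" unfolding rows by (intro eq_card_imp_inj_on) simp_all
    have indep: "vec.independent (rows W)"
      by (rule vec.card_le_dim_spanning[OF subset_refl vec.span_superset fin]) (simp add: card_eq dim)
    show ?thesis
    proof (intro allI impI)
      fix c i assume c: "(\<Sum>i\<in>UNIV. c i *s row i W) = 0"
      define q where "q r = c (inv (\<lambda>i. row i W) r)" for r
      have "(\<Sum>r\<in>rows W. q r *s r) = (\<Sum>i\<in>UNIV. c i *s row i W)"
        unfolding rows by (subst sum.reindex[OF inj]) (simp add: q_def inv_f_f[OF inj])
      then have "q (row i W) = 0"
        using c by (intro vec.independentD[OF indep fin subset_refl]) (simp_all add: rows)
      then show "c i = 0" by (simp add: q_def inv_f_f[OF inj])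
    qed
  qed
  then have "\<exists>B :: 'k^'m^'n. W ** B = mat 1"
    unfolding matrix_right_invertible_independent_rows .
  then obtain B :: "'k^'m^'n" where "W ** B = mat 1" ..
  then show ?thesis by (rule that)
qed

text \<open>
  With \<open>f = P\<^sub>1 p - P\<^sub>1 q\<close> and \<open>e = p + q\<close>, the boundary form is \<open>(f | e)\<close>, and the boundary condition says
  that \<open>(f,e)\<close> is in the kernel of \<open>V = W\<^sub>B\<close>, that is, orthogonal to the range of \<open>V*\<close>. If \<open>(u,v) = V* z\<close>,
  then \<open>V \<Sigma> V* \<ge> 0\<close> means \<open>(u | v) \<ge> 0\<close>, that is, \<open>|u - v| \<le> |u + v|\<close>. Since \<open>V*\<close> is injective, so is
  \<open>z \<mapsto> u + v\<close>, and for reasons of dimension some \<open>z\<close> satisfies \<open>u + v = f + e\<close>. Orthogonality then gives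
  \<open>|f + e|\<^sup>2 = - (f - e | u - v) \<le> |f - e| |f + e|\<close>, hence \<open>|f + e| \<le> |f - e|\<close>, which is \<open>(f | e) \<le> 0\<close>.
\<close>

lemma boundary_form_nonpos:
  fixes P1 :: "'k::real_or_complex^'n^'n" and W :: "'k^('n + 'n)^'n"
  assumes inv: "invertible P1" and P1_sym: "ctranspose P1 = P1"
    and pos: "pos_semidef (W_B P1 W ** Sigma_mat ** ctranspose (W_B P1 W))" and rank: "rank W = CARD('n)"
    and bc: "W *v stack p q = 0"
  shows "(P1 *v p) \<bullet> p \<le> (P1 *v q) \<bullet> q"
proof -
  define R where "R = block P1 (- P1) (mat 1) (mat 1)"
  have R: "R *v stack u v = stack (P1 *v u - P1 *v v) (u + v)" for u v
    by (simp add: R_def block_stack matrix_vector_minus_left)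
  obtain P1' where P1': "P1' ** P1 = mat 1" using inv by (auto simp: invertible_def)
  have P1_inj: "x = 0" if "P1 *v x = 0" for x
  proof -
    have "x = P1' *v (P1 *v x)" by (simp add: matrix_vector_mul_assoc P1')
    then show ?thesis using that by simp
  qed
  have "inj ((*v) R)"
  proof (rule linear_injective_0[OF linear_matrix_vector, THEN iffD2], intro allI impI)
    fix y assume y: "R *v y = 0"
    obtain u v where uv: "y = stack u v" by (rule stack_cases)
    have "stack (P1 *v u - P1 *v v) (u + v) = stack 0 0" using y by (simp only: uv R stack_0)
    then have 1: "P1 *v u - P1 *v v = 0" and 2: "u + v = 0" unfolding stack_eq_iff by simp_all
    have "u - v = 0" using 1 by - (rule P1_inj, simp add: matrix_vector_mult_diff_distrib)
    then have "2 *\<^sub>R u = 0" using 2 by (simp add: scaleR_2)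
    then show "y = 0" using 2 by (simp add: uv stack_0)
  qed
  then have "\<exists>B. B ** R = mat 1" using matrix_left_invertible_injective by blast
  then have R_inv: "invertible R" by (simp add: invertible_left_inverse)
  define V where "V = W_B P1 W"
  have VR: "V ** R = W"
  proof -
    have "matrix_inv R ** R = mat 1"
      using R_inv unfolding invertible_def matrix_inv_def by (rule someI2_ex) simp
    then show ?thesis by (simp add: V_def W_B_def R_def[symmetric] matrix_mul_assoc[symmetric])
  qed
  obtain B where B: "W ** B = mat 1" by (rule rank_right_inverse[OF rank])
  have V_adj_inj: "z = 0" if "ctranspose V *v z = 0" for z
  proof -
    have "V *v (R *v (B *v z)) = z" using B by (simp add: matrix_vector_mul_assoc VR matrix_mul_assoc)
    then have "z \<bullet> z = (R *v (B *v z)) \<bullet> (ctranspose V *v z)" using inner_ctranspose[of V "R *v (B *v z)" z] by simp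
    then show ?thesis using that by simp
  qed
  \<comment> \<open>the two halves of \<open>V* z\<close>\<close>
  define u where "u z = (\<chi> i. (ctranspose V *v z) $ Inl i)" for z
  define v where "v z = (\<chi> i. (ctranspose V *v z) $ Inr i)" for z
  have uv: "ctranspose V *v z = stack (u z) (v z)" for z
    by (auto simp: vec_eq_iff stack_def u_def v_def split: sum.split)
  have uv_nonneg: "0 \<le> u z \<bullet> v z" for z
  proof -
    have "0 \<le> z \<bullet> ((V ** Sigma_mat ** ctranspose V) *v z)"
      using pos by (simp add: pos_semidef_def V_def)
    also have "\<dots> = (Sigma_mat *v (ctranspose V *v z)) \<bullet> (ctranspose V *v z)"
      by (simp add: matrix_vector_mul_assoc[symmetric] inner_commute[of z] inner_ctranspose[of V])
    also have "\<dots> = 2 * (u z \<bullet> v z)"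
      by (simp add: uv Sigma_mat_def block_stack stack_inner inner_commute)
    finally show ?thesis by simp
  qed
  have lin: "linear (\<lambda>z. u z + v z)"
    by (rule linearI) (simp_all add: u_def v_def vec_eq_iff matrix_vector_right_distrib matrix_vector_scaleR algebra_simps)
  have "inj (\<lambda>z. u z + v z)"
  proof (rule linear_injective_0[OF lin, THEN iffD2], intro allI impI)
    fix z assume 0: "u z + v z = 0"
    then have v_eq: "v z = - u z" by (simp add: eq_neg_iff_add_eq_0 add.commute)
    then have "u z \<bullet> u z \<le> 0" using uv_nonneg[of z] by simp
    then have "u z = 0" by (metis inner_eq_zero_iff inner_ge_zero order_antisym)
    then have "ctranspose V *v z = 0" using v_eq by (simp add: uv stack_0)
    then show "z = 0" by (rule V_adj_inj)
  qed
  then have surj: "surj (\<lambda>z. u z + v z)" using linear_injective_imp_surjective[OF lin] by simp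
  define f where "f = P1 *v p - P1 *v q"
  define e where "e = p + q"
  have "\<exists>z. f + e = u z + v z" by (rule surjD[OF surj])
  then obtain z where z: "u z + v z = f + e" by auto
  have Ve: "V *v stack f e = 0"
    using bc R[of p q] by (simp add: f_def e_def VR[symmetric] matrix_vector_mul_assoc[symmetric])
  have "0 = (V *v stack f e) \<bullet> z" by (simp add: Ve)
  also have "\<dots> = f \<bullet> u z + e \<bullet> v z" by (simp add: inner_ctranspose uv stack_inner)
  finally have 0: "f \<bullet> u z + e \<bullet> v z = 0" by simp
  have "(f + e) \<bullet> (f + e) = (f + e) \<bullet> (u z + v z)" by (simp add: z)
  also have "\<dots> = - ((f - e) \<bullet> (u z - v z))"
    using 0 by (simp add: inner_add_left inner_add_right inner_diff_left inner_diff_right)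
  also have "\<dots> \<le> norm (f - e) * norm (u z - v z)"
    using Cauchy_Schwarz_ineq2[of "f - e" "u z - v z"] by linarith
  also have "\<dots> \<le> norm (f - e) * norm (f + e)"
  proof (intro mult_left_mono)
    have "(norm (u z - v z))\<^sup>2 = (norm (u z + v z))\<^sup>2 - 4 * (u z \<bullet> v z)"
      by (simp add: power2_norm_eq_inner inner_add_left inner_add_right inner_diff_left inner_diff_right inner_commute)
    also have "\<dots> \<le> (norm (f + e))\<^sup>2" using uv_nonneg[of z] by (simp add: z)
    finally show "norm (u z - v z) \<le> norm (f + e)" by (rule power2_le_imp_le) simp
  qed simp
  finally have "norm (f + e) * norm (f + e) \<le> norm (f - e) * norm (f + e)"
    by (simp flip: power2_norm_eq_inner power2_eq_square)
  then have "norm (f + e) \<le> norm (f - e)"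
    by (cases "norm (f + e) = 0") (auto simp: mult_le_cancel_right)
  then have "(norm (f + e))\<^sup>2 \<le> (norm (f - e))\<^sup>2" by (intro power_mono) auto
  then have "f \<bullet> e \<le> 0"
    by (simp add: power2_norm_eq_inner inner_add_left inner_add_right inner_diff_left inner_diff_right inner_commute)
  moreover have "(P1 *v p) \<bullet> q = (P1 *v q) \<bullet> p"
    using inner_ctranspose[of P1 p q] by (simp add: P1_sym inner_commute)
  ultimately show ?thesis
    by (simp add: f_def e_def inner_add_right inner_diff_left)
qed

section \<open>Absolutely continuous representatives\<close>

text \<open>
  The positive and negative parts of \<open>f\<close> are densities of two measures that agree on all half-lines.
\<close>

lemma AE_zero_if_tail_integrals_zero:
  fixes f :: "real \<Rightarrow> real"
  assumes f: "integrable lborel f"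
    and zero: "\<And>x. (LINT y|lborel. indicator {x<..} y * f y) = 0"
  shows "AE x in lborel. f x = 0"
proof -
  have [measurable]: "f \<in> borel_measurable borel" using f by auto
  define M where "M = density lborel (\<lambda>x. ennreal (f x))"
  define N where "N = density lborel (\<lambda>x. ennreal (- f x))"
  have eM: "emeasure M {x<..} = (\<integral>\<^sup>+y. ennreal (indicator {x<..} y * f y) \<partial>lborel)" for x
    unfolding M_def by (subst emeasure_density) (auto intro!: nn_integral_cong split: split_indicator)
  have eN: "emeasure N {x<..} = (\<integral>\<^sup>+y. ennreal (- (indicator {x<..} y * f y)) \<partial>lborel)" for x
    unfolding N_def by (subst emeasure_density) (auto intro!: nn_integral_cong split: split_indicator)
  have int: "integrable lborel (\<lambda>y. indicator {x<..} y * f y)" for x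
    using integrable_real_mult_indicator[OF _ f, of "{x<..}"] by (simp add: mult.commute)
  have "M = N"
  proof (rule measure_eqI_lessThan)
    fix x
    note fin = int[of x, unfolded real_integrable_def]
    show "emeasure M {x<..} < \<infinity>" using fin unfolding eM by (simp add: top.not_eq_extremum)
    have "enn2real (emeasure M {x<..}) = enn2real (emeasure N {x<..})"
      using zero[of x] unfolding eM eN real_lebesgue_integral_def[OF int] by simp
    then show "emeasure M {x<..} = emeasure N {x<..}"
      using fin unfolding eM eN
      by (metis (no_types, lifting) ennreal_enn2real infinity_ennreal_def less_top)
  qed (simp_all add: M_def N_def)
  then have "AE x in lborel. ennreal (f x) = ennreal (- f x)"
    unfolding M_def N_def by (intro sigma_finite_measure.density_unique[OF sigma_finite_lborel]) auto
  then show ?thesis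
  proof eventually_elim
    case (elim x)
    then show ?case by (cases "0 \<le> f x") (auto simp: ennreal_neg)
  qed
qed

lemma lebesgue_on_lemmas:
  shows "integrable (lebesgue_on {a..b::real}) f \<longleftrightarrow> integrable lebesgue (\<lambda>x. indicator {a..b} x *\<^sub>R (f x :: 'v::euclidean_space))"
    and "(LINT x|lebesgue_on {a..b}. f x) = (LINT x|lebesgue. indicator {a..b} x *\<^sub>R f x)"
  by (simp_all add: integrable_restrict_space integral_restrict_space)

lemma AE_zero_if_primitive_zero:
  fixes d :: "real \<Rightarrow> 'v::euclidean_space"
  assumes d: "integrable (lebesgue_on {a..b}) d" and ab: "a < b"
    and zero: "\<And>\<zeta>. \<zeta> \<in> {a..b} \<Longrightarrow> (LINT \<eta>|lebesgue_on {a..\<zeta>}. d \<eta>) = 0"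
  shows "AE \<zeta> in lebesgue_on {a..b}. d \<zeta> = 0"
proof -
  have comp: "AE x in lebesgue. indicator {a..b} x * (d x \<bullet> e) = 0" for e
  proof -
    define g where "g x = indicator {a..b} x * (d x \<bullet> e)" for x
    have int_d: "integrable lebesgue (\<lambda>x. indicator {c..c'} x *\<^sub>R d x)" if "{c..c'} \<subseteq> {a..b}" for c c'
      using integrable_subinterval[OF d that] by (simp add: lebesgue_on_lemmas)
    have zero': "(LINT x|lebesgue. indicator {a..\<zeta>} x * (d x \<bullet> e)) = 0" if "\<zeta> \<in> {a..b}" for \<zeta>
    proof -
      have "(LINT x|lebesgue. (indicator {a..\<zeta>} x *\<^sub>R d x) \<bullet> e) = (LINT x|lebesgue. indicator {a..\<zeta>} x *\<^sub>R d x) \<bullet> e"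
        by (rule integral_inner_left) (use that in \<open>intro int_d, auto\<close>)
      then show ?thesis using zero[OF that] by (simp add: lebesgue_on_lemmas)
    qed
    have int': "integrable lebesgue (\<lambda>x. indicator {a..\<zeta>} x * (d x \<bullet> e))" if "\<zeta> \<in> {a..b}" for \<zeta>
    proof -
      have "integrable lebesgue (\<lambda>x. (indicator {a..\<zeta>} x *\<^sub>R d x) \<bullet> e)"
        by (rule integrable_inner_left) (use that in \<open>intro int_d, auto\<close>)
      then show ?thesis by simp
    qed
    have g_int: "integrable lebesgue g" unfolding g_def by (rule int') (use ab in simp)
    have g_tail: "(LINT y|lebesgue. indicator {x<..} y * g y) = 0" for x
    proof -
      consider "x < a" | "x \<in> {a..b}" | "b < x" by force
      then show ?thesis
      proof cases
        case 1
        then have "(LINT y|lebesgue. indicator {x<..} y * g y) = (LINT y|lebesgue. indicator {a..b} y * (d y \<bullet> e))"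
          by (intro Bochner_Integration.integral_cong) (auto simp: g_def split: split_indicator)
        then show ?thesis using zero'[of b] ab by simp
      next
        case 2
        then have "(LINT y|lebesgue. indicator {x<..} y * g y) =
            (LINT y|lebesgue. indicator {a..b} y * (d y \<bullet> e) - indicator {a..x} y * (d y \<bullet> e))"
          by (intro Bochner_Integration.integral_cong) (auto simp: g_def split: split_indicator)
        also have "\<dots> = 0" using zero'[of b] zero'[OF 2] int'[of b] int'[OF 2] ab
          by (subst Bochner_Integration.integral_diff) auto
        finally show ?thesis .
      next
        case 3
        then show ?thesis
          by (intro integral_eq_zero_AE AE_I2) (auto simp: g_def split: split_indicator)
      qed
    qed
    have "g \<in> borel_measurable (completion lborel)" using g_int by auto
    from completion_ex_borel_measurable_real[OF this] obtain h where
      h[measurable]: "h \<in> borel_measurable lborel" and gh: "AE x in lborel. g x = h x" by blast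
    have gh': "AE x in lebesgue. g x = h x" using gh by (rule AE_completion)
    have h_leb[measurable]: "h \<in> borel_measurable lebesgue" using h by (simp add: measurable_completion)
    have h_int: "integrable lebesgue h"
      using integrable_cong_AE[OF _ h_leb gh'] g_int by auto
    have "AE x in lborel. h x = 0"
    proof (rule AE_zero_if_tail_integrals_zero)
      show "integrable lborel h" using h_int integrable_completion[OF h] by simp
      fix x
      have "(LINT y|lborel. indicator {x<..} y * h y) = (LINT y|lebesgue. indicator {x<..} y * h y)"
        by (rule integral_completion[symmetric]) measurable
      also have "\<dots> = (LINT y|lebesgue. indicator {x<..} y * g y)"
      proof (rule integral_cong_AE)
        have ind: "(indicator {x<..} :: real \<Rightarrow> real) \<in> borel_measurable lebesgue"
          by (intro borel_measurable_indicator sets_completionI_sets) simp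
        show "(\<lambda>y. indicator {x<..} y * g y) \<in> borel_measurable lebesgue"
          by (intro borel_measurable_times ind borel_measurable_integrable g_int)
        show "(\<lambda>y. indicator {x<..} y * h y) \<in> borel_measurable lebesgue"
          by (intro borel_measurable_times h_leb ind)
        show "AE y in lebesgue. indicator {x<..} y * h y = indicator {x<..} y * g y" using gh' by eventually_elim simp
      qed
      finally show "(LINT y|lborel. indicator {x<..} y * h y) = 0" by (simp add: g_tail)
    qed
    then have "AE x in lebesgue. h x = 0" by (rule AE_completion)
    then show ?thesis using gh' by eventually_elim (simp add: g_def)
  qed
  have "AE x in lebesgue. \<forall>e\<in>Basis. indicator {a..b} x * (d x \<bullet> e) = 0"
    by (intro AE_finite_allI comp) simp
  then have "AE x in lebesgue. x \<in> {a..b} \<longrightarrow> d x = 0"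
  proof eventually_elim
    case (elim x)
    then show ?case by (auto intro!: euclidean_eqI[of "d x" 0])
  qed
  then show ?thesis by (simp add: AE_restrict_space_iff)
qed

lemma L2_measurable: "x \<in> L2 a b \<Longrightarrow> x \<in> borel_measurable (lebesgue_on {a..b})"
  by (simp add: L2_def)

lemma finite_measure_interval: "finite_measure (lebesgue_on {a..b::real})"
  by (rule finite_measure_lebesgue_on) simp

lemma L2_integrable:
  assumes "x \<in> L2 a b" shows "integrable (lebesgue_on {a..b}) x"
proof (rule Bochner_Integration.integrable_bound)
  interpret finite_measure "lebesgue_on {a..b}" by (rule finite_measure_interval)
  show "integrable (lebesgue_on {a..b}) (\<lambda>\<zeta>. 1 + (norm (x \<zeta>))\<^sup>2)"
    using assms by (intro Bochner_Integration.integrable_add) (auto simp: L2_def)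
  have "norm (x \<zeta>) \<le> 1 + (norm (x \<zeta>))\<^sup>2" for \<zeta>
  proof -
    have "norm (x \<zeta>) \<le> 2 * 1 * norm (x \<zeta>)" by simp
    also have "\<dots> \<le> 1\<^sup>2 + (norm (x \<zeta>))\<^sup>2" by (rule sum_squares_bound)
    finally show ?thesis by simp
  qed
  then show "AE \<zeta> in lebesgue_on {a..b}. norm (x \<zeta>) \<le> norm (1 + (norm (x \<zeta>))\<^sup>2)" by simp
qed (use assms in \<open>simp add: L2_def\<close>)

lemma primitive_continuous:
  fixes d :: "real \<Rightarrow> 'v::euclidean_space"
  assumes d: "integrable (lebesgue_on {a..b}) d"
  shows "continuous_on {a..b} (\<lambda>\<zeta>. LINT \<eta>|lebesgue_on {a..\<zeta>}. d \<eta>)"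
proof -
  have "continuous_on {a..b} (\<lambda>\<zeta>. integral {a..\<zeta>} d)"
    by (intro indefinite_integral_continuous_1 integrable_on_lebesgue_on[OF d]) simp
  then show ?thesis
  proof (rule continuous_on_eq)
    fix \<zeta> assume "\<zeta> \<in> {a..b}"
    then have "integrable (lebesgue_on {a..\<zeta>}) d" by (intro integrable_subinterval[OF d]) auto
    then show "integral {a..\<zeta>} d = (LINT \<eta>|lebesgue_on {a..\<zeta>}. d \<eta>)"
      by (simp add: lebesgue_integral_eq_integral)
  qed
qed

lemma continuous_AE_eq_imp_eq:
  fixes f g :: "real \<Rightarrow> 'v::euclidean_space"
  assumes ab: "a < b" and f: "continuous_on {a..b} f" and g: "continuous_on {a..b} g"
    and eq: "eq_ae a b f g" and \<zeta>: "\<zeta> \<in> {a..b}"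
  shows "f \<zeta> = g \<zeta>"
proof -
  define h where "h x = norm (f x - g x)" for x
  have h: "continuous_on {a..b} h" unfolding h_def by (intro continuous_intros f g)
  have AE: "AE x in lebesgue_on {a..b}. h x = 0" using eq unfolding eq_ae_def h_def by simp
  have "(LINT x|lebesgue_on {a..b}. h x) = 0" using AE by (intro integral_eq_zero_AE)
  moreover have "integrable (lebesgue_on {a..b}) h"
    using continuous_imp_integrable_real[OF h] .
  ultimately have "integral {a..b} h = 0" by (simp add: lebesgue_integral_eq_integral)
  moreover have "(h has_integral integral {a..b} h) (cbox a b)"
    using integrable_integral[OF integrable_continuous_real[OF h]] by simp
  ultimately have "(h has_integral 0) (cbox a b)" by simp
  then have "h \<zeta> = 0"
    by (intro has_integral_0_cbox_imp_0[of a b h]) (use h \<zeta> ab in \<open>auto simp: h_def\<close>)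
  then show ?thesis by (simp add: h_def)
qed

lemma ac_repD:
  assumes "ac_rep a b x g d"
  shows "eq_ae a b x g" "d \<in> L2 a b"
    "\<zeta> \<in> {a..b} \<Longrightarrow> g \<zeta> = g a + (LINT \<eta>|lebesgue_on {a..\<zeta>}. d \<eta>)"
  using assms unfolding ac_rep_def by blast+

lemma ac_rep_continuous:
  assumes "ac_rep a b x g d" shows "continuous_on {a..b} g"
proof -
  have "continuous_on {a..b} (\<lambda>\<zeta>. g a + (LINT \<eta>|lebesgue_on {a..\<zeta>}. d \<eta>))"
    by (intro continuous_intros primitive_continuous L2_integrable ac_repD(2)[OF assms])
  then show ?thesis by (rule continuous_on_eq) (rule ac_repD(3)[OF assms, symmetric])
qed

lemma ac_rep_unique:
  assumes ab: "a < b" and 1: "ac_rep a b x g d" and 2: "ac_rep a b x g' d'"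
  shows "\<zeta> \<in> {a..b} \<Longrightarrow> g \<zeta> = g' \<zeta>" and "eq_ae a b d d'"
proof -
  have xg: "AE \<zeta> in lebesgue_on {a..b}. x \<zeta> = g \<zeta>" and xg': "AE \<zeta> in lebesgue_on {a..b}. x \<zeta> = g' \<zeta>"
    using ac_repD(1)[OF 1] ac_repD(1)[OF 2] by (simp_all add: eq_ae_def)
  have "AE \<zeta> in lebesgue_on {a..b}. g \<zeta> = g' \<zeta>" by (rule eventually_elim2[OF xg xg']) simp
  then have "eq_ae a b g g'" by (simp add: eq_ae_def)
  then have gg': "g \<zeta> = g' \<zeta>" if "\<zeta> \<in> {a..b}" for \<zeta>
    using continuous_AE_eq_imp_eq[OF ab ac_rep_continuous[OF 1] ac_rep_continuous[OF 2]] that by blast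
  then show "\<zeta> \<in> {a..b} \<Longrightarrow> g \<zeta> = g' \<zeta>" .
  have d: "integrable (lebesgue_on {a..b}) d" "integrable (lebesgue_on {a..b}) d'"
    using ac_repD(2)[OF 1] ac_repD(2)[OF 2] by (simp_all add: L2_integrable)
  have "AE \<zeta> in lebesgue_on {a..b}. d \<zeta> - d' \<zeta> = 0"
  proof (rule AE_zero_if_primitive_zero[OF _ ab])
    show "integrable (lebesgue_on {a..b}) (\<lambda>\<zeta>. d \<zeta> - d' \<zeta>)" using d by simp
    fix \<zeta> assume \<zeta>: "\<zeta> \<in> {a..b}"
    then have sub: "{a..\<zeta>} \<subseteq> {a..b}" by auto
    have "(LINT \<eta>|lebesgue_on {a..\<zeta>}. d \<eta> - d' \<eta>) = (LINT \<eta>|lebesgue_on {a..\<zeta>}. d \<eta>) - (LINT \<eta>|lebesgue_on {a..\<zeta>}. d' \<eta>)"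
      by (intro Bochner_Integration.integral_diff integrable_subinterval[OF _ sub] d)
    also have "\<dots> = 0"
    proof -
      have "g \<zeta> = g a + (LINT \<eta>|lebesgue_on {a..\<zeta>}. d \<eta>)" "g' \<zeta> = g' a + (LINT \<eta>|lebesgue_on {a..\<zeta>}. d' \<eta>)"
        using ac_repD(3)[OF 1 \<zeta>] ac_repD(3)[OF 2 \<zeta>] .
      then show ?thesis using gg'[OF \<zeta>] gg'[of a] ab by simp
    qed
    finally show "(LINT \<eta>|lebesgue_on {a..\<zeta>}. d \<eta> - d' \<eta>) = 0" .
  qed
  then show "eq_ae a b d d'" by (simp add: eq_ae_def)
qed

text \<open>
  Integration by parts for \<open>g\<close> with \<open>g(a) = 0\<close> and \<open>g' = d\<close>. By symmetry of \<open>L\<close>, the integrals of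
  \<open>(L d(\<zeta>) | d(\<eta>))\<close> over the triangles \<open>\<eta> \<le> \<zeta>\<close> and \<open>\<zeta> \<le> \<eta>\<close> are equal, and together they give the
  integral over the square, which is \<open>(L D | D)\<close>.
\<close>

lemma primitive_integration_by_parts:
  fixes d :: "real \<Rightarrow> 'v::euclidean_space" and L :: "'v \<Rightarrow> 'v"
  assumes L: "linear L" and sym: "\<And>x y. L x \<bullet> y = x \<bullet> L y" and d: "integrable (lebesgue_on {a..b}) d"
  defines "D \<equiv> (LINT \<eta>|lebesgue_on {a..b}. d \<eta>)"
  shows "2 * (LINT \<zeta>|lebesgue_on {a..b}. L (d \<zeta>) \<bullet> (LINT \<eta>|lebesgue_on {a..\<zeta>}. d \<eta>)) = L D \<bullet> D"
proof -
  let ?M = "lebesgue_on {a..b}"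
  interpret finite_measure ?M by (rule finite_measure_interval)
  interpret pair_sigma_finite ?M ?M ..
  have Lb: "bounded_linear L" using L by (simp add: linear_conv_bounded_linear)
  have Ld: "integrable ?M (\<lambda>\<zeta>. L (d \<zeta>))" by (rule integrable_bounded_linear[OF Lb d])
  have dm[measurable]: "d \<in> borel_measurable ?M" and Ldm[measurable]: "(\<lambda>\<zeta>. L (d \<zeta>)) \<in> borel_measurable ?M"
    using d Ld by auto
  have id: "(\<lambda>x. x) \<in> borel_measurable ?M" by (intro measurable_restrict_space1 measurable_completion) simp
  note fst_m = measurable_compose[OF measurable_fst id, of ?M]
    and snd_m = measurable_compose[OF measurable_snd id, of ?M]
    and Ld_m = measurable_compose[OF measurable_fst Ldm, of ?M]
    and d_m = measurable_compose[OF measurable_snd dm, of ?M]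
  define F where "F \<zeta> \<eta> = indicator {..\<zeta>} \<eta> *\<^sub>R (L (d \<zeta>) \<bullet> d \<eta>)" for \<zeta> \<eta>
  define F' where "F' \<zeta> \<eta> = indicator {\<zeta>..} \<eta> *\<^sub>R (L (d \<zeta>) \<bullet> d \<eta>)" for \<zeta> \<eta>
  have meas: "(\<lambda>p. (if snd p \<le> fst p then 1 else 0) *\<^sub>R (L (d (fst p)) \<bullet> d (snd p))) \<in> borel_measurable (?M \<Otimes>\<^sub>M ?M)"
    "(\<lambda>p. (if fst p \<le> snd p then 1 else 0) *\<^sub>R (L (d (fst p)) \<bullet> d (snd p))) \<in> borel_measurable (?M \<Otimes>\<^sub>M ?M)"
    by (intro borel_measurable_scaleR borel_measurable_inner Ld_m d_m measurable_If borel_measurable_const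
        borel_measurable_le fst_m snd_m)+
  have Fm[measurable]: "case_prod F \<in> borel_measurable (?M \<Otimes>\<^sub>M ?M)" "case_prod F' \<in> borel_measurable (?M \<Otimes>\<^sub>M ?M)"
  proof -
    have "case_prod F = (\<lambda>p. (if snd p \<le> fst p then 1 else 0) *\<^sub>R (L (d (fst p)) \<bullet> d (snd p)))"
      "case_prod F' = (\<lambda>p. (if fst p \<le> snd p then 1 else 0) *\<^sub>R (L (d (fst p)) \<bullet> d (snd p)))"
      by (auto simp: F_def F'_def fun_eq_iff)
    then show "case_prod F \<in> borel_measurable (?M \<Otimes>\<^sub>M ?M)" "case_prod F' \<in> borel_measurable (?M \<Otimes>\<^sub>M ?M)"
      using meas by simp_all
  qed
  have norm_int: "integrable ?M (\<lambda>\<eta>. norm (d \<eta>))" "integrable ?M (\<lambda>\<zeta>. norm (L (d \<zeta>)))" using d Ld by auto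
  have prod_int: "integrable (?M \<Otimes>\<^sub>M ?M) (\<lambda>p. norm (L (d (fst p))) * norm (d (snd p)))"
  proof (rule Fubini_integrable)
    show "integrable ?M (\<lambda>x. LINT y|?M. norm (norm (L (d (fst (x, y)))) * norm (d (snd (x, y)))))"
      using norm_int by simp
    show "AE x in ?M. integrable ?M (\<lambda>y. norm (L (d (fst (x, y)))) * norm (d (snd (x, y))))"
      using norm_int by simp
    show "(\<lambda>p. norm (L (d (fst p))) * norm (d (snd p))) \<in> borel_measurable (?M \<Otimes>\<^sub>M ?M)"
      by (intro borel_measurable_times measurable_compose[OF Ld_m borel_measurable_norm] measurable_compose[OF d_m borel_measurable_norm])
  qed
  have F_int: "integrable (?M \<Otimes>\<^sub>M ?M) (case_prod F)" "integrable (?M \<Otimes>\<^sub>M ?M) (case_prod F')"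
    by (rule Bochner_Integration.integrable_bound[OF prod_int];
        auto simp: F_def F'_def Cauchy_Schwarz_ineq2 split: split_indicator)+
  have inner_int: "integrable ?M (\<lambda>\<eta>. L (d \<zeta>) \<bullet> d \<eta>)" for \<zeta> using d by simp
  have ind: "(indicator S :: real \<Rightarrow> real) \<in> borel_measurable ?M" if "S \<in> sets borel" for S
    using that by (intro measurable_restrict_space1 borel_measurable_indicator sets_completionI_sets) simp
  have F_row: "integrable ?M (F \<zeta>)" "integrable ?M (F' \<zeta>)" for \<zeta>
  proof -
    have "F \<zeta> \<in> borel_measurable ?M" "F' \<zeta> \<in> borel_measurable ?M"
      unfolding F_def F'_def
      by (rule borel_measurable_scaleR[OF ind borel_measurable_integrable[OF inner_int]]; simp)+
    then show "integrable ?M (F \<zeta>)" "integrable ?M (F' \<zeta>)"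
      by (auto intro!: Bochner_Integration.integrable_bound[OF inner_int[of \<zeta>]] simp: F_def F'_def split: split_indicator)
  qed
  have comm: "L (d x) \<bullet> d y = L (d y) \<bullet> d x" for x y unfolding sym[of "d x"] by (rule inner_commute)
  have FF': "F y x = F' x y" for x y
    by (simp add: F_def F'_def comm[of y x] split: split_indicator)
  define I where "I = (LINT \<zeta>|?M. LINT \<eta>|?M. F \<zeta> \<eta>)"
  have swap: "I = (LINT \<zeta>|?M. LINT \<eta>|?M. F' \<zeta> \<eta>)"
  proof -
    have "I = (LINT \<eta>|?M. LINT \<zeta>|?M. F \<zeta> \<eta>)" unfolding I_def by (rule Fubini_integral[OF F_int(1), symmetric])
    also have "\<dots> = (LINT \<zeta>|?M. LINT \<eta>|?M. F' \<zeta> \<eta>)"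
      by (simp only: FF')
    finally show ?thesis .
  qed
  have sum: "(LINT \<eta>|?M. F \<zeta> \<eta>) + (LINT \<eta>|?M. F' \<zeta> \<eta>) = L (d \<zeta>) \<bullet> D" for \<zeta>
  proof -
    have "(LINT \<eta>|?M. F \<zeta> \<eta>) + (LINT \<eta>|?M. F' \<zeta> \<eta>) = (LINT \<eta>|?M. F \<zeta> \<eta> + F' \<zeta> \<eta>)"
      using F_row by simp
    also have "\<dots> = (LINT \<eta>|?M. L (d \<zeta>) \<bullet> d \<eta>)"
    proof (rule integral_cong_AE)
      have "AE \<eta> in lebesgue. \<eta> \<noteq> \<zeta>" by (rule AE_completion) (rule AE_lborel_singleton)
      then have "AE \<eta> in ?M. \<eta> \<noteq> \<zeta>" using AE_restrict_space_iff[of "{a..b}" lebesgue] by (simp add: eventually_mono)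
      then show "AE \<eta> in ?M. F \<zeta> \<eta> + F' \<zeta> \<eta> = L (d \<zeta>) \<bullet> d \<eta>"
        by eventually_elim (auto simp: F_def F'_def split: split_indicator)
    qed (use F_row inner_int in auto)
    also have "\<dots> = L (d \<zeta>) \<bullet> D" unfolding D_def using d by simp
    finally show ?thesis .
  qed
  have row: "(LINT \<eta>|?M. F \<zeta> \<eta>) = L (d \<zeta>) \<bullet> (LINT \<eta>|lebesgue_on {a..\<zeta>}. d \<eta>)" if "\<zeta> \<in> {a..b}" for \<zeta>
  proof -
    have "integrable (lebesgue_on {a..\<zeta>}) d" using that by (intro integrable_subinterval[OF d]) auto
    then have "L (d \<zeta>) \<bullet> (LINT \<eta>|lebesgue_on {a..\<zeta>}. d \<eta>) = (LINT \<eta>|lebesgue_on {a..\<zeta>}. L (d \<zeta>) \<bullet> d \<eta>)" by simp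
    also have "\<dots> = (LINT \<eta>|?M. F \<zeta> \<eta>)"
      unfolding lebesgue_on_lemmas F_def using that
      by (intro Bochner_Integration.integral_cong refl) (auto split: split_indicator)
    finally show ?thesis by simp
  qed
  have "2 * I = I + (LINT \<zeta>|?M. LINT \<eta>|?M. F' \<zeta> \<eta>)" using swap by simp
  also have "\<dots> = (LINT \<zeta>|?M. (LINT \<eta>|?M. F \<zeta> \<eta>) + (LINT \<eta>|?M. F' \<zeta> \<eta>))"
    unfolding I_def using integrable_fst[OF F_int(1)] integrable_fst[OF F_int(2)] by simp
  also have "\<dots> = (LINT \<zeta>|?M. L (d \<zeta>) \<bullet> D)" by (simp only: sum)
  also have "\<dots> = (LINT \<zeta>|?M. L (d \<zeta>)) \<bullet> D" using Ld by simp
  also have "(LINT \<zeta>|?M. L (d \<zeta>)) = L D" unfolding D_def by (rule integral_bounded_linear[OF Lb d])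
  finally have "2 * I = L D \<bullet> D" .
  moreover have "I = (LINT \<zeta>|?M. L (d \<zeta>) \<bullet> (LINT \<eta>|lebesgue_on {a..\<zeta>}. d \<eta>))"
    unfolding I_def by (intro Bochner_Integration.integral_cong refl row) simp
  ultimately show ?thesis by simp
qed

section \<open>The resolvent equation of the port-Hamiltonian operator\<close>

lemma L2_iff: "x \<in> L2 a b \<longleftrightarrow> (\<lambda>\<zeta>. indicator {a..b} \<zeta> *\<^sub>R x \<zeta>) \<in> sq_int"
proof -
  have "(norm (indicator {a..b} \<zeta> *\<^sub>R x \<zeta>))\<^sup>2 = indicator {a..b} \<zeta> *\<^sub>R (norm (x \<zeta>))\<^sup>2" for \<zeta>
    by (simp split: split_indicator)
  then show ?thesis
    unfolding L2_def sq_int_def mem_Collect_eq lebesgue_on_lemmas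
    by (simp add: borel_measurable_restrict_space_iff)
qed

lemma L2_add: "x \<in> L2 a b \<Longrightarrow> y \<in> L2 a b \<Longrightarrow> (\<lambda>\<zeta>. x \<zeta> + y \<zeta>) \<in> L2 a b"
  unfolding L2_iff scaleR_add_right by (rule sq_int_add)

lemma L2_diff: "x \<in> L2 a b \<Longrightarrow> y \<in> L2 a b \<Longrightarrow> (\<lambda>\<zeta>. x \<zeta> - y \<zeta>) \<in> L2 a b"
  unfolding L2_iff scaleR_diff_right by (rule sq_int_diff)

lemma L2_0: "(\<lambda>\<zeta>. 0) \<in> L2 a b"
  by (simp add: L2_def)

lemma L2_dominated:
  fixes x y :: "real \<Rightarrow> 'k::real_or_complex^'n"
  assumes y: "y \<in> L2 a b" and x: "x \<in> borel_measurable (lebesgue_on {a..b})"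
    and le: "AE \<zeta> in lebesgue_on {a..b}. norm (x \<zeta>) \<le> C * norm (y \<zeta>)"
  shows "x \<in> L2 a b"
  unfolding L2_def
proof (intro CollectI conjI x)
  show "integrable (lebesgue_on {a..b}) (\<lambda>\<zeta>. (norm (x \<zeta>))\<^sup>2)"
  proof (rule Bochner_Integration.integrable_bound)
    show "integrable (lebesgue_on {a..b}) (\<lambda>\<zeta>. C\<^sup>2 * (norm (y \<zeta>))\<^sup>2)" using y by (simp add: L2_def)
    show "(\<lambda>\<zeta>. (norm (x \<zeta>))\<^sup>2) \<in> borel_measurable (lebesgue_on {a..b})" using x by simp
    show "AE \<zeta> in lebesgue_on {a..b}. norm ((norm (x \<zeta>))\<^sup>2) \<le> norm (C\<^sup>2 * (norm (y \<zeta>))\<^sup>2)"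
      using le
    proof eventually_elim
      case (elim \<zeta>)
      then have "(norm (x \<zeta>))\<^sup>2 \<le> (C * norm (y \<zeta>))\<^sup>2" by (intro power_mono) auto
      then show ?case by (simp add: power_mult_distrib)
    qed
  qed
qed

lemma L2_linear:
  fixes L :: "'k::real_or_complex^'n \<Rightarrow> 'k^'m"
  assumes L: "linear L" and x: "x \<in> L2 a b" shows "(\<lambda>\<zeta>. L (x \<zeta>)) \<in> L2 a b"
proof -
  have bl: "bounded_linear L" using L by (simp add: linear_conv_bounded_linear)
  have x_m: "x \<in> borel_measurable (lebesgue_on {a..b})" using x by (rule L2_measurable)
  have m: "(\<lambda>\<zeta>. L (x \<zeta>)) \<in> borel_measurable (lebesgue_on {a..b})"
    by (rule measurable_compose[OF x_m borel_measurable_continuous_onI]) (intro linear_continuous_on bl)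
  have "integrable (lebesgue_on {a..b}) (\<lambda>\<zeta>. (norm (L (x \<zeta>)))\<^sup>2)"
  proof (rule Bochner_Integration.integrable_bound)
    show "integrable (lebesgue_on {a..b}) (\<lambda>\<zeta>. (onorm L)\<^sup>2 * (norm (x \<zeta>))\<^sup>2)" using x by (simp add: L2_def)
    show "(\<lambda>\<zeta>. (norm (L (x \<zeta>)))\<^sup>2) \<in> borel_measurable (lebesgue_on {a..b})" using m by simp
    have "(norm (L (x \<zeta>)))\<^sup>2 \<le> (onorm L)\<^sup>2 * (norm (x \<zeta>))\<^sup>2" for \<zeta>
      using power_mono[OF onorm[OF bl, of "x \<zeta>"], of 2] by (simp add: power_mult_distrib)
    then show "AE \<zeta> in lebesgue_on {a..b}. norm ((norm (L (x \<zeta>)))\<^sup>2) \<le> norm ((onorm L)\<^sup>2 * (norm (x \<zeta>))\<^sup>2)"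
      by (auto intro!: AE_I2)
  qed
  with m show ?thesis by (simp add: L2_def)
qed

lemma linear_smult: "linear ((*s) (c :: 'k::real_or_complex) :: 'k^'n \<Rightarrow> 'k^'n)"
  by (rule linearI) (simp_all add: vec_eq_iff algebra_simps)

lemma L2_continuous:
  fixes g :: "real \<Rightarrow> 'k::real_or_complex^'n"
  assumes g: "continuous_on {a..b} g" shows "g \<in> L2 a b"
proof -
  have "continuous_on {a..b} (\<lambda>\<zeta>. (norm (g \<zeta>))\<^sup>2)" by (intro continuous_intros g)
  then have "integrable (lebesgue_on {a..b}) (\<lambda>\<zeta>. (norm (g \<zeta>))\<^sup>2)" by (rule continuous_imp_integrable_real)
  moreover have "g \<in> borel_measurable (lebesgue_on {a..b})"
    by (rule continuous_imp_measurable_on_sets_lebesgue[OF g]) simp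
  ultimately show ?thesis by (simp add: L2_def)
qed

lemma L2_inner_integrable:
  "x \<in> L2 a b \<Longrightarrow> y \<in> L2 a b \<Longrightarrow> integrable (lebesgue_on {a..b}) (\<lambda>\<zeta>. x \<zeta> \<bullet> y \<zeta>)"
proof -
  assume "x \<in> L2 a b" "y \<in> L2 a b"
  from sq_int_inner_integrable[OF this[unfolded L2_iff]]
  have "integrable lebesgue (\<lambda>\<zeta>. indicator {a..b} \<zeta> *\<^sub>R x \<zeta> \<bullet> indicator {a..b} \<zeta> *\<^sub>R y \<zeta>)" .
  moreover have "indicator {a..b} \<zeta> *\<^sub>R x \<zeta> \<bullet> indicator {a..b} \<zeta> *\<^sub>R y \<zeta> = indicator {a..b} \<zeta> *\<^sub>R (x \<zeta> \<bullet> y \<zeta>)" for \<zeta>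
    by (simp split: split_indicator)
  ultimately show ?thesis unfolding lebesgue_on_lemmas by (simp only:)
qed

lemma ac_rep_linear:
  assumes L: "linear (L :: 'k::real_or_complex^'n \<Rightarrow> 'k^'m)" and x: "ac_rep a b x g d"
  shows "ac_rep a b (\<lambda>\<zeta>. L (x \<zeta>)) (\<lambda>\<zeta>. L (g \<zeta>)) (\<lambda>\<zeta>. L (d \<zeta>))"
  unfolding ac_rep_def
proof (intro conjI ballI)
  have "AE \<zeta> in lebesgue_on {a..b}. x \<zeta> = g \<zeta>" using ac_repD(1)[OF x] by (simp add: eq_ae_def)
  then have "AE \<zeta> in lebesgue_on {a..b}. L (x \<zeta>) = L (g \<zeta>)" by eventually_elim simp
  then show "eq_ae a b (\<lambda>\<zeta>. L (x \<zeta>)) (\<lambda>\<zeta>. L (g \<zeta>))" by (simp add: eq_ae_def)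
  show "(\<lambda>\<zeta>. L (d \<zeta>)) \<in> L2 a b" by (rule L2_linear[OF L ac_repD(2)[OF x]])
  fix \<zeta> assume \<zeta>: "\<zeta> \<in> {a..b}"
  have bl: "bounded_linear L" using L by (simp add: linear_conv_bounded_linear)
  have "integrable (lebesgue_on {a..\<zeta>}) d"
    using \<zeta> by (intro integrable_subinterval[OF L2_integrable[OF ac_repD(2)[OF x]]]) auto
  then have "(LINT \<eta>|lebesgue_on {a..\<zeta>}. L (d \<eta>)) = L (LINT \<eta>|lebesgue_on {a..\<zeta>}. d \<eta>)"
    by (rule integral_bounded_linear[OF bl])
  then show "L (g \<zeta>) = L (g a) + (LINT \<eta>|lebesgue_on {a..\<zeta>}. L (d \<eta>))"
    using ac_repD(3)[OF x \<zeta>] linear_add[OF L] by simp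
qed

lemma ac_rep_add:
  assumes x: "ac_rep a b x g d" and y: "ac_rep a b y h e"
  shows "ac_rep a b (\<lambda>\<zeta>. x \<zeta> + y \<zeta>) (\<lambda>\<zeta>. g \<zeta> + h \<zeta>) (\<lambda>\<zeta>. d \<zeta> + e \<zeta>)"
  unfolding ac_rep_def
proof (intro conjI ballI)
  have "AE \<zeta> in lebesgue_on {a..b}. x \<zeta> = g \<zeta>" "AE \<zeta> in lebesgue_on {a..b}. y \<zeta> = h \<zeta>"
    using ac_repD(1)[OF x] ac_repD(1)[OF y] by (simp_all add: eq_ae_def)
  then have "AE \<zeta> in lebesgue_on {a..b}. x \<zeta> + y \<zeta> = g \<zeta> + h \<zeta>" by eventually_elim simp
  then show "eq_ae a b (\<lambda>\<zeta>. x \<zeta> + y \<zeta>) (\<lambda>\<zeta>. g \<zeta> + h \<zeta>)" by (simp add: eq_ae_def)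
  show "(\<lambda>\<zeta>. d \<zeta> + e \<zeta>) \<in> L2 a b" by (rule L2_add[OF ac_repD(2)[OF x] ac_repD(2)[OF y]])
  fix \<zeta> assume \<zeta>: "\<zeta> \<in> {a..b}"
  have "integrable (lebesgue_on {a..\<zeta>}) d" "integrable (lebesgue_on {a..\<zeta>}) e"
    using \<zeta> by (auto intro: integrable_subinterval[OF L2_integrable[OF ac_repD(2)[OF x]]]
        integrable_subinterval[OF L2_integrable[OF ac_repD(2)[OF y]]])
  then have "(LINT \<eta>|lebesgue_on {a..\<zeta>}. d \<eta> + e \<eta>) = (LINT \<eta>|lebesgue_on {a..\<zeta>}. d \<eta>) + (LINT \<eta>|lebesgue_on {a..\<zeta>}. e \<eta>)"
    by (rule Bochner_Integration.integral_add)
  then show "g \<zeta> + h \<zeta> = g a + h a + (LINT \<eta>|lebesgue_on {a..\<zeta>}. d \<eta> + e \<eta>)"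
    using ac_repD(3)[OF x \<zeta>] ac_repD(3)[OF y \<zeta>] by simp
qed

lemma ac_rep_cong_left:
  assumes "eq_ae a b x y" shows "ac_rep a b x = ac_rep a b y"
proof -
  have "eq_ae a b x g \<longleftrightarrow> eq_ae a b y g" for g
    unfolding eq_ae_def
  proof
    assume "AE \<zeta> in lebesgue_on {a..b}. x \<zeta> = g \<zeta>"
    with assms[unfolded eq_ae_def] show "AE \<zeta> in lebesgue_on {a..b}. y \<zeta> = g \<zeta>" by eventually_elim simp
  next
    assume "AE \<zeta> in lebesgue_on {a..b}. y \<zeta> = g \<zeta>"
    with assms[unfolded eq_ae_def] show "AE \<zeta> in lebesgue_on {a..b}. x \<zeta> = g \<zeta>" by eventually_elim simp
  qed
  then show ?thesis by (simp add: ac_rep_def fun_eq_iff)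
qed

lemma H1_traceI:
  assumes ab: "a < b" and x: "ac_rep a b x g d" and \<zeta>: "\<zeta> \<in> {a..b}" shows "H1_trace a b x \<zeta> = g \<zeta>"
proof -
  have "\<exists>d. ac_rep a b x (H1_trace a b x) d"
    unfolding H1_trace_def by (rule someI_ex[of "\<lambda>g. \<exists>d. ac_rep a b x g d"]) (use x in blast)
  then obtain d' where "ac_rep a b x (H1_trace a b x) d'" ..
  from ac_rep_unique(1)[OF ab this x \<zeta>] show ?thesis .
qed

lemma H1_derivI:
  assumes ab: "a < b" and x: "ac_rep a b x g d" shows "eq_ae a b (H1_deriv a b x) d" "H1_deriv a b x \<in> L2 a b"
proof -
  have "\<exists>g. ac_rep a b x g (H1_deriv a b x)"
    unfolding H1_deriv_def by (rule someI_ex[of "\<lambda>d. \<exists>g. ac_rep a b x g d"]) (use x in blast)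
  then obtain g' where g': "ac_rep a b x g' (H1_deriv a b x)" ..
  from ac_rep_unique(2)[OF ab this x] show "eq_ae a b (H1_deriv a b x) d" .
  show "H1_deriv a b x \<in> L2 a b" by (rule ac_repD(2)[OF g'])
qed

text \<open>
  Traces are defined by choice of a representative; here this choice is eliminated.
\<close>

lemma dom_A_iff:
  assumes ab: "a < b"
  shows "x \<in> dom_A a b W \<longleftrightarrow> x \<in> L2 a b \<and> (\<exists>g d. ac_rep a b x g d \<and> W *v stack (g b) (g a) = 0)"
proof
  assume "x \<in> dom_A a b W"
  then obtain g d where x: "x \<in> L2 a b" "ac_rep a b x g d"
    and W: "W *v stack (H1_trace a b x b) (H1_trace a b x a) = 0"
    by (auto simp only: dom_A_def H1_def mem_Collect_eq)
  have "W *v stack (g b) (g a) = 0"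
    using W H1_traceI[OF ab x(2), of a] H1_traceI[OF ab x(2), of b] ab by simp
  with x show "x \<in> L2 a b \<and> (\<exists>g d. ac_rep a b x g d \<and> W *v stack (g b) (g a) = 0)" by blast
next
  assume "x \<in> L2 a b \<and> (\<exists>g d. ac_rep a b x g d \<and> W *v stack (g b) (g a) = 0)"
  then obtain g d where x: "x \<in> L2 a b" "ac_rep a b x g d" and W: "W *v stack (g b) (g a) = 0" by blast
  have "W *v stack (H1_trace a b x b) (H1_trace a b x a) = 0"
    using W H1_traceI[OF ab x(2), of a] H1_traceI[OF ab x(2), of b] ab by simp
  then show "x \<in> dom_A a b W" using x unfolding dom_A_def H1_def by blast
qed

lemma dissipation_integral:
  fixes P0 P1 :: "'k::real_or_complex^'n^'n"
  assumes ab: "a < b" and P1: "ctranspose P1 = P1" and P0: "\<And>x. (P0 *v x) \<bullet> x \<le> 0"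
    and x: "ac_rep a b x g d" and bc: "(P1 *v g b) \<bullet> g b \<le> (P1 *v g a) \<bullet> g a"
  shows "(LINT \<zeta>|lebesgue_on {a..b}. (P1 *v d \<zeta> + P0 *v g \<zeta>) \<bullet> g \<zeta>) \<le> 0"
proof -
  let ?M = "lebesgue_on {a..b}"
  have sym: "(P1 *v u) \<bullet> v = u \<bullet> (P1 *v v)" for u v using inner_ctranspose[of P1 u v] by (simp add: P1)
  have d: "d \<in> L2 a b" by (rule ac_repD(2)[OF x])
  have g: "g \<in> L2 a b" by (rule L2_continuous[OF ac_rep_continuous[OF x]])
  have P1d: "(\<lambda>\<zeta>. P1 *v d \<zeta>) \<in> L2 a b" by (rule L2_linear[OF linear_matrix_vector d])
  have P0g: "(\<lambda>\<zeta>. P0 *v g \<zeta>) \<in> L2 a b" by (rule L2_linear[OF linear_matrix_vector g])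
  have ga: "(\<lambda>\<zeta>. g a) \<in> L2 a b" by (rule L2_continuous) simp
  define D where "D = (LINT \<eta>|?M. d \<eta>)"
  have gb: "g b = g a + D" using ac_repD(3)[OF x, of b] ab by (simp add: D_def)
  have "(LINT \<zeta>|?M. (P1 *v d \<zeta> + P0 *v g \<zeta>) \<bullet> g \<zeta>) = (LINT \<zeta>|?M. (P1 *v d \<zeta>) \<bullet> g \<zeta>) + (LINT \<zeta>|?M. (P0 *v g \<zeta>) \<bullet> g \<zeta>)"
    unfolding inner_add_left
    by (rule Bochner_Integration.integral_add[OF L2_inner_integrable[OF P1d g] L2_inner_integrable[OF P0g g]])
  also have "(LINT \<zeta>|?M. (P0 *v g \<zeta>) \<bullet> g \<zeta>) \<le> 0"
    using integral_mono[OF L2_inner_integrable[OF P0g g], of "\<lambda>_. 0"] P0 by simp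
  also have "(LINT \<zeta>|?M. (P1 *v d \<zeta>) \<bullet> g \<zeta>) = (LINT \<zeta>|?M. (P1 *v d \<zeta>) \<bullet> g a + (P1 *v d \<zeta>) \<bullet> (g \<zeta> - g a))"
    by (simp add: inner_diff_right)
  also have "\<dots> = (LINT \<zeta>|?M. (P1 *v d \<zeta>) \<bullet> g a) + (LINT \<zeta>|?M. (P1 *v d \<zeta>) \<bullet> (g \<zeta> - g a))"
    by (rule Bochner_Integration.integral_add[OF L2_inner_integrable[OF P1d ga] L2_inner_integrable[OF P1d L2_diff[OF g ga]]])
  also have "(LINT \<zeta>|?M. (P1 *v d \<zeta>) \<bullet> g a) = (P1 *v D) \<bullet> g a"
    using integral_bounded_linear[OF bounded_linear_matrix_vector[of P1] L2_integrable[OF d]] L2_integrable[OF P1d]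
    by (simp add: D_def)
  also have "(LINT \<zeta>|?M. (P1 *v d \<zeta>) \<bullet> (g \<zeta> - g a)) = (LINT \<zeta>|?M. (P1 *v d \<zeta>) \<bullet> (LINT \<eta>|lebesgue_on {a..\<zeta>}. d \<eta>))"
  proof (rule Bochner_Integration.integral_cong[OF refl])
    fix \<zeta> assume "\<zeta> \<in> space ?M"
    then have "\<zeta> \<in> {a..b}" by simp
    from ac_repD(3)[OF x this] show "(P1 *v d \<zeta>) \<bullet> (g \<zeta> - g a) = (P1 *v d \<zeta>) \<bullet> (LINT \<eta>|lebesgue_on {a..\<zeta>}. d \<eta>)" by simp
  qed
  also have "\<dots> = ((P1 *v D) \<bullet> D) / 2"
    using primitive_integration_by_parts[OF linear_matrix_vector sym L2_integrable[OF d]] by (simp add: D_def)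
  also have "(P1 *v D) \<bullet> g a + ((P1 *v D) \<bullet> D) / 2 = ((P1 *v g b) \<bullet> g b - (P1 *v g a) \<bullet> g a) / 2"
    using sym[of "g a" D] by (simp add: gb matrix_vector_right_distrib inner_add_left inner_add_right inner_commute)
  also have "\<dots> + 0 \<le> 0" using bc by simp
  finally show ?thesis by simp
qed

lemma primitive_of_derivative:
  fixes y :: "real \<Rightarrow> 'v::euclidean_space"
  assumes y: "\<And>t. t \<in> {a..b} \<Longrightarrow> (y has_vector_derivative f t) (at t within {a..b})"
    and f: "continuous_on {a..b} f" and \<zeta>: "\<zeta> \<in> {a..b}"
  shows "y \<zeta> = y a + (LINT \<eta>|lebesgue_on {a..\<zeta>}. f \<eta>)"
proof -
  have sub: "{a..\<zeta>} \<subseteq> {a..b}" using \<zeta> by auto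
  have "(f has_integral (y \<zeta> - y a)) {a..\<zeta>}"
    using \<zeta> sub by (intro fundamental_theorem_of_calculus has_vector_derivative_within_subset[OF y sub]) auto
  then have "integral {a..\<zeta>} f = y \<zeta> - y a" by (rule integral_unique)
  moreover have "integrable (lebesgue_on {a..\<zeta>}) f"
    by (rule continuous_imp_integrable_real[OF continuous_on_subset[OF f sub]])
  ultimately show ?thesis by (simp add: lebesgue_integral_eq_integral)
qed

text \<open>
  The equation reads \<open>g' = N g - P\<^sub>1^-1 h / \<mu>\<close> with a matrix \<open>N\<close>. Adding solutions of the homogeneous equation
  with initial value \<open>c\<close> changes \<open>W (g(b), g(a))\<close> by \<open>T c\<close>, where \<open>T\<close> is a linear map of the
  finite-dimensional space to itself. If \<open>T c = 0\<close>, the homogeneous solution satisfies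
  \<open>g = \<mu> A g\<close>, so dissipativity implies \<open>(g | g) \<le> 0\<close> and hence \<open>c = 0\<close>. Therefore \<open>T\<close> is surjective, and the
  boundary value can be corrected to \<open>0\<close>.
\<close>

lemma boundary_value_problem:
  fixes P0 P1 :: "'k::real_or_complex^'n^'n" and W :: "'k^('n + 'n)^'n"
  assumes ab: "a < b" and P1: "ctranspose P1 = P1" "invertible P1" and P0: "\<And>x. (P0 *v x) \<bullet> x \<le> 0"
    and bc: "\<And>p q. W *v stack p q = 0 \<Longrightarrow> (P1 *v p) \<bullet> p \<le> (P1 *v q) \<bullet> q"
    and \<mu>: "0 < \<mu>" and h: "h \<in> L2 a b"
  obtains g d where "ac_rep a b g g d" "W *v stack (g b) (g a) = 0"
    "\<And>\<zeta>. g \<zeta> - \<mu> *\<^sub>R (P1 *v d \<zeta> + P0 *v g \<zeta>) = h \<zeta>"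
proof -
  obtain P1' where P1': "P1 ** P1' = mat 1" using P1(2) by (auto simp: invertible_def)
  define N where "N = Blinfun (\<lambda>x :: 'k^'n. P1' *v ((1 / \<mu>) *\<^sub>R x - P0 *v x))"
  have N: "N x = P1' *v ((1 / \<mu>) *\<^sub>R x - P0 *v x)" for x
  proof -
    have "linear (\<lambda>x :: 'k^'n. P1' *v ((1 / \<mu>) *\<^sub>R x - P0 *v x))"
      by (rule linearI)
        (simp_all add: matrix_vector_right_distrib matrix_vector_mult_diff_distrib matrix_vector_scaleR algebra_simps)
    then show ?thesis unfolding N_def
      by (subst bounded_linear_Blinfun_apply) (simp_all add: linear_conv_bounded_linear)
  qed
  have P1N: "P1 *v N x = (1 / \<mu>) *\<^sub>R x - P0 *v x" for x
    by (simp add: N matrix_vector_mul_assoc P1')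
  have N_cont: "continuous_on S (\<lambda>t. N (y t))" if "continuous_on S y" for y S
    by (intro bounded_bilinear.continuous_on[OF bounded_bilinear_blinfun_apply] continuous_on_const that)
  define hom where "hom c y \<longleftrightarrow> y a = c \<and> (\<forall>t\<in>{a..b}. (y has_vector_derivative N (y t)) (at t within {a..b}))" for c y
  have "\<exists>y. hom c y" for c
    unfolding hom_def
    by (rule linear_ode_solution[OF ab continuous_on_const[of _ N] continuous_on_const[of _ 0], of c]) auto
  then obtain Y where Y: "\<And>c. hom c (Y c)" by metis
  have hom_cont: "continuous_on {a..b} y" if "hom c y" for c y
    using that unfolding hom_def by (intro continuous_on_vector_derivative) blast
  \<comment> \<open>uniqueness for the differential equation, by the energy estimate with the identity as \<open>G\<close>\<close>
  have hom_zero: "y b = 0" if y: "hom 0 y" for y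
  proof -
    have "id_blinfun (y b) \<bullet> y b \<le> exp (2 * norm N * (b - a)) * (id_blinfun (y a) \<bullet> y a + 0 * (b - a))"
    proof (rule energy_estimate[where ?G1.0 = "\<lambda>_. 0" and ?w1.0 = "\<lambda>t. N (y t)"])
      show "continuous_on {a..b} y" by (rule hom_cont[OF y])
      fix r assume r: "r \<in> {a<..<b}"
      then have "at r within {a..b} = at r" by (intro at_within_interior) auto
      then show "(y has_vector_derivative N (y r)) (at r)" using y r unfolding hom_def by (metis atLeastAtMost_iff greaterThanLessThan_iff less_imp_le)
      have "N (y r) \<bullet> y r \<le> norm (N (y r)) * norm (y r)" by (rule norm_cauchy_schwarz)
      also have "\<dots> \<le> (norm N * norm (y r)) * norm (y r)" by (intro mult_right_mono norm_blinfun) auto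
      finally have "N (y r) \<bullet> y r \<le> norm N * (y r \<bullet> y r)" by (simp add: norm_eq_sqrt_inner mult.assoc)
      then show "2 * (id_blinfun (N (y r)) \<bullet> y r) + blinfun_apply 0 (y r) \<bullet> y r \<le> 2 * norm N * (id_blinfun (y r) \<bullet> y r) + 0"
        by simp
    qed (use ab in auto)
    then have "y b \<bullet> y b \<le> 0" using y by (simp add: hom_def)
    then show ?thesis by (metis inner_eq_zero_iff inner_ge_zero order_antisym)
  qed
  define \<Phi> where "\<Phi> c = Y c b" for c
  have lin: "linear \<Phi>"
  proof (rule linearI)
    fix c c' :: "'k^'n" and r :: real
    have "hom 0 (\<lambda>t. Y (c + c') t - Y c t - Y c' t)"
      using Y[of c] Y[of c'] Y[of "c + c'"] unfolding hom_def blinfun.diff_right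
      by (auto intro!: has_vector_derivative_diff)
    from hom_zero[OF this] show "\<Phi> (c + c') = \<Phi> c + \<Phi> c'" by (simp add: \<Phi>_def diff_eq_eq add.commute)
    have "hom 0 (\<lambda>t. Y (r *\<^sub>R c) t - r *\<^sub>R Y c t)"
      using Y[of c] Y[of "r *\<^sub>R c"] unfolding hom_def blinfun.diff_right blinfun.scaleR_right
      by (auto intro!: has_vector_derivative_diff bounded_linear.has_vector_derivative[OF bounded_linear_scaleR_right])
    from hom_zero[OF this] show "\<Phi> (r *\<^sub>R c) = r *\<^sub>R \<Phi> c" by (simp add: \<Phi>_def)
  qed
  define T where "T c = W *v stack (\<Phi> c) c" for c
  have T_lin: "linear T"
    by (rule linearI)
      (simp_all add: T_def linear_add[OF lin] linear_scale[OF lin] stack_add[symmetric] stack_scaleR[symmetric]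
        matrix_vector_right_distrib matrix_vector_scaleR)
  have "inj T"
  proof (rule linear_injective_0[OF T_lin, THEN iffD2], intro allI impI)
    fix c assume T0: "T c = 0"
    define g where "g = Y c"
    have g: "hom c g" by (simp add: g_def Y)
    have gc: "continuous_on {a..b} g" by (rule hom_cont[OF g])
    have Ng: "continuous_on {a..b} (\<lambda>t. N (g t))" by (rule N_cont[OF gc])
    have rep: "ac_rep a b g g (\<lambda>t. N (g t))"
      unfolding ac_rep_def
    proof (intro conjI ballI L2_continuous[OF Ng])
      show "eq_ae a b g g" by (simp add: eq_ae_def)
      show "g \<zeta> = g a + (LINT \<eta>|lebesgue_on {a..\<zeta>}. N (g \<eta>))" if "\<zeta> \<in> {a..b}" for \<zeta>
        using g that unfolding hom_def by (intro primitive_of_derivative[OF _ Ng]) blast+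
    qed
    have ga: "g a = c" using g by (simp add: hom_def)
    have "(P1 *v g b) \<bullet> g b \<le> (P1 *v g a) \<bullet> g a"
      using T0 by (intro bc) (simp add: T_def \<Phi>_def ga flip: g_def)
    from dissipation_integral[OF ab P1(1) P0 rep this]
    have "(LINT \<zeta>|lebesgue_on {a..b}. (1 / \<mu>) * (g \<zeta> \<bullet> g \<zeta>)) \<le> 0" by (simp add: P1N)
    then have le: "(LINT \<zeta>|lebesgue_on {a..b}. g \<zeta> \<bullet> g \<zeta>) \<le> 0" using \<mu> by (simp add: mult_le_0_iff divide_le_0_iff)
    have gL: "g \<in> L2 a b" by (rule L2_continuous[OF gc])
    have "0 \<le> (LINT \<zeta>|lebesgue_on {a..b}. g \<zeta> \<bullet> g \<zeta>)" by simp
    with le have "(LINT \<zeta>|lebesgue_on {a..b}. g \<zeta> \<bullet> g \<zeta>) = 0" by simp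
    then have "AE \<zeta> in lebesgue_on {a..b}. g \<zeta> \<bullet> g \<zeta> = 0"
      by (subst (asm) integral_nonneg_eq_0_iff_AE[OF L2_inner_integrable[OF gL gL]]) auto
    then have "eq_ae a b g (\<lambda>_. 0)" by (simp add: eq_ae_def)
    from continuous_AE_eq_imp_eq[OF ab gc continuous_on_const this, of a] ab show "c = 0" by (simp add: ga)
  qed
  then have surj: "surj T" using linear_injective_imp_surjective[OF T_lin] by simp
  \<comment> \<open>\<open>h\<close> is only square integrable, so \<open>g\<close> is split into the primitive \<open>k1\<close> of the term with \<open>h\<close>
    and a remainder \<open>u\<close> that is continuously differentiable\<close>
  define k where "k \<zeta> = - ((1 / \<mu>) *\<^sub>R (P1' *v h \<zeta>))" for \<zeta>
  have k_lin: "linear (\<lambda>x. - ((1 / \<mu>) *\<^sub>R (P1' *v x)))"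
    by (rule linearI) (simp_all add: matrix_vector_right_distrib matrix_vector_scaleR algebra_simps)
  have k: "k \<in> L2 a b" unfolding k_def by (rule L2_linear[OF k_lin h])
  define k1 where "k1 \<zeta> = (LINT \<eta>|lebesgue_on {a..\<zeta>}. k \<eta>)" for \<zeta>
  have k1: "continuous_on {a..b} k1" unfolding k1_def by (rule primitive_continuous[OF L2_integrable[OF k]])
  have k1a: "k1 a = 0"
  proof -
    have "integrable (lebesgue_on {a..a}) k" using ab by (intro integrable_subinterval[OF L2_integrable[OF k]]) auto
    then have "k1 a = integral (cbox a a) k"
      unfolding k1_def cbox_interval by (rule lebesgue_integral_eq_integral) (rule lmeasurable_interval[THEN fmeasurableD])
    then show ?thesis by (simp only: integral_refl)
  qed
  obtain y where y: "y a = 0" "\<And>t. t \<in> {a..b} \<Longrightarrow> (y has_vector_derivative N (y t) + N (k1 t)) (at t within {a..b})"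
    by (rule linear_ode_solution[OF ab continuous_on_const[of _ N] N_cont[OF k1], of 0]) auto
  obtain c where c: "- (W *v stack (y b + k1 b) 0) = T c" using surjD[OF surj] by blast
  define u where "u t = y t + Y c t" for t
  have u_deriv: "(u has_vector_derivative N (u t + k1 t)) (at t within {a..b})" if "t \<in> {a..b}" for t
  proof -
    have "(Y c has_vector_derivative N (Y c t)) (at t within {a..b})" using Y[of c] that by (auto simp: hom_def)
    from has_vector_derivative_add[OF y(2)[OF that] this] show ?thesis
      by (simp add: u_def[abs_def] blinfun.add_right add_ac)
  qed
  have u_cont: "continuous_on {a..b} u" by (rule continuous_on_vector_derivative[OF u_deriv])
  define g where "g t = u t + k1 t" for t
  define d where "d t = N (g t) + k t" for t
  have g_cont: "continuous_on {a..b} g" unfolding g_def by (intro continuous_intros u_cont k1)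
  have Ng: "continuous_on {a..b} (\<lambda>t. N (g t))" by (rule N_cont[OF g_cont])
  show ?thesis
  proof (rule that[of g d])
    have ga: "g a = c" using Y[of c] by (simp add: g_def u_def y(1) hom_def k1a)
    show "ac_rep a b g g d"
      unfolding ac_rep_def
    proof (intro conjI ballI)
      show "eq_ae a b g g" by (simp add: eq_ae_def)
      show "d \<in> L2 a b" unfolding d_def by (rule L2_add[OF L2_continuous[OF Ng] k])
      fix \<zeta> assume \<zeta>: "\<zeta> \<in> {a..b}"
      then have sub: "{a..\<zeta>} \<subseteq> {a..b}" by auto
      have "(LINT \<eta>|lebesgue_on {a..\<zeta>}. d \<eta>) = (LINT \<eta>|lebesgue_on {a..\<zeta>}. N (g \<eta>)) + k1 \<zeta>"
        unfolding d_def k1_def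
        by (rule Bochner_Integration.integral_add)
          (rule integrable_subinterval[OF L2_integrable sub] L2_continuous[OF Ng] k)+
      moreover have "u \<zeta> = u a + (LINT \<eta>|lebesgue_on {a..\<zeta>}. N (g \<eta>))"
        using u_deriv by (intro primitive_of_derivative[OF _ Ng \<zeta>]) (simp add: g_def)
      ultimately show "g \<zeta> = g a + (LINT \<eta>|lebesgue_on {a..\<zeta>}. d \<eta>)" by (simp add: g_def k1a)
    qed
    have "stack (g b) (g a) = stack (y b + k1 b) 0 + stack (\<Phi> c) c"
      by (simp add: stack_add ga) (simp add: g_def u_def \<Phi>_def add_ac)
    then have "W *v stack (g b) (g a) = W *v stack (y b + k1 b) 0 + T c"
      by (simp only: matrix_vector_right_distrib T_def)
    then show "W *v stack (g b) (g a) = 0" by (simp add: c[symmetric])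
    fix \<zeta>
    have "P1 *v d \<zeta> = (1 / \<mu>) *\<^sub>R g \<zeta> - P0 *v g \<zeta> - (1 / \<mu>) *\<^sub>R h \<zeta>"
    proof -
      have "P1 *v k \<zeta> = - ((1 / \<mu>) *\<^sub>R h \<zeta>)"
        using matrix_vector_scaleR[of P1 "- (1 / \<mu>)" "P1' *v h \<zeta>"]
        by (simp add: k_def matrix_vector_mul_assoc P1')
      then show ?thesis by (simp add: d_def matrix_vector_right_distrib P1N)
    qed
    then show "g \<zeta> - \<mu> *\<^sub>R (P1 *v d \<zeta> + P0 *v g \<zeta>) = h \<zeta>"
      using \<mu> by (simp add: scaleR_diff_right)
  qed
qed

section \<open>Embedding of functions on an interval, and multiplication operators\<close>

definition emb :: "real \<Rightarrow> real \<Rightarrow> (real \<Rightarrow> 'k::real_or_complex^'n) \<Rightarrow> ('k^'n) l2" where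
  "emb a b x = cls (\<lambda>\<zeta>. indicator {a..b} \<zeta> *\<^sub>R x \<zeta>)"

lemma emb_add: "x \<in> L2 a b \<Longrightarrow> y \<in> L2 a b \<Longrightarrow> emb a b (\<lambda>\<zeta>. x \<zeta> + y \<zeta>) = emb a b x + emb a b y"
  unfolding emb_def L2_iff scaleR_add_right by (rule cls_add)

lemma emb_diff: "x \<in> L2 a b \<Longrightarrow> y \<in> L2 a b \<Longrightarrow> emb a b (\<lambda>\<zeta>. x \<zeta> - y \<zeta>) = emb a b x - emb a b y"
  unfolding emb_def L2_iff scaleR_diff_right by (rule cls_diff)

lemma emb_scaleR: "x \<in> L2 a b \<Longrightarrow> emb a b (\<lambda>\<zeta>. c *\<^sub>R x \<zeta>) = c *\<^sub>R emb a b x"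
  unfolding emb_def L2_iff scaleR_left_commute[of _ c] by (rule cls_scaleR)

lemma emb_inner:
  assumes "x \<in> L2 a b" "y \<in> L2 a b"
  shows "emb a b x \<bullet> emb a b y = (LINT \<zeta>|lebesgue_on {a..b}. x \<zeta> \<bullet> y \<zeta>)"
proof -
  have "emb a b x \<bullet> emb a b y = (LINT \<zeta>|lebesgue. indicator {a..b} \<zeta> *\<^sub>R x \<zeta> \<bullet> indicator {a..b} \<zeta> *\<^sub>R y \<zeta>)"
    unfolding emb_def using assms by (intro inner_cls) (simp_all add: L2_iff)
  also have "\<dots> = (LINT \<zeta>|lebesgue. indicator {a..b} \<zeta> *\<^sub>R (x \<zeta> \<bullet> y \<zeta>))"
    by (intro Bochner_Integration.integral_cong refl) (simp split: split_indicator)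
  finally show ?thesis by (simp only: lebesgue_on_lemmas)
qed

lemma norm_emb: "x \<in> L2 a b \<Longrightarrow> norm (emb a b x) = L2_norm a b x"
  by (simp add: norm_eq_sqrt_inner emb_inner L2_norm_def)

lemma emb_eq_iff:
  assumes "x \<in> L2 a b" "y \<in> L2 a b" shows "emb a b x = emb a b y \<longleftrightarrow> eq_ae a b x y"
proof -
  have "emb a b x = emb a b y \<longleftrightarrow> (AE \<zeta> in lebesgue. indicator {a..b} \<zeta> *\<^sub>R x \<zeta> = indicator {a..b} \<zeta> *\<^sub>R y \<zeta>)"
    unfolding emb_def using assms by (intro cls_eq_iff) (simp_all add: L2_iff)
  also have "\<dots> \<longleftrightarrow> (AE \<zeta> in lebesgue. \<zeta> \<in> {a..b} \<longrightarrow> x \<zeta> = y \<zeta>)"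
    by (rule AE_cong) (auto split: split_indicator)
  also have "\<dots> \<longleftrightarrow> eq_ae a b x y" unfolding eq_ae_def by (simp add: AE_restrict_space_iff)
  finally show ?thesis .
qed

lemma emb_cong: "x \<in> L2 a b \<Longrightarrow> y \<in> L2 a b \<Longrightarrow> eq_ae a b x y \<Longrightarrow> emb a b x = emb a b y"
  by (simp add: emb_eq_iff)

lemma AE_lebesgue_on_interval: "AE \<zeta> in lebesgue. P \<zeta> \<Longrightarrow> AE \<zeta> in lebesgue_on {a..b::real}. P \<zeta>"
  by (simp add: AE_restrict_space_iff) (erule eventually_mono, simp)

lemma rep_L2: "rep f \<in> L2 a b"
proof -
  have f: "integrable lebesgue (\<lambda>\<zeta>. (norm (rep f \<zeta>))\<^sup>2)" "rep f \<in> borel_measurable lebesgue"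
    using rep_sq_int[of f] by (auto simp: sq_int_def)
  have "integrable lebesgue (\<lambda>\<zeta>. indicator {a..b} \<zeta> *\<^sub>R (norm (rep f \<zeta>))\<^sup>2)"
    by (rule integrable_mult_indicator[OF _ f(1)]) simp
  then show ?thesis
    unfolding L2_def mem_Collect_eq lebesgue_on_lemmas using f(2) by (auto intro: measurable_restrict_space1)
qed

lemma rep_emb:
  assumes "x \<in> L2 a b" shows "eq_ae a b (rep (emb a b x)) x"
proof -
  have "AE \<zeta> in lebesgue. rep (emb a b x) \<zeta> = indicator {a..b} \<zeta> *\<^sub>R x \<zeta>"
    unfolding emb_def by (rule rep_cls) (use assms in \<open>simp add: L2_iff\<close>)
  then show ?thesis
    unfolding eq_ae_def by (simp add: AE_restrict_space_iff) (erule eventually_mono, simp)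
qed

text \<open>
  The orthogonal projection onto the functions that vanish outside \<open>[a,b]\<close>.
\<close>

definition restr :: "real \<Rightarrow> real \<Rightarrow> ('k::real_or_complex^'n) l2 \<Rightarrow> ('k^'n) l2" where
  "restr a b f = emb a b (rep f)"

lemma restr_emb: "x \<in> L2 a b \<Longrightarrow> restr a b (emb a b x) = emb a b x"
  unfolding restr_def by (intro emb_cong rep_L2 rep_emb)

lemma eq_ae_rep:
  shows rep_add_ae: "eq_ae a b (rep (f + g)) (\<lambda>\<zeta>. rep f \<zeta> + rep g \<zeta>)"
    and rep_diff_ae: "eq_ae a b (rep (f - g)) (\<lambda>\<zeta>. rep f \<zeta> - rep g \<zeta>)"
    and rep_scaleR_ae: "eq_ae a b (rep (c *\<^sub>R f)) (\<lambda>\<zeta>. c *\<^sub>R rep f \<zeta>)"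
  unfolding eq_ae_def by (rule AE_lebesgue_on_interval, rule rep_add rep_diff rep_scaleR)+

lemma L2_scaleR: "x \<in> L2 a b \<Longrightarrow> (\<lambda>\<zeta>. c *\<^sub>R x \<zeta>) \<in> L2 a b"
  by (rule L2_linear) (simp_all add: linear_scale_self linear_compose_scale_right linear_id[unfolded id_def])

lemma restr_add: "restr a b (f + g) = restr a b f + restr a b g"
  unfolding restr_def emb_add[OF rep_L2 rep_L2, symmetric] by (intro emb_cong rep_L2 L2_add rep_add_ae)

lemma restr_diff: "restr a b (f - g) = restr a b f - restr a b g"
  unfolding restr_def emb_diff[OF rep_L2 rep_L2, symmetric] by (intro emb_cong rep_L2 L2_diff rep_diff_ae)

lemma restr_scaleR: "restr a b (c *\<^sub>R f) = c *\<^sub>R restr a b f"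
  unfolding restr_def emb_scaleR[OF rep_L2, symmetric] by (intro emb_cong rep_L2 L2_scaleR rep_scaleR_ae)

lemma restr_idem: "restr a b (restr a b f) = restr a b f"
  unfolding restr_def[of a b f] by (rule restr_emb[OF rep_L2])

lemma inner_emb_left:
  assumes "x \<in> L2 a b" shows "emb a b x \<bullet> f = emb a b x \<bullet> restr a b f"
proof -
  have "emb a b x \<bullet> f = emb a b x \<bullet> cls (rep f)" by (simp add: cls_rep)
  also have "\<dots> = (LINT \<zeta>|lebesgue. indicator {a..b} \<zeta> *\<^sub>R x \<zeta> \<bullet> rep f \<zeta>)"
    unfolding emb_def using assms by (intro inner_cls rep_sq_int) (simp_all add: L2_iff)
  also have "\<dots> = (LINT \<zeta>|lebesgue_on {a..b}. x \<zeta> \<bullet> rep f \<zeta>)"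
    by (simp add: lebesgue_on_lemmas)
  finally show ?thesis by (simp add: restr_def emb_inner assms rep_L2)
qed

lemma restr_inner_left: "restr a b f \<bullet> g = restr a b f \<bullet> restr a b g"
  unfolding restr_def[of a b f] by (rule inner_emb_left[OF rep_L2])

lemma restr_sym: "restr a b f \<bullet> g = f \<bullet> restr a b g"
  by (metis restr_inner_left inner_commute)

lemma norm_split: "(norm f)\<^sup>2 = (norm (restr a b f))\<^sup>2 + (norm (f - restr a b f))\<^sup>2"
proof -
  have "restr a b f \<bullet> f = restr a b f \<bullet> restr a b f" by (rule restr_inner_left)
  then show ?thesis
    by (simp add: power2_norm_eq_inner inner_diff_left inner_diff_right inner_commute)
qed

lemma norm_restr_le: "norm (restr a b f) \<le> norm f"
  by (rule power2_le_imp_le) (simp_all add: norm_split[of f a b])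

lemma L2_norm_diff_rep: "L2_norm a b (\<lambda>\<zeta>. rep f \<zeta> - rep g \<zeta>) \<le> norm (f - g)"
proof -
  have "L2_norm a b (\<lambda>\<zeta>. rep f \<zeta> - rep g \<zeta>) = norm (restr a b (f - g))"
    by (simp add: norm_emb[symmetric] L2_diff rep_L2 emb_diff restr_diff) (simp add: restr_def)
  then show ?thesis by (simp add: norm_restr_le)
qed

text \<open>
  This makes the operator norm of a measurable matrix function measurable.
\<close>

lemma onorm_matrix_continuous: "continuous_on UNIV (\<lambda>A :: 'k::real_or_complex^'n^'m. onorm ((*v) A))"
proof -
  have lin: "linear (\<lambda>A :: 'k^'n^'m. Blinfun ((*v) A))"
  proof (rule linearI)
    fix A B :: "'k^'n^'m" and c :: real
    show "Blinfun ((*v) (A + B)) = Blinfun ((*v) A) + Blinfun ((*v) B)"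
      by (rule blinfun_eqI)
        (simp add: bounded_linear_Blinfun_apply bounded_linear_matrix_vector blinfun.add_left matrix_vector_mult_add_rdistrib)
    show "Blinfun ((*v) (c *\<^sub>R A)) = c *\<^sub>R Blinfun ((*v) A)"
      by (rule blinfun_eqI)
        (simp add: bounded_linear_Blinfun_apply bounded_linear_matrix_vector blinfun.scaleR_left scaleR_matrix_vector)
  qed
  have "onorm ((*v) A) = norm (Blinfun ((*v) A))" for A :: "'k^'n^'m"
    by (simp add: norm_blinfun.rep_eq bounded_linear_Blinfun_apply bounded_linear_matrix_vector)
  moreover have "continuous_on UNIV (\<lambda>A :: 'k^'n^'m. norm (Blinfun ((*v) A)))"
    by (intro continuous_on_norm linear_continuous_on) (use lin in \<open>simp add: linear_conv_bounded_linear\<close>)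
  ultimately show ?thesis by simp
qed

lemma norm_matrix_vector_le: "norm ((A :: 'k::real_or_complex^'n^'m) *v x) \<le> onorm ((*v) A) * norm x"
  by (rule onorm[OF bounded_linear_matrix_vector])

lemma Linf_onorm_measurable:
  "F \<in> borel_measurable (lebesgue_on {a..b}) \<Longrightarrow>
    (\<lambda>\<zeta>. ereal (onorm ((*v) (F \<zeta> :: 'k::real_or_complex^'n^'n)))) \<in> borel_measurable (lebesgue_on {a..b})"
  by (intro borel_measurable_ereal measurable_compose[OF _ borel_measurable_continuous_onI[OF onorm_matrix_continuous]])

lemma interval_not_null: assumes "a < b" shows "\<not> (AE \<zeta> in lebesgue_on {a..b::real}. False)"
proof
  assume "AE \<zeta> in lebesgue_on {a..b}. False"
  then have "emeasure (lebesgue_on {a..b}) (space (lebesgue_on {a..b})) = 0"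
    using AE_iff_measurable[of "space (lebesgue_on {a..b})" "lebesgue_on {a..b}" "\<lambda>_. False"] by (simp add: set_eq_iff)
  then show False using assms by (simp add: emeasure_restrict_space)
qed

lemma Linf_enorm_nonneg:
  assumes "a < b" shows "0 \<le> Linf_enorm a b F"
proof (rule ccontr)
  assume "\<not> 0 \<le> Linf_enorm a b F"
  have "AE \<zeta> in lebesgue_on {a..b}. ereal (onorm ((*v) (F \<zeta>))) \<le> Linf_enorm a b F"
    unfolding Linf_enorm_def by (rule esssup_AE)
  then have "AE \<zeta> in lebesgue_on {a..b}. False"
  proof eventually_elim
    case (elim \<zeta>)
    have "0 \<le> ereal (onorm ((*v) (F \<zeta>)))" by (simp add: onorm_pos_le[OF bounded_linear_matrix_vector])
    then show False using elim \<open>\<not> 0 \<le> Linf_enorm a b F\<close> order_trans by blast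
  qed
  then show False using interval_not_null[OF assms] by blast
qed

lemma Linf_norm_nonneg: "a < b \<Longrightarrow> 0 \<le> Linf_norm a b F"
  unfolding Linf_norm_def by (intro real_of_ereal_pos Linf_enorm_nonneg)

lemma Linf_AE_bound:
  assumes ab: "a < b" and F: "F \<in> Linf a b"
  shows "AE \<zeta> in lebesgue_on {a..b}. onorm ((*v) (F \<zeta>)) \<le> Linf_norm a b F"
proof -
  have "Linf_enorm a b F = ereal (Linf_norm a b F)"
    using F Linf_enorm_nonneg[OF ab, of F] unfolding Linf_def Linf_norm_def by (auto simp: ereal_real)
  moreover have "AE \<zeta> in lebesgue_on {a..b}. ereal (onorm ((*v) (F \<zeta>))) \<le> Linf_enorm a b F"
    unfolding Linf_enorm_def by (rule esssup_AE)
  ultimately show ?thesis by simp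
qed

lemma LinfI:
  assumes F: "F \<in> borel_measurable (lebesgue_on {a..b})"
    and le: "AE \<zeta> in lebesgue_on {a..b}. onorm ((*v) (F \<zeta>)) \<le> C"
  shows "F \<in> Linf a b" and Linf_norm_le: "a < b \<Longrightarrow> Linf_norm a b F \<le> C"
proof -
  have "Linf_enorm a b F \<le> ereal C"
    unfolding Linf_enorm_def by (rule esssup_I[OF Linf_onorm_measurable[OF F]]) (use le in simp)
  then show "F \<in> Linf a b" using F by (auto simp: Linf_def)
  show "Linf_norm a b F \<le> C" if "a < b"
    using \<open>Linf_enorm a b F \<le> ereal C\<close> Linf_enorm_nonneg[OF that, of F]
    unfolding Linf_norm_def by (cases "Linf_enorm a b F") auto
qed

lemma onorm_matrix_diff: "onorm ((*v) (A - B :: 'k::real_or_complex^'n^'n)) \<le> onorm ((*v) A) + onorm ((*v) B)"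
proof (rule onorm_bound)
  fix x
  have "norm ((A - B) *v x) \<le> norm (A *v x) + norm (B *v x)"
    unfolding matrix_vector_mult_diff_rdistrib by (rule norm_triangle_ineq4)
  also have "\<dots> \<le> onorm ((*v) A) * norm x + onorm ((*v) B) * norm x" by (intro add_mono norm_matrix_vector_le)
  finally show "norm ((A - B) *v x) \<le> (onorm ((*v) A) + onorm ((*v) B)) * norm x" by (simp add: distrib_right)
qed (simp add: onorm_pos_le[OF bounded_linear_matrix_vector] add_nonneg_nonneg)

lemma Linf_diff:
  assumes ab: "a < b" and F: "F \<in> Linf a b" and G: "G \<in> Linf a b"
  shows "(\<lambda>\<zeta>. F \<zeta> - G \<zeta>) \<in> Linf a b"
proof (rule LinfI(1))
  show "(\<lambda>\<zeta>. F \<zeta> - G \<zeta>) \<in> borel_measurable (lebesgue_on {a..b})" using F G by (auto simp: Linf_def)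
  show "AE \<zeta> in lebesgue_on {a..b}. onorm ((*v) (F \<zeta> - G \<zeta>)) \<le> Linf_norm a b F + Linf_norm a b G"
    using Linf_AE_bound[OF ab F] Linf_AE_bound[OF ab G]
  proof eventually_elim
    case (elim \<zeta>)
    then show ?case using onorm_matrix_diff[of "F \<zeta>" "G \<zeta>"] by linarith
  qed
qed

lemma Linf_scaleR_bound:
  assumes ab: "a < b" and F: "F \<in> Linf a b"
  shows Linf_scaleR: "(\<lambda>\<zeta>. c *\<^sub>R F \<zeta>) \<in> Linf a b"
    and Linf_norm_scaleR_le: "Linf_norm a b (\<lambda>\<zeta>. c *\<^sub>R F \<zeta>) \<le> \<bar>c\<bar> * Linf_norm a b F"
proof -
  have m: "(\<lambda>\<zeta>. c *\<^sub>R F \<zeta>) \<in> borel_measurable (lebesgue_on {a..b})" using F by (auto simp: Linf_def)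
  have le: "AE \<zeta> in lebesgue_on {a..b}. onorm ((*v) (c *\<^sub>R F \<zeta>)) \<le> \<bar>c\<bar> * Linf_norm a b F"
    using Linf_AE_bound[OF ab F]
  proof eventually_elim
    case (elim \<zeta>)
    have "(*v) (c *\<^sub>R F \<zeta>) = (\<lambda>x. c *\<^sub>R (F \<zeta> *v x))" by (rule ext) (rule scaleR_matrix_vector)
    then have "onorm ((*v) (c *\<^sub>R F \<zeta>)) = onorm (\<lambda>x. c *\<^sub>R (F \<zeta> *v x))" by simp
    also have "\<dots> = \<bar>c\<bar> * onorm ((*v) (F \<zeta>))" by (rule onorm_scaleR[OF bounded_linear_matrix_vector])
    finally show ?case using elim by (simp add: mult_left_mono)
  qed
  show "(\<lambda>\<zeta>. c *\<^sub>R F \<zeta>) \<in> Linf a b" by (rule LinfI(1)[OF m le])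
  show "Linf_norm a b (\<lambda>\<zeta>. c *\<^sub>R F \<zeta>) \<le> \<bar>c\<bar> * Linf_norm a b F" by (rule Linf_norm_le[OF m le ab])
qed

lemma onorm_matrix_uminus: "onorm ((*v) (- A)) = onorm ((*v) (A :: 'k::real_or_complex^'n^'n))"
proof -
  have "(*v) (- A) = (\<lambda>x. - (A *v x))" by (rule ext) (rule matrix_vector_minus_left)
  then show ?thesis by (simp add: onorm_neg)
qed

lemma Linf_norm_minus_commute:
  "Linf_norm a b (\<lambda>\<zeta>. F \<zeta> - G \<zeta> :: 'k::real_or_complex^'n^'n) = Linf_norm a b (\<lambda>\<zeta>. G \<zeta> - F \<zeta>)"
  unfolding Linf_norm_def Linf_enorm_def
  using onorm_matrix_uminus[of "F \<zeta> - G \<zeta>" for \<zeta>] by simp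

lemma Linf_norm_triangle:
  assumes ab: "a < b" and F: "F \<in> Linf a b" and G: "G \<in> Linf a b"
  shows "Linf_norm a b F \<le> Linf_norm a b (\<lambda>\<zeta>. F \<zeta> - G \<zeta>) + Linf_norm a b G"
proof (rule LinfI(2)[OF _ _ ab])
  show "F \<in> borel_measurable (lebesgue_on {a..b})" using F by (simp add: Linf_def)
  show "AE \<zeta> in lebesgue_on {a..b}. onorm ((*v) (F \<zeta>)) \<le> Linf_norm a b (\<lambda>\<zeta>. F \<zeta> - G \<zeta>) + Linf_norm a b G"
    using Linf_AE_bound[OF ab Linf_diff[OF ab F G]] Linf_AE_bound[OF ab G]
  proof eventually_elim
    case (elim \<zeta>)
    have "onorm ((*v) (F \<zeta>)) = onorm ((*v) ((F \<zeta> - G \<zeta>) - (- G \<zeta>)))" by simp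
    also have "\<dots> \<le> onorm ((*v) (F \<zeta> - G \<zeta>)) + onorm ((*v) (- G \<zeta>))" by (rule onorm_matrix_diff)
    finally show ?case using elim by (simp add: onorm_matrix_uminus)
  qed
qed

text \<open>
  Continuity guarantees that the norms on \<open>[0,T]\<close> are bounded; without a bound the supremum would be
  an unspecified number.
\<close>

lemma Linf_norm_le_SUP:
  assumes ab: "a < b" and F: "continuous_into (Linf a b) (Linf_norm a b) {0..} F" and t: "0 \<le> t" "t \<le> T"
  shows "Linf_norm a b (F t) \<le> (SUP t\<in>{0..T}. Linf_norm a b (F t))"
proof -
  have FL: "F r \<in> Linf a b" if "0 \<le> r" for r using F that by (auto simp: continuous_into_def)
  have "continuous_on {0..T} (\<lambda>t. Linf_norm a b (F t))"
    unfolding continuous_on_def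
  proof
    fix t assume t: "t \<in> {0..T}"
    have "((\<lambda>r. Linf_norm a b (\<lambda>\<zeta>. F r \<zeta> - F t \<zeta>)) \<longlongrightarrow> 0) (at t within {0..})"
      using F t by (auto simp: continuous_into_def)
    then have lim: "((\<lambda>r. Linf_norm a b (\<lambda>\<zeta>. F r \<zeta> - F t \<zeta>)) \<longlongrightarrow> 0) (at t within {0..T})"
      by (rule tendsto_within_subset) auto
    have "\<forall>\<^sub>F r in at t within {0..T}. norm (Linf_norm a b (F r) - Linf_norm a b (F t)) \<le> Linf_norm a b (\<lambda>\<zeta>. F r \<zeta> - F t \<zeta>)"
      unfolding eventually_at_filter
    proof (intro always_eventually allI impI)
      fix r assume "r \<in> {0..T}"
      then have "F r \<in> Linf a b" "F t \<in> Linf a b" using FL t by auto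
      from Linf_norm_triangle[OF ab this] Linf_norm_triangle[OF ab this(2,1)]
      show "norm (Linf_norm a b (F r) - Linf_norm a b (F t)) \<le> Linf_norm a b (\<lambda>\<zeta>. F r \<zeta> - F t \<zeta>)"
        unfolding Linf_norm_minus_commute[of a b "F t"] by simp
    qed
    from Lim_null_comparison[OF this lim]
    show "((\<lambda>t. Linf_norm a b (F t)) \<longlongrightarrow> Linf_norm a b (F t)) (at t within {0..T})" by (rule LIM_zero_cancel)
  qed
  then have "bdd_above ((\<lambda>t. Linf_norm a b (F t)) ` {0..T})"
    by (intro bounded_imp_bdd_above compact_imp_bounded compact_continuous_image) auto
  then show ?thesis using t by (intro cSUP_upper) auto
qed

lemma C1_into_imp_continuous_into:
  fixes F F' :: "real \<Rightarrow> real \<Rightarrow> 'k::real_or_complex^'n^'n"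
  assumes ab: "a < b" and F: "C1_into (Linf a b) (Linf_norm a b) S F F'"
  shows "continuous_into (Linf a b) (Linf_norm a b) S F"
  unfolding continuous_into_def
proof (intro conjI ballI)
  show FL: "F t \<in> Linf a b" if "t \<in> S" for t using F that by (simp add: C1_into_def)
  fix t assume t: "t \<in> S"
  have F'L: "F' t \<in> Linf a b" using F t by (simp add: C1_into_def continuous_into_def)
  let ?q = "\<lambda>r \<zeta>. (F r \<zeta> - F t \<zeta>) /\<^sub>R (r - t)"
  have "((\<lambda>r. Linf_norm a b (\<lambda>\<zeta>. ?q r \<zeta> - F' t \<zeta>)) \<longlongrightarrow> 0) (at t within S)"
    using F t by (simp add: C1_into_def)
  then have "((\<lambda>r. \<bar>r - t\<bar> * (Linf_norm a b (\<lambda>\<zeta>. ?q r \<zeta> - F' t \<zeta>) + Linf_norm a b (F' t))) \<longlongrightarrow> \<bar>t - t\<bar> * (0 + Linf_norm a b (F' t))) (at t within S)"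
    by (intro tendsto_intros)
  then have lim: "((\<lambda>r. \<bar>r - t\<bar> * (Linf_norm a b (\<lambda>\<zeta>. ?q r \<zeta> - F' t \<zeta>) + Linf_norm a b (F' t))) \<longlongrightarrow> 0) (at t within S)"
    by simp
  have "\<forall>\<^sub>F r in at t within S. norm (Linf_norm a b (\<lambda>\<zeta>. F r \<zeta> - F t \<zeta>))
      \<le> \<bar>r - t\<bar> * (Linf_norm a b (\<lambda>\<zeta>. ?q r \<zeta> - F' t \<zeta>) + Linf_norm a b (F' t))"
    unfolding eventually_at_filter
  proof (intro always_eventually allI impI)
    fix r assume r: "r \<noteq> t" "r \<in> S"
    have qL: "?q r \<in> Linf a b" by (rule Linf_scaleR[OF ab Linf_diff[OF ab FL[OF r(2)] FL[OF t]]])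
    have "(\<lambda>\<zeta>. F r \<zeta> - F t \<zeta>) = (\<lambda>\<zeta>. (r - t) *\<^sub>R ?q r \<zeta>)" using r by simp
    then have "Linf_norm a b (\<lambda>\<zeta>. F r \<zeta> - F t \<zeta>) \<le> \<bar>r - t\<bar> * Linf_norm a b (?q r)"
      using Linf_norm_scaleR_le[OF ab qL, of "r - t"] by simp
    also have "\<dots> \<le> \<bar>r - t\<bar> * (Linf_norm a b (\<lambda>\<zeta>. ?q r \<zeta> - F' t \<zeta>) + Linf_norm a b (F' t))"
      by (intro mult_left_mono Linf_norm_triangle[OF ab qL F'L]) simp
    finally show "norm (Linf_norm a b (\<lambda>\<zeta>. F r \<zeta> - F t \<zeta>))
      \<le> \<bar>r - t\<bar> * (Linf_norm a b (\<lambda>\<zeta>. ?q r \<zeta> - F' t \<zeta>) + Linf_norm a b (F' t))"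
      by (simp add: Linf_norm_nonneg[OF ab])
  qed
  from Lim_null_comparison[OF this lim]
  show "((\<lambda>r. Linf_norm a b (\<lambda>\<zeta>. F r \<zeta> - F t \<zeta>)) \<longlongrightarrow> 0) (at t within S)" .
qed

lemma L2_mult:
  fixes F :: "real \<Rightarrow> 'k::real_or_complex^'n^'n"
  assumes ab: "a < b" and F: "F \<in> Linf a b" and x: "x \<in> L2 a b"
  shows "(\<lambda>\<zeta>. F \<zeta> *v x \<zeta>) \<in> L2 a b" "L2_norm a b (\<lambda>\<zeta>. F \<zeta> *v x \<zeta>) \<le> Linf_norm a b F * L2_norm a b x"
proof -
  let ?M = "lebesgue_on {a..b}"
  have Fm: "F \<in> borel_measurable ?M" using F by (simp add: Linf_def)
  have cont: "continuous_on UNIV (\<lambda>p :: ('k^'n^'n) \<times> ('k^'n). fst p *v snd p)"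
    unfolding matrix_vector_mult_def by (intro continuous_intros)
  have m: "(\<lambda>\<zeta>. F \<zeta> *v x \<zeta>) \<in> borel_measurable ?M"
    using measurable_compose[OF borel_measurable_Pair[OF Fm L2_measurable[OF x]] borel_measurable_continuous_onI[OF cont]] by simp
  have le: "AE \<zeta> in ?M. norm (F \<zeta> *v x \<zeta>) \<le> Linf_norm a b F * norm (x \<zeta>)"
    using Linf_AE_bound[OF ab F]
  proof eventually_elim
    case (elim \<zeta>)
    then show ?case using norm_matrix_vector_le[of "F \<zeta>" "x \<zeta>"] mult_right_mono[OF elim norm_ge_zero[of "x \<zeta>"]] by linarith
  qed
  show L: "(\<lambda>\<zeta>. F \<zeta> *v x \<zeta>) \<in> L2 a b" by (rule L2_dominated[OF x m le])
  have "(LINT \<zeta>|?M. (norm (F \<zeta> *v x \<zeta>))\<^sup>2) \<le> (LINT \<zeta>|?M. (Linf_norm a b F)\<^sup>2 * (norm (x \<zeta>))\<^sup>2)"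
  proof (rule integral_mono_AE)
    show "AE \<zeta> in ?M. (norm (F \<zeta> *v x \<zeta>))\<^sup>2 \<le> (Linf_norm a b F)\<^sup>2 * (norm (x \<zeta>))\<^sup>2"
      using le
    proof eventually_elim
      case (elim \<zeta>)
      then have "(norm (F \<zeta> *v x \<zeta>))\<^sup>2 \<le> (Linf_norm a b F * norm (x \<zeta>))\<^sup>2" by (intro power_mono) auto
      then show ?case by (simp add: power_mult_distrib)
    qed
  qed (use L x in \<open>simp_all add: L2_def\<close>)
  also have "\<dots> = (Linf_norm a b F)\<^sup>2 * (LINT \<zeta>|?M. (norm (x \<zeta>))\<^sup>2)" by simp
  finally have "sqrt (LINT \<zeta>|?M. (norm (F \<zeta> *v x \<zeta>))\<^sup>2) \<le> sqrt ((Linf_norm a b F)\<^sup>2 * (LINT \<zeta>|?M. (norm (x \<zeta>))\<^sup>2))"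
    by (rule real_sqrt_le_mono)
  then show "L2_norm a b (\<lambda>\<zeta>. F \<zeta> *v x \<zeta>) \<le> Linf_norm a b F * L2_norm a b x"
    using Linf_norm_nonneg[OF ab, of F] by (simp add: L2_norm_def real_sqrt_mult)
qed

definition mult_op :: "real \<Rightarrow> real \<Rightarrow> (real \<Rightarrow> 'k::real_or_complex^'n^'n) \<Rightarrow> ('k^'n) l2 \<Rightarrow>\<^sub>L ('k^'n) l2" where
  "mult_op a b F = Blinfun (\<lambda>f. emb a b (\<lambda>\<zeta>. F \<zeta> *v rep f \<zeta>))"

lemma eq_ae_mult:
  fixes F :: "real \<Rightarrow> 'k::real_or_complex^'n^'n"
  shows "eq_ae a b x y \<Longrightarrow> eq_ae a b (\<lambda>\<zeta>. F \<zeta> *v x \<zeta>) (\<lambda>\<zeta>. F \<zeta> *v y \<zeta>)"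
  unfolding eq_ae_def by (erule eventually_mono) simp

lemma mult_op:
  fixes F :: "real \<Rightarrow> 'k::real_or_complex^'n^'n"
  assumes ab: "a < b" and F: "F \<in> Linf a b"
  shows mult_op_apply: "mult_op a b F f = emb a b (\<lambda>\<zeta>. F \<zeta> *v rep f \<zeta>)"
    and norm_mult_op: "norm (mult_op a b F) \<le> Linf_norm a b F"
    and mult_op_emb: "x \<in> L2 a b \<Longrightarrow> mult_op a b F (emb a b x) = emb a b (\<lambda>\<zeta>. F \<zeta> *v x \<zeta>)"
proof -
  note FL = L2_mult(1)[OF ab F]
  have bound: "norm (emb a b (\<lambda>\<zeta>. F \<zeta> *v rep f \<zeta>)) \<le> norm f * Linf_norm a b F" for f
  proof -
    have "norm (emb a b (\<lambda>\<zeta>. F \<zeta> *v rep f \<zeta>)) \<le> Linf_norm a b F * L2_norm a b (rep f)"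
      unfolding norm_emb[OF FL[OF rep_L2]] by (rule L2_mult(2)[OF ab F rep_L2])
    also have "\<dots> \<le> Linf_norm a b F * norm f"
      using norm_restr_le[of a b f] by (intro mult_left_mono Linf_norm_nonneg ab) (simp add: restr_def norm_emb rep_L2)
    finally show ?thesis by (simp add: mult.commute)
  qed
  have "bounded_linear (\<lambda>f. emb a b (\<lambda>\<zeta>. F \<zeta> *v rep f \<zeta>))"
  proof (rule bounded_linear_intro[OF _ _ bound])
    show "emb a b (\<lambda>\<zeta>. F \<zeta> *v rep (f + g) \<zeta>) = emb a b (\<lambda>\<zeta>. F \<zeta> *v rep f \<zeta>) + emb a b (\<lambda>\<zeta>. F \<zeta> *v rep g \<zeta>)" for f g
    proof -
      have "emb a b (\<lambda>\<zeta>. F \<zeta> *v rep (f + g) \<zeta>) = emb a b (\<lambda>\<zeta>. F \<zeta> *v (rep f \<zeta> + rep g \<zeta>))"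
        by (intro emb_cong FL rep_L2 L2_add eq_ae_mult rep_add_ae)
      then show ?thesis by (simp add: matrix_vector_right_distrib emb_add FL rep_L2)
    qed
    show "emb a b (\<lambda>\<zeta>. F \<zeta> *v rep (c *\<^sub>R f) \<zeta>) = c *\<^sub>R emb a b (\<lambda>\<zeta>. F \<zeta> *v rep f \<zeta>)" for c f
    proof -
      have "emb a b (\<lambda>\<zeta>. F \<zeta> *v rep (c *\<^sub>R f) \<zeta>) = emb a b (\<lambda>\<zeta>. F \<zeta> *v (c *\<^sub>R rep f \<zeta>))"
        by (intro emb_cong FL rep_L2 L2_scaleR eq_ae_mult rep_scaleR_ae)
      then show ?thesis by (simp add: matrix_vector_scaleR emb_scaleR FL rep_L2)
    qed
  qed
  then show app: "mult_op a b F f = emb a b (\<lambda>\<zeta>. F \<zeta> *v rep f \<zeta>)" for f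
    by (simp add: mult_op_def bounded_linear_Blinfun_apply)
  show "norm (mult_op a b F) \<le> Linf_norm a b F"
    using bound by (intro norm_blinfun_bound Linf_norm_nonneg ab) (simp add: app mult.commute)
  show "mult_op a b F (emb a b x) = emb a b (\<lambda>\<zeta>. F \<zeta> *v x \<zeta>)" if "x \<in> L2 a b"
    unfolding app using that by (intro emb_cong FL rep_L2 eq_ae_mult rep_emb)
qed

lemma mult_op_diff:
  assumes ab: "a < b" and F: "F \<in> Linf a b" and G: "G \<in> Linf a b"
  shows "mult_op a b (\<lambda>\<zeta>. F \<zeta> - G \<zeta>) = mult_op a b F - mult_op a b G"
  by (rule blinfun_eqI)
    (simp add: mult_op_apply[OF ab] F G Linf_diff[OF ab F G] blinfun.diff_left matrix_vector_mult_diff_rdistrib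
      emb_diff L2_mult[OF ab] rep_L2)

lemma mult_op_scaleR:
  assumes ab: "a < b" and F: "F \<in> Linf a b"
  shows "mult_op a b (\<lambda>\<zeta>. c *\<^sub>R F \<zeta>) = c *\<^sub>R mult_op a b F"
  by (rule blinfun_eqI)
    (simp add: mult_op_apply[OF ab] F Linf_scaleR[OF ab F] blinfun.scaleR_left scaleR_matrix_vector
      emb_scaleR L2_mult[OF ab] rep_L2)

lemma mult_op_continuous:
  assumes ab: "a < b" and F: "continuous_into (Linf a b) (Linf_norm a b) S F"
  shows "continuous_on S (\<lambda>t. mult_op a b (F t))"
  unfolding continuous_on_def
proof
  fix t assume t: "t \<in> S"
  have FL: "F r \<in> Linf a b" if "r \<in> S" for r using F that by (auto simp: continuous_into_def)
  have "\<forall>\<^sub>F r in at t within S. norm (mult_op a b (F r) - mult_op a b (F t)) \<le> Linf_norm a b (\<lambda>\<zeta>. F r \<zeta> - F t \<zeta>)"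
    unfolding eventually_at_filter
    by (intro always_eventually allI impI)
      (simp add: mult_op_diff[OF ab, symmetric] norm_mult_op[OF ab] Linf_diff[OF ab] FL t)
  moreover have "((\<lambda>r. Linf_norm a b (\<lambda>\<zeta>. F r \<zeta> - F t \<zeta>)) \<longlongrightarrow> 0) (at t within S)"
    using F t by (auto simp: continuous_into_def)
  ultimately have "((\<lambda>r. mult_op a b (F r) - mult_op a b (F t)) \<longlongrightarrow> 0) (at t within S)"
    by (rule Lim_null_comparison)
  then show "((\<lambda>t. mult_op a b (F t)) \<longlongrightarrow> mult_op a b (F t)) (at t within S)" by (rule LIM_zero_cancel)
qed

lemma mult_op_has_derivative:
  assumes ab: "a < b" and F: "C1_into (Linf a b) (Linf_norm a b) S F F'" and t: "t \<in> S"
  shows "((\<lambda>t. mult_op a b (F t)) has_vector_derivative mult_op a b (F' t)) (at t within S)"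
  unfolding has_vector_derivative_iff_norm_tendsto
proof (rule Lim_null_comparison)
  have FL: "F r \<in> Linf a b" if "r \<in> S" for r using F that by (auto simp: C1_into_def)
  have F'L: "F' t \<in> Linf a b" using F t by (auto simp: C1_into_def continuous_into_def)
  show "((\<lambda>r. Linf_norm a b (\<lambda>\<zeta>. (F r \<zeta> - F t \<zeta>) /\<^sub>R (r - t) - F' t \<zeta>)) \<longlongrightarrow> 0) (at t within S)"
    using F t by (auto simp: C1_into_def)
  show "\<forall>\<^sub>F r in at t within S. norm (norm ((mult_op a b (F r) - mult_op a b (F t)) /\<^sub>R (r - t) - mult_op a b (F' t)))
      \<le> Linf_norm a b (\<lambda>\<zeta>. (F r \<zeta> - F t \<zeta>) /\<^sub>R (r - t) - F' t \<zeta>)"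
    unfolding eventually_at_filter
  proof (intro always_eventually allI impI)
    fix r assume r: "r \<in> S"
    note L = Linf_diff[OF ab FL[OF r] FL[OF t]]
    note L' = Linf_scaleR[OF ab L, of "inverse (r - t)"]
    show "norm (norm ((mult_op a b (F r) - mult_op a b (F t)) /\<^sub>R (r - t) - mult_op a b (F' t)))
      \<le> Linf_norm a b (\<lambda>\<zeta>. (F r \<zeta> - F t \<zeta>) /\<^sub>R (r - t) - F' t \<zeta>)"
      using norm_mult_op[OF ab Linf_diff[OF ab L' F'L]]
      by (simp add: mult_op_diff[OF ab L' F'L] mult_op_scaleR[OF ab L] mult_op_diff[OF ab FL[OF r] FL[OF t]])
  qed
qed

section \<open>The system as an abstract evolution equation\<close>

locale port_hamiltonian_system =
  fixes a b :: real and P0 P1 :: "'k::real_or_complex^'n^'n" and W :: "'k^('n + 'n)^'n"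
    and H Hd K :: "real \<Rightarrow> real \<Rightarrow> 'k^'n^'n" and m M :: real
  assumes ph: "port_hamiltonian a b P0 P1 W H Hd K m M"
begin

lemma ab: "a < b" and m: "0 < m" and M: "0 < M" and P1: "ctranspose P1 = P1" "invertible P1"
  and H_C1: "C1_into (Linf a b) (Linf_norm a b) {0..} H Hd"
  and H_bounds: "0 \<le> t \<Longrightarrow> AE \<zeta> in lebesgue_on {a..b}.
        ctranspose (H t \<zeta>) = H t \<zeta> \<and>
        loewner_le (mat (of_real m)) (H t \<zeta>) \<and> loewner_le (H t \<zeta>) (mat (of_real M))"
  using ph by (simp_all add: port_hamiltonian_def)

definition "Hdd = (SOME Hdd. C1_into (Linf a b) (Linf_norm a b) {0..} Hd Hdd)"
definition "Kd = (SOME Kd. C1_into (Linf a b) (Linf_norm a b) {0..} K Kd)"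

lemma Hd_C1: "C1_into (Linf a b) (Linf_norm a b) {0..} Hd Hdd"
proof -
  have "\<exists>F'. C1_into (Linf a b) (Linf_norm a b) {0..} Hd F'"
    using ph unfolding port_hamiltonian_def by (elim conjE)
  from someI_ex[OF this] show ?thesis unfolding Hdd_def .
qed

lemma K_C1: "C1_into (Linf a b) (Linf_norm a b) {0..} K Kd"
proof -
  have "\<exists>F'. C1_into (Linf a b) (Linf_norm a b) {0..} K F'"
    using ph unfolding port_hamiltonian_def by (elim conjE)
  from someI_ex[OF this] show ?thesis unfolding Kd_def .
qed

lemma H_Linf: "0 \<le> t \<Longrightarrow> H t \<in> Linf a b" and Hd_Linf: "0 \<le> t \<Longrightarrow> Hd t \<in> Linf a b"
  and K_Linf: "0 \<le> t \<Longrightarrow> K t \<in> Linf a b"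
  using H_C1 Hd_C1 K_C1 by (simp_all add: C1_into_def)

lemma P0_dissipative: "(P0 *v x) \<bullet> x \<le> 0"
proof -
  have "loewner_le ((1 / 2) *\<^sub>R (P0 + ctranspose P0)) 0" using ph by (simp add: port_hamiltonian_def)
  from loewner_leD[OF this, of x] have "x \<bullet> (P0 *v x) + x \<bullet> (ctranspose P0 *v x) \<le> 0"
    by (simp add: scaleR_matrix_vector matrix_vector_mult_add_rdistrib inner_add_right)
  then show ?thesis by (simp add: inner_ctranspose[symmetric] inner_commute)
qed

lemma boundary_dissipative: "W *v stack p q = 0 \<Longrightarrow> (P1 *v p) \<bullet> p \<le> (P1 *v q) \<bullet> q"
  by (rule boundary_form_nonpos[where W = W]) (use ph in \<open>simp_all add: port_hamiltonian_def\<close>)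

text \<open>
  The bounds hold almost everywhere on a set of positive measure. The inequality makes \<open>M\<close> an upper
  bound for an operator that acts as \<open>m\<close> outside \<open>[a,b]\<close>.
\<close>

lemma m_le_M: "m \<le> M"
proof (rule ccontr)
  assume "\<not> m \<le> M"
  define x :: "'k^'n" where "x = (\<chi> i. 1)"
  have x: "x \<noteq> 0" by (simp add: x_def vec_eq_iff)
  have "AE \<zeta> in lebesgue_on {a..b}. False"
    using H_bounds[of 0, OF order_refl]
  proof eventually_elim
    case (elim \<zeta>)
    have "x \<bullet> (mat (of_real m) *v x) \<le> x \<bullet> (mat (of_real M) *v x)"
      using loewner_leD[of "mat (of_real m)" "H 0 \<zeta>" x] loewner_leD[of "H 0 \<zeta>" "mat (of_real M)" x] elim by linarith
    then show False using \<open>\<not> m \<le> M\<close> x by (simp add: mat_of_real_vector)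
  qed
  then show False using interval_not_null[OF ab] by blast
qed

text \<open>
  Values outside \<open>[a,b]\<close> are unrestricted in the domain, and \<open>A\<close> maps them to \<open>0\<close>.
\<close>

abbreviation "D \<equiv> {f. rep f \<in> dom_A a b W}"
abbreviation "A f \<equiv> emb a b (op_A a b P0 P1 (rep f))"

lemma dom_A_cong:
  assumes x: "x \<in> dom_A a b W" and y: "y \<in> L2 a b" and eq: "eq_ae a b x y"
  shows "y \<in> dom_A a b W"
  using x y unfolding dom_A_iff[OF ab] ac_rep_cong_left[OF eq] by blast

lemma eq_ae_sym: "eq_ae a b x y \<Longrightarrow> eq_ae a b y x"
  unfolding eq_ae_def by (erule eventually_mono) simp

lemma eq_ae_trans:
  assumes "eq_ae a b x y" "eq_ae a b y z" shows "eq_ae a b x z"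
  using assms unfolding eq_ae_def by eventually_elim simp

lemma op_A_props:
  assumes x: "x \<in> L2 a b" "ac_rep a b x g d"
  shows op_A_L2: "op_A a b P0 P1 x \<in> L2 a b"
    and op_A_ae: "eq_ae a b (op_A a b P0 P1 x) (\<lambda>\<zeta>. P1 *v d \<zeta> + P0 *v g \<zeta>)"
proof -
  note D = H1_derivI[OF ab x(2)]
  show "op_A a b P0 P1 x \<in> L2 a b"
    unfolding op_A_def by (intro L2_add L2_linear[OF linear_matrix_vector] D x)
  have "AE \<zeta> in lebesgue_on {a..b}. H1_deriv a b x \<zeta> = d \<zeta>" "AE \<zeta> in lebesgue_on {a..b}. x \<zeta> = g \<zeta>"
    using D(1) ac_repD(1)[OF x(2)] by (simp_all add: eq_ae_def)
  then show "eq_ae a b (op_A a b P0 P1 x) (\<lambda>\<zeta>. P1 *v d \<zeta> + P0 *v g \<zeta>)"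
    unfolding eq_ae_def op_A_def by eventually_elim simp
qed

lemma dom_A_L2: "x \<in> dom_A a b W \<Longrightarrow> x \<in> L2 a b"
  by (simp add: dom_A_iff[OF ab])

lemma dom_A_ac_rep:
  assumes "x \<in> dom_A a b W"
  obtains g d where "ac_rep a b x g d" "W *v stack (g b) (g a) = 0"
  using assms unfolding dom_A_iff[OF ab] by blast

lemma op_A_cong:
  assumes x: "x \<in> dom_A a b W" and y: "y \<in> L2 a b" and eq: "eq_ae a b x y"
  shows "emb a b (op_A a b P0 P1 x) = emb a b (op_A a b P0 P1 y)"
proof -
  obtain g d where gd: "ac_rep a b x g d" "W *v stack (g b) (g a) = 0" using x by (rule dom_A_ac_rep)
  then have gd': "ac_rep a b y g d" using ac_rep_cong_left[OF eq] by simp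
  note X = op_A_props[OF dom_A_L2[OF x] gd(1)] and Y = op_A_props[OF y gd']
  show ?thesis by (rule emb_cong[OF X(1) Y(1) eq_ae_trans[OF X(2) eq_ae_sym[OF Y(2)]]])
qed

lemma A_eq:
  assumes f: "ac_rep a b (rep f) g d"
  shows "A f = emb a b (\<lambda>\<zeta>. P1 *v d \<zeta> + P0 *v g \<zeta>)"
proof (rule emb_cong)
  show "op_A a b P0 P1 (rep f) \<in> L2 a b" by (rule op_A_L2[OF rep_L2 f])
  show "(\<lambda>\<zeta>. P1 *v d \<zeta> + P0 *v g \<zeta>) \<in> L2 a b"
    by (intro L2_add L2_linear[OF linear_matrix_vector] ac_repD(2)[OF f] L2_continuous ac_rep_continuous[OF f])
  show "eq_ae a b (op_A a b P0 P1 (rep f)) (\<lambda>\<zeta>. P1 *v d \<zeta> + P0 *v g \<zeta>)" by (rule op_A_ae[OF rep_L2 f])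
qed

lemma inD_I:
  assumes "ac_rep a b x g d" "W *v stack (g b) (g a) = 0" "eq_ae a b (rep f) x"
  shows "f \<in> D" "ac_rep a b (rep f) g d"
proof -
  show "ac_rep a b (rep f) g d" using assms(1) unfolding ac_rep_cong_left[OF assms(3)] .
  with assms(2) rep_L2[of f a b] show "f \<in> D" unfolding mem_Collect_eq dom_A_iff[OF ab] by blast
qed

lemma dom_A_linear_image:
  assumes L: "linear (L :: 'k^'n \<Rightarrow> 'k^'n)" "\<And>p q. W *v stack (L p) (L q) = L (W *v stack p q)"
    and x: "x \<in> dom_A a b W"
  shows "(\<lambda>\<zeta>. L (x \<zeta>)) \<in> dom_A a b W"
proof -
  obtain g d where gd: "ac_rep a b x g d" "W *v stack (g b) (g a) = 0" using x by (rule dom_A_ac_rep)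
  have "W *v stack (L (g b)) (L (g a)) = 0" using gd(2) L linear_0[OF L(1)] by simp
  with ac_rep_linear[OF L(1) gd(1)] L2_linear[OF L(1) dom_A_L2[OF x]] show ?thesis
    unfolding dom_A_iff[OF ab] by blast
qed

lemma dom_A_add:
  assumes x: "x \<in> dom_A a b W" and y: "y \<in> dom_A a b W"
  shows "(\<lambda>\<zeta>. x \<zeta> + y \<zeta>) \<in> dom_A a b W"
proof -
  obtain g d where gd: "ac_rep a b x g d" "W *v stack (g b) (g a) = 0" using x by (rule dom_A_ac_rep)
  obtain h e where he: "ac_rep a b y h e" "W *v stack (h b) (h a) = 0" using y by (rule dom_A_ac_rep)
  have "W *v stack (g b + h b) (g a + h a) = 0"
    using gd(2) he(2) by (simp add: stack_add[symmetric] matrix_vector_right_distrib)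
  with ac_rep_add[OF gd(1) he(1)] L2_add[OF dom_A_L2[OF x] dom_A_L2[OF y]] show ?thesis
    unfolding dom_A_iff[OF ab] by blast
qed

lemma dom_A_0: "(\<lambda>\<zeta>. 0) \<in> dom_A a b W"
proof -
  have "ac_rep a b (\<lambda>\<zeta>. 0 :: 'k^'n) (\<lambda>\<zeta>. 0) (\<lambda>\<zeta>. 0)" by (simp add: ac_rep_def eq_ae_def L2_0)
  then show ?thesis unfolding dom_A_iff[OF ab] using L2_0 by (metis matrix_vector_mult_0_right stack_0)
qed

lemma linear_scaleR_vec: "linear (\<lambda>x :: 'k^'n. c *\<^sub>R x)"
  by (rule linearI) (simp_all add: algebra_simps)

lemma dom_A_scaleR: "x \<in> dom_A a b W \<Longrightarrow> (\<lambda>\<zeta>. c *\<^sub>R x \<zeta>) \<in> dom_A a b W"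
  by (rule dom_A_linear_image[OF linear_scaleR_vec]) (simp_all add: stack_scaleR[symmetric] matrix_vector_scaleR)

lemma dom_A_smult: "x \<in> dom_A a b W \<Longrightarrow> (\<lambda>\<zeta>. c *s x \<zeta>) \<in> dom_A a b W"
  by (rule dom_A_linear_image[OF linear_smult])
    (simp_all add: stack_smult[symmetric] vector_scalar_commute)

lemma subspace_D: "subspace D"
proof (rule subspaceI; unfold mem_Collect_eq)
  have "eq_ae a b (rep (0 *\<^sub>R (0 :: ('k^'n) l2))) (\<lambda>\<zeta>. 0 *\<^sub>R rep 0 \<zeta>)" by (rule rep_scaleR_ae)
  then have "eq_ae a b (rep (0 :: ('k^'n) l2)) (\<lambda>\<zeta>. 0)" by simp
  then show "rep (0 :: ('k^'n) l2) \<in> dom_A a b W" by (rule dom_A_cong[OF dom_A_0 rep_L2 eq_ae_sym])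
  show "rep (f + g) \<in> dom_A a b W" if "rep f \<in> dom_A a b W" "rep g \<in> dom_A a b W" for f g
    by (rule dom_A_cong[OF dom_A_add[OF that] rep_L2 eq_ae_sym[OF rep_add_ae]])
  show "rep (c *\<^sub>R f) \<in> dom_A a b W" if "rep f \<in> dom_A a b W" for c f
    by (rule dom_A_cong[OF dom_A_scaleR[OF that] rep_L2 eq_ae_sym[OF rep_scaleR_ae]])
qed

lemma A_add:
  assumes f: "f \<in> D" and g: "g \<in> D" shows "A (f + g) = A f + A g"
proof -
  obtain u d where ud: "ac_rep a b (rep f) u d" "W *v stack (u b) (u a) = 0" using f unfolding mem_Collect_eq by (rule dom_A_ac_rep)
  obtain v e where ve: "ac_rep a b (rep g) v e" "W *v stack (v b) (v a) = 0" using g unfolding mem_Collect_eq by (rule dom_A_ac_rep)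
  have fg: "ac_rep a b (rep (f + g)) (\<lambda>\<zeta>. u \<zeta> + v \<zeta>) (\<lambda>\<zeta>. d \<zeta> + e \<zeta>)"
    using ac_rep_add[OF ud(1) ve(1)] by (simp add: ac_rep_cong_left[OF rep_add_ae])
  have L: "(\<lambda>\<zeta>. P1 *v d \<zeta> + P0 *v u \<zeta>) \<in> L2 a b" "(\<lambda>\<zeta>. P1 *v e \<zeta> + P0 *v v \<zeta>) \<in> L2 a b"
    by (intro L2_add L2_linear[OF linear_matrix_vector] ac_repD(2)[OF ud(1)] ac_repD(2)[OF ve(1)]
        L2_continuous ac_rep_continuous[OF ud(1)] ac_rep_continuous[OF ve(1)])+
  show ?thesis
    unfolding A_eq[OF fg] A_eq[OF ud(1)] A_eq[OF ve(1)] emb_add[OF L, symmetric]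
    by (simp add: matrix_vector_right_distrib add_ac)
qed

lemma A_scaleR:
  assumes f: "f \<in> D" shows "A (c *\<^sub>R f) = c *\<^sub>R A f"
proof -
  obtain u d where ud: "ac_rep a b (rep f) u d" "W *v stack (u b) (u a) = 0" using f unfolding mem_Collect_eq by (rule dom_A_ac_rep)
  have cf: "ac_rep a b (rep (c *\<^sub>R f)) (\<lambda>\<zeta>. c *\<^sub>R u \<zeta>) (\<lambda>\<zeta>. c *\<^sub>R d \<zeta>)"
    using ac_rep_linear[OF linear_scaleR_vec ud(1), of c] by (simp add: ac_rep_cong_left[OF rep_scaleR_ae])
  have L: "(\<lambda>\<zeta>. P1 *v d \<zeta> + P0 *v u \<zeta>) \<in> L2 a b"
    by (intro L2_add L2_linear[OF linear_matrix_vector] ac_repD(2)[OF ud(1)] L2_continuous ac_rep_continuous[OF ud(1)])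
  show ?thesis
    unfolding A_eq[OF cf] A_eq[OF ud(1)] emb_scaleR[OF L, symmetric]
    by (simp add: matrix_vector_scaleR scaleR_add_right)
qed

lemma A_dissipative:
  assumes f: "f \<in> D" shows "A f \<bullet> f \<le> 0"
proof -
  obtain u d where ud: "ac_rep a b (rep f) u d" "W *v stack (u b) (u a) = 0" using f unfolding mem_Collect_eq by (rule dom_A_ac_rep)
  have L: "(\<lambda>\<zeta>. P1 *v d \<zeta> + P0 *v u \<zeta>) \<in> L2 a b" and u: "u \<in> L2 a b"
    by (intro L2_add L2_linear[OF linear_matrix_vector] ac_repD(2)[OF ud(1)] L2_continuous ac_rep_continuous[OF ud(1)])+
  have "A f \<bullet> f = emb a b (\<lambda>\<zeta>. P1 *v d \<zeta> + P0 *v u \<zeta>) \<bullet> restr a b f"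
    unfolding A_eq[OF ud(1)] by (rule inner_emb_left[OF L])
  also have "restr a b f = emb a b u"
    unfolding restr_def by (rule emb_cong[OF rep_L2 u ac_repD(1)[OF ud(1)]])
  also have "emb a b (\<lambda>\<zeta>. P1 *v d \<zeta> + P0 *v u \<zeta>) \<bullet> emb a b u \<le> 0"
    unfolding emb_inner[OF L u]
    by (rule dissipation_integral[OF ab P1(1) P0_dissipative ud(1) boundary_dissipative[OF ud(2)]])
  finally show "A f \<bullet> f \<le> 0" .
qed

lemma A_range:
  assumes \<mu>: "0 < \<mu>" shows "\<exists>f\<in>D. f - \<mu> *\<^sub>R A f = y"
proof -
  obtain g d where gd: "ac_rep a b g g d" "W *v stack (g b) (g a) = 0"
    "\<And>\<zeta>. g \<zeta> - \<mu> *\<^sub>R (P1 *v d \<zeta> + P0 *v g \<zeta>) = rep y \<zeta>"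
  proof (rule boundary_value_problem[OF ab P1 P0_dissipative boundary_dissipative \<mu> rep_L2[of y]]) qed (assumption | rule that)+
  have g: "g \<in> L2 a b" by (rule L2_continuous[OF ac_rep_continuous[OF gd(1)]])
  have L: "(\<lambda>\<zeta>. P1 *v d \<zeta> + P0 *v g \<zeta>) \<in> L2 a b"
    by (intro L2_add L2_linear[OF linear_matrix_vector] ac_repD(2)[OF gd(1)] g)
  \<comment> \<open>outside \<open>[a,b]\<close> the operator vanishes, so there the solution is \<open>y\<close> itself\<close>
  define f where "f = emb a b g + (y - restr a b y)"
  have restr_f: "restr a b f = emb a b g"
    by (simp add: f_def restr_add restr_diff restr_idem restr_emb g)
  have ae: "eq_ae a b (rep f) g"
    using restr_f unfolding restr_def emb_eq_iff[OF rep_L2 g] .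
  note f = inD_I[OF gd(1,2) ae]
  have "emb a b g - \<mu> *\<^sub>R emb a b (\<lambda>\<zeta>. P1 *v d \<zeta> + P0 *v g \<zeta>) = restr a b y"
    unfolding restr_def emb_scaleR[OF L, symmetric] emb_diff[OF g L2_scaleR[OF L], symmetric] gd(3) ..
  moreover have "f - \<mu> *\<^sub>R A f = (emb a b g - \<mu> *\<^sub>R emb a b (\<lambda>\<zeta>. P1 *v d \<zeta> + P0 *v g \<zeta>)) + (y - restr a b y)"
    unfolding A_eq[OF f(2)] by (simp add: f_def)
  ultimately have "f - \<mu> *\<^sub>R A f = y" by simp
  then show "\<exists>f\<in>D. f - \<mu> *\<^sub>R A f = y" using f(1) by blast
qed

sublocale A: m_dissipative D "\<lambda>f. A f"
  by (rule m_dissipative.intro) (fact subspace_D A_add A_scaleR A_dissipative A_range)+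

text \<open>
  Acting as \<open>m\<close> outside \<open>[a,b]\<close> makes the operator coercive on the whole space.
\<close>

definition Hop :: "real \<Rightarrow> ('k^'n) l2 \<Rightarrow>\<^sub>L ('k^'n) l2" where
  "Hop t = mult_op a b (H t) + m *\<^sub>R (id_blinfun - Blinfun (restr a b))"

lemma restr_op: "blinfun_apply (Blinfun (restr a b)) f = restr a b (f :: ('k^'n) l2)"
proof -
  have "bounded_linear (restr a b :: ('k^'n) l2 \<Rightarrow> _)"
    by (rule bounded_linear_intro[where K = 1]) (simp_all add: restr_add restr_scaleR norm_restr_le)
  then show ?thesis by (simp add: bounded_linear_Blinfun_apply)
qed

lemma Hop: "0 \<le> t \<Longrightarrow> Hop t f = emb a b (\<lambda>\<zeta>. H t \<zeta> *v rep f \<zeta>) + m *\<^sub>R (f - restr a b f)"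
  by (simp add: Hop_def blinfun.bilinear_simps restr_op mult_op_apply[OF ab H_Linf])

lemma Hop_emb: "0 \<le> t \<Longrightarrow> x \<in> L2 a b \<Longrightarrow> Hop t (emb a b x) = emb a b (\<lambda>\<zeta>. H t \<zeta> *v x \<zeta>)"
  by (simp add: Hop_def blinfun.bilinear_simps restr_op mult_op_emb[OF ab H_Linf] restr_emb)

lemmas HL2 = L2_mult(1)[OF ab H_Linf]

lemma rep_Hop:
  assumes t: "0 \<le> t" shows "eq_ae a b (rep (Hop t f)) (\<lambda>\<zeta>. H t \<zeta> *v rep f \<zeta>)"
proof -
  have "restr a b (Hop t f) = emb a b (\<lambda>\<zeta>. H t \<zeta> *v rep f \<zeta>)"
    by (simp add: Hop t restr_add restr_scaleR restr_diff restr_idem restr_emb HL2 rep_L2)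
  then show ?thesis unfolding restr_def emb_eq_iff[OF rep_L2 HL2[OF t rep_L2]] .
qed

lemma Hop_inner:
  assumes t: "0 \<le> t"
  shows "Hop t f \<bullet> g = (LINT \<zeta>|lebesgue_on {a..b}. (H t \<zeta> *v rep f \<zeta>) \<bullet> rep g \<zeta>)
    + m * ((f - restr a b f) \<bullet> (g - restr a b g))"
proof -
  have "emb a b (\<lambda>\<zeta>. H t \<zeta> *v rep f \<zeta>) \<bullet> g = emb a b (\<lambda>\<zeta>. H t \<zeta> *v rep f \<zeta>) \<bullet> restr a b g"
    by (rule inner_emb_left[OF HL2[OF t rep_L2]])
  also have "\<dots> = (LINT \<zeta>|lebesgue_on {a..b}. (H t \<zeta> *v rep f \<zeta>) \<bullet> rep g \<zeta>)"
    unfolding restr_def by (rule emb_inner[OF HL2[OF t rep_L2] rep_L2])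
  finally have "emb a b (\<lambda>\<zeta>. H t \<zeta> *v rep f \<zeta>) \<bullet> g = (LINT \<zeta>|lebesgue_on {a..b}. (H t \<zeta> *v rep f \<zeta>) \<bullet> rep g \<zeta>)" .
  moreover have "(f - restr a b f) \<bullet> g = (f - restr a b f) \<bullet> (g - restr a b g)"
    using restr_sym[of a b f g] restr_inner_left[of a b f g]
    by (simp add: inner_diff_left inner_diff_right)
  ultimately show ?thesis by (simp add: Hop t inner_add_left)
qed

lemma Hop_bounds:
  assumes t: "0 \<le> t"
  shows Hop_sym: "Hop t f \<bullet> g = f \<bullet> Hop t g"
    and Hop_lower: "m * (norm f)\<^sup>2 \<le> Hop t f \<bullet> f"
    and Hop_upper: "Hop t f \<bullet> f \<le> M * (norm f)\<^sup>2"
proof -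
  let ?M = "lebesgue_on {a..b}"
  have int: "integrable ?M (\<lambda>\<zeta>. (H t \<zeta> *v rep f \<zeta>) \<bullet> rep g \<zeta>)" for f g
    by (rule L2_inner_integrable[OF HL2[OF t rep_L2] rep_L2])
  have int2: "integrable ?M (\<lambda>\<zeta>. rep f \<zeta> \<bullet> rep f \<zeta>)" for f :: "('k^'n) l2"
    by (rule L2_inner_integrable[OF rep_L2 rep_L2])
  have norm_restr: "(norm (restr a b f))\<^sup>2 = (LINT \<zeta>|?M. rep f \<zeta> \<bullet> rep f \<zeta>)" for f :: "('k^'n) l2"
    unfolding power2_norm_eq_inner restr_def by (rule emb_inner[OF rep_L2 rep_L2])
  have "(LINT \<zeta>|?M. (H t \<zeta> *v rep f \<zeta>) \<bullet> rep g \<zeta>) = (LINT \<zeta>|?M. (H t \<zeta> *v rep g \<zeta>) \<bullet> rep f \<zeta>)"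
  proof (rule integral_cong_AE)
    show "AE \<zeta> in ?M. (H t \<zeta> *v rep f \<zeta>) \<bullet> rep g \<zeta> = (H t \<zeta> *v rep g \<zeta>) \<bullet> rep f \<zeta>"
      using H_bounds[OF t]
    proof eventually_elim
      case (elim \<zeta>)
      then show ?case using inner_ctranspose[of "H t \<zeta>" "rep f \<zeta>" "rep g \<zeta>"] by (simp add: inner_commute)
    qed
  qed (use int in auto)
  then show "Hop t f \<bullet> g = f \<bullet> Hop t g"
    unfolding inner_commute[of f] Hop_inner[OF t] by (simp add: inner_commute)
  have "(LINT \<zeta>|?M. m * (rep f \<zeta> \<bullet> rep f \<zeta>)) \<le> (LINT \<zeta>|?M. (H t \<zeta> *v rep f \<zeta>) \<bullet> rep f \<zeta>)"
  proof (rule integral_mono_AE)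
    show "AE \<zeta> in ?M. m * (rep f \<zeta> \<bullet> rep f \<zeta>) \<le> (H t \<zeta> *v rep f \<zeta>) \<bullet> rep f \<zeta>"
      using H_bounds[OF t]
    proof eventually_elim
      case (elim \<zeta>)
      then show ?case using loewner_leD[of "mat (of_real m)" "H t \<zeta>" "rep f \<zeta>"]
        by (simp add: mat_of_real_vector inner_commute)
    qed
  qed (use int int2 in auto)
  then show "m * (norm f)\<^sup>2 \<le> Hop t f \<bullet> f"
    unfolding Hop_inner[OF t] norm_split[of f a b] norm_restr by (simp add: distrib_left power2_norm_eq_inner)
  have "(LINT \<zeta>|?M. (H t \<zeta> *v rep f \<zeta>) \<bullet> rep f \<zeta>) \<le> (LINT \<zeta>|?M. M * (rep f \<zeta> \<bullet> rep f \<zeta>))"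
  proof (rule integral_mono_AE)
    show "AE \<zeta> in ?M. (H t \<zeta> *v rep f \<zeta>) \<bullet> rep f \<zeta> \<le> M * (rep f \<zeta> \<bullet> rep f \<zeta>)"
      using H_bounds[OF t]
    proof eventually_elim
      case (elim \<zeta>)
      then show ?case using loewner_leD[of "H t \<zeta>" "mat (of_real M)" "rep f \<zeta>"]
        by (simp add: mat_of_real_vector inner_commute)
    qed
  qed (use int int2 in auto)
  moreover have "m * (norm (f - restr a b f))\<^sup>2 \<le> M * (norm (f - restr a b f))\<^sup>2"
    by (rule mult_right_mono[OF m_le_M]) simp
  ultimately show "Hop t f \<bullet> f \<le> M * (norm f)\<^sup>2"
    unfolding Hop_inner[OF t] norm_split[of f a b] norm_restr by (simp add: distrib_left power2_norm_eq_inner)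
qed

sublocale evo: hamiltonian_evolution D "\<lambda>f. A f" m M Hop "\<lambda>t. mult_op a b (Hd t)" "\<lambda>t. mult_op a b (Hdd t)"
  "\<lambda>t. mult_op a b (K t)" "\<lambda>t. mult_op a b (Kd t)"
proof
  fix t :: real assume t: "0 \<le> t"
  then have t': "t \<in> {0..}" by simp
  have "(Hop has_vector_derivative mult_op a b (Hd t) + 0) (at t within {0..})"
    unfolding Hop_def[abs_def]
    by (rule has_vector_derivative_add[OF mult_op_has_derivative[OF ab H_C1 t'] has_vector_derivative_const])
  then show "(Hop has_vector_derivative mult_op a b (Hd t)) (at t within {0..})" by simp
  show "((\<lambda>t. mult_op a b (Hd t)) has_vector_derivative mult_op a b (Hdd t)) (at t within {0..})"
    by (rule mult_op_has_derivative[OF ab Hd_C1 t'])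
  show "((\<lambda>t. mult_op a b (K t)) has_vector_derivative mult_op a b (Kd t)) (at t within {0..})"
    by (rule mult_op_has_derivative[OF ab K_C1 t'])
qed (use m M Hop_sym Hop_lower Hop_upper Hd_C1 K_C1 in
    \<open>auto intro!: mult_op_continuous[OF ab] simp: C1_into_def\<close>)

end

section \<open>Classical solutions\<close>

lemma L2_norm_nonneg: "0 \<le> L2_norm a b x"
  by (simp add: L2_norm_def)

lemma norm_L2_norm: "norm (L2_norm a b x) = L2_norm a b x"
  by (simp add: L2_norm_def)

context port_hamiltonian_system
begin

abbreviation "domH \<equiv> dom_At a b W H"
abbreviation "opH \<equiv> op_At a b P0 P1 H K"

lemma dom_iff:
  assumes t: "0 \<le> t" shows "u \<in> domH t \<longleftrightarrow> u \<in> L2 a b \<and> Hop t (emb a b u) \<in> D"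
proof (cases "u \<in> L2 a b")
  case True
  note Hu = HL2[OF t True]
  have ae: "eq_ae a b (rep (Hop t (emb a b u))) (\<lambda>\<zeta>. H t \<zeta> *v u \<zeta>)"
    unfolding Hop_emb[OF t True] by (rule rep_emb[OF Hu])
  show ?thesis
    using True dom_A_cong[OF _ Hu ae] dom_A_cong[OF _ rep_L2 eq_ae_sym[OF ae]]
    unfolding dom_At_def by blast
qed (simp add: dom_At_def)

lemma dom_rep:
  assumes t: "0 \<le> t" and f: "Hop t f \<in> D" shows "rep f \<in> domH t"
proof -
  have "(\<lambda>\<zeta>. H t \<zeta> *v rep f \<zeta>) \<in> dom_A a b W"
    using f dom_A_cong[OF _ HL2[OF t rep_L2] rep_Hop[OF t]] by blast
  then show ?thesis by (simp add: dom_At_def rep_L2)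
qed

lemma op_emb:
  assumes t: "0 \<le> t" and u: "u \<in> domH t"
  shows op_L2: "opH t u \<in> L2 a b"
    and emb_op: "emb a b (opH t u) = A (Hop t (emb a b u)) + mult_op a b (K t) (emb a b u)"
proof -
  have uL: "u \<in> L2 a b" and Hu: "(\<lambda>\<zeta>. H t \<zeta> *v u \<zeta>) \<in> dom_A a b W" using u by (simp_all add: dom_At_def)
  obtain g d where gd: "ac_rep a b (\<lambda>\<zeta>. H t \<zeta> *v u \<zeta>) g d" "W *v stack (g b) (g a) = 0"
    using Hu by (rule dom_A_ac_rep)
  note L = op_A_L2[OF HL2[OF t uL] gd(1)] L2_mult(1)[OF ab K_Linf[OF t] uL]
  show "opH t u \<in> L2 a b" unfolding op_At_def by (rule L2_add[OF L])
  have "emb a b (op_A a b P0 P1 (\<lambda>\<zeta>. H t \<zeta> *v u \<zeta>)) = A (Hop t (emb a b u))"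
    unfolding Hop_emb[OF t uL] by (rule op_A_cong[OF Hu rep_L2 eq_ae_sym[OF rep_emb[OF HL2[OF t uL]]]])
  then show "emb a b (opH t u) = A (Hop t (emb a b u)) + mult_op a b (K t) (emb a b u)"
    unfolding op_At_def by (simp add: emb_add L mult_op_emb[OF ab K_Linf[OF t] uL])
qed

lemma emb_diff_quotient:
  assumes "u \<in> L2 a b" "v \<in> L2 a b" "w \<in> L2 a b"
  shows "(\<lambda>\<zeta>. (u \<zeta> - v \<zeta>) /\<^sub>R c - w \<zeta>) \<in> L2 a b"
    and "emb a b (\<lambda>\<zeta>. (u \<zeta> - v \<zeta>) /\<^sub>R c - w \<zeta>) = (emb a b u - emb a b v) /\<^sub>R c - emb a b w"
  using assms by (simp_all add: L2_diff L2_scaleR emb_diff emb_scaleR)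

lemma classical_solution_L2:
  assumes "classical_solution a b domH opH s x u" "s \<le> t"
  shows "u t \<in> L2 a b" "u t \<in> domH t"
  using assms by (auto simp: classical_solution_def continuous_into_def)

lemma classical_imp_solves:
  assumes s: "0 \<le> s" and u: "classical_solution a b domH opH s x u"
  shows "evo.solves s (\<lambda>t. emb a b (u t))"
  unfolding evo.solves_def
proof (intro conjI allI impI)
  note uL = classical_solution_L2(1)[OF u] and uD = classical_solution_L2(2)[OF u]
  show "continuous_on {s..} (\<lambda>t. emb a b (u t))"
    unfolding continuous_on_def
  proof
    fix t assume t: "t \<in> {s..}"
    have "((\<lambda>r. L2_norm a b (\<lambda>\<zeta>. u r \<zeta> - u t \<zeta>)) \<longlongrightarrow> 0) (at t within {s..})"
      using u t by (auto simp: classical_solution_def continuous_into_def)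
    moreover have "\<forall>\<^sub>F r in at t within {s..}. norm (emb a b (u r) - emb a b (u t)) \<le> L2_norm a b (\<lambda>\<zeta>. u r \<zeta> - u t \<zeta>)"
      unfolding eventually_at_filter
      using t by (intro always_eventually) (auto simp: emb_diff[symmetric] norm_emb L2_diff uL)
    ultimately have "((\<lambda>r. emb a b (u r) - emb a b (u t)) \<longlongrightarrow> 0) (at t within {s..})"
      by (rule Lim_null_comparison[rotated])
    then show "((\<lambda>t. emb a b (u t)) \<longlongrightarrow> emb a b (u t)) (at t within {s..})" by (rule LIM_zero_cancel)
  qed
  show "Hop t (emb a b (u t)) \<in> D" if "s \<le> t" for t
    using uD[OF that] dom_iff[of t "u t"] s that by simp
  fix t assume t: "s < t"
  then have t0: "0 \<le> t" using s by simp
  obtain u' where u': "C1_into (L2 a b) (L2_norm a b) {s<..} u u'" "\<And>t. s < t \<Longrightarrow> eq_ae a b (u' t) (opH t (u t))"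
    using u by (auto simp: classical_solution_def)
  have u'L: "u' t \<in> L2 a b" using u'(1) t by (auto simp: C1_into_def continuous_into_def)
  have "((\<lambda>r. L2_norm a b (\<lambda>\<zeta>. (u r \<zeta> - u t \<zeta>) /\<^sub>R (r - t) - u' t \<zeta>)) \<longlongrightarrow> 0) (at t within {s<..})"
    using u'(1) t by (auto simp: C1_into_def)
  moreover have "\<forall>\<^sub>F r in at t within {s<..}.
     norm (norm ((emb a b (u r) - emb a b (u t)) /\<^sub>R (r - t) - emb a b (u' t)))
       \<le> L2_norm a b (\<lambda>\<zeta>. (u r \<zeta> - u t \<zeta>) /\<^sub>R (r - t) - u' t \<zeta>)"
    unfolding eventually_at_filter
    using t by (intro always_eventually)
      (auto simp: emb_diff_quotient(2)[symmetric] norm_emb emb_diff_quotient(1) uL u'L L2_norm_nonneg)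
  ultimately have "((\<lambda>t. emb a b (u t)) has_vector_derivative emb a b (u' t)) (at t within {s<..})"
    unfolding has_vector_derivative_iff_norm_tendsto by (rule Lim_null_comparison[rotated])
  moreover have "at t within {s<..} = at t" using t by (intro at_within_open) auto
  moreover have "emb a b (u' t) = emb a b (opH t (u t))"
    using t by (intro emb_cong u'L op_L2 t0 uD u'(2)) auto
  ultimately show "((\<lambda>t. emb a b (u t)) has_vector_derivative
      A (Hop t (emb a b (u t))) + mult_op a b (K t) (emb a b (u t))) (at t)"
    using emb_op[OF t0 uD[of t]] t by simp
qed

lemma solves_imp_classical:
  assumes s: "0 \<le> s" and v: "evo.solves s v" and x: "x \<in> L2 a b" "v s = emb a b x"
    and cont: "continuous_on {s..} (\<lambda>t. A (Hop t (v t)) + mult_op a b (K t) (v t))"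
  shows "classical_solution a b domH opH s x (\<lambda>t. rep (v t))"
  unfolding classical_solution_def
proof (intro conjI allI impI exI)
  define v' where "v' t = A (Hop t (v t)) + mult_op a b (K t) (v t)" for t
  have into: "continuous_into (L2 a b) (L2_norm a b) S (\<lambda>t. rep (f t))" if f: "continuous_on S f" for S and f :: "real \<Rightarrow> ('k^'n) l2"
    unfolding continuous_into_def
  proof (intro conjI ballI rep_L2)
    fix t assume "t \<in> S"
    then have "(f \<longlongrightarrow> f t) (at t within S)" using f by (auto simp: continuous_on_def)
    then have "((\<lambda>r. norm (f r - f t)) \<longlongrightarrow> 0) (at t within S)" by (simp add: LIM_zero_iff tendsto_norm_zero_iff)
    then show "((\<lambda>r. L2_norm a b (\<lambda>\<zeta>. rep (f r) \<zeta> - rep (f t) \<zeta>)) \<longlongrightarrow> 0) (at t within S)"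
      by (rule Lim_null_comparison[rotated])
        (intro always_eventually allI, unfold norm_L2_norm, rule L2_norm_diff_rep)
  qed
  show "continuous_into (L2 a b) (L2_norm a b) {s..} (\<lambda>t. rep (v t))"
    using v by (intro into) (simp add: evo.solves_def)
  have vD: "rep (v t) \<in> domH t" if "s \<le> t" for t
    using v that s by (intro dom_rep) (auto simp: evo.solves_def)
  then show "rep (v t) \<in> domH t" if "s \<le> t" for t using that .
  have "eq_ae a b (rep (v s)) (rep (emb a b x))" by (simp add: x(2) eq_ae_def)
  from eq_ae_trans[OF this rep_emb[OF x(1)]] show "eq_ae a b (rep (v s)) x" .
  show "C1_into (L2 a b) (L2_norm a b) {s<..} (\<lambda>t. rep (v t)) (\<lambda>t. rep (v' t))"
    unfolding C1_into_def
  proof (intro conjI ballI rep_L2)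
    show "continuous_into (L2 a b) (L2_norm a b) {s<..} (\<lambda>t. rep (v' t))"
      unfolding v'_def by (rule into[OF continuous_on_subset[OF cont]]) auto
    fix t assume t: "t \<in> {s<..}"
    have "(v has_vector_derivative v' t) (at t within {s<..})"
      by (rule has_vector_derivative_at_within) (use v t in \<open>simp add: v'_def evo.solves_def\<close>)
    then have lim: "((\<lambda>r. norm ((v r - v t) /\<^sub>R (r - t) - v' t)) \<longlongrightarrow> 0) (at t within {s<..})"
      unfolding has_vector_derivative_iff_norm_tendsto .
    have le: "L2_norm a b (\<lambda>\<zeta>. (rep (v r) \<zeta> - rep (v t) \<zeta>) /\<^sub>R (r - t) - rep (v' t) \<zeta>)
        \<le> norm ((v r - v t) /\<^sub>R (r - t) - v' t)" for r
    proof -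
      have "L2_norm a b (\<lambda>\<zeta>. (rep (v r) \<zeta> - rep (v t) \<zeta>) /\<^sub>R (r - t) - rep (v' t) \<zeta>)
          = norm (restr a b ((v r - v t) /\<^sub>R (r - t) - v' t))"
        unfolding norm_emb[OF emb_diff_quotient(1)[OF rep_L2 rep_L2 rep_L2], symmetric]
          emb_diff_quotient(2)[OF rep_L2 rep_L2 rep_L2] restr_diff restr_scaleR
        unfolding restr_def ..
      then show ?thesis by (simp add: norm_restr_le)
    qed
    show "((\<lambda>r. L2_norm a b (\<lambda>\<zeta>. (rep (v r) \<zeta> - rep (v t) \<zeta>) /\<^sub>R (r - t) - rep (v' t) \<zeta>)) \<longlongrightarrow> 0) (at t within {s<..})"
      by (rule tendsto_sandwich[OF always_eventually always_eventually tendsto_const lim]) (simp_all add: L2_norm_nonneg le)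
  qed
  fix t assume t: "s < t"
  then have t0: "0 \<le> t" using s by simp
  have Hv: "Hop t (v t) \<in> D" using v t by (simp add: evo.solves_def)
  have uD: "rep (v t) \<in> domH t" using vD t by simp
  have "emb a b (opH t (rep (v t))) = v' t"
  proof -
    have "A (Hop t (emb a b (rep (v t)))) = A (Hop t (v t))"
    proof (rule op_A_cong)
      show "rep (Hop t (emb a b (rep (v t)))) \<in> dom_A a b W" using uD dom_iff[OF t0] by simp
      show "eq_ae a b (rep (Hop t (emb a b (rep (v t))))) (rep (Hop t (v t)))"
        unfolding Hop_emb[OF t0 rep_L2]
        by (rule eq_ae_trans[OF rep_emb[OF HL2[OF t0 rep_L2]] eq_ae_sym[OF rep_Hop[OF t0]]])
    qed (rule rep_L2)
    moreover have "mult_op a b (K t) (emb a b (rep (v t))) = mult_op a b (K t) (v t)"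
      by (rule trans[OF mult_op_emb[OF ab K_Linf[OF t0] rep_L2] mult_op_apply[OF ab K_Linf[OF t0], symmetric]])
    ultimately show ?thesis by (simp add: emb_op[OF t0 uD] v'_def)
  qed
  then show "eq_ae a b (rep (v' t)) (opH t (rep (v t)))"
    using rep_emb[OF op_L2[OF t0 uD]] by simp
qed

lemma regularity_space_eq: "regularity_space a b W H = domH"
  by (rule ext) (auto simp: regularity_space_def dom_At_def dom_A_def)

text \<open>
  The domain at time \<open>t\<close> is the inverse image of the dense domain of \<open>A\<close> under the isomorphism \<open>Hop t\<close>.
\<close>

lemma dense_subspace_dom:
  assumes t: "0 \<le> t" shows "dense_subspace a b (domH t)"
  unfolding dense_subspace_def
proof (intro conjI ballI allI impI)
  have dom_eq: "x \<in> domH t \<longleftrightarrow> x \<in> L2 a b \<and> (\<lambda>\<zeta>. H t \<zeta> *v x \<zeta>) \<in> dom_A a b W" for x by (simp add: dom_At_def)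
  show "domH t \<subseteq> L2 a b" by (auto simp: dom_eq)
  show "y \<in> domH t" if "x \<in> domH t" "y \<in> L2 a b" "eq_ae a b x y" for x y
    using that dom_A_cong[OF _ HL2[OF t that(2)] eq_ae_mult[OF that(3)]] by (simp add: dom_eq)
  show "(\<lambda>\<zeta>. 0) \<in> domH t" using dom_A_0 by (simp add: dom_eq L2_0)
  show "(\<lambda>\<zeta>. x \<zeta> + y \<zeta>) \<in> domH t" if "x \<in> domH t" "y \<in> domH t" for x y
    using that dom_A_add[of "\<lambda>\<zeta>. H t \<zeta> *v x \<zeta>" "\<lambda>\<zeta>. H t \<zeta> *v y \<zeta>"]
    by (simp add: dom_eq L2_add matrix_vector_right_distrib)
  show "(\<lambda>\<zeta>. c *s x \<zeta>) \<in> domH t" if "x \<in> domH t" for c x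
    using that dom_A_smult[of "\<lambda>\<zeta>. H t \<zeta> *v x \<zeta>" c]
    by (simp add: dom_eq vector_scalar_commute L2_linear[OF linear_smult])
  fix x :: "real \<Rightarrow> 'k^'n" and \<epsilon> :: real assume x: "x \<in> L2 a b" and \<epsilon>: "0 < \<epsilon>"
  have "0 < \<epsilon> * m" using \<epsilon> m by simp
  from A.D_dense[OF this] obtain y where y: "y \<in> D" "norm (y - Hop t (emb a b x)) < \<epsilon> * m" by blast
  define f where "f = evo.G t y"
  have "Hop t f \<in> D" using y(1) by (simp add: f_def evo.HG[OF t])
  then have fD: "rep f \<in> domH t" by (rule dom_rep[OF t])
  have "L2_norm a b (\<lambda>\<zeta>. x \<zeta> - rep f \<zeta>) = norm (restr a b (emb a b x - f))"
    using x by (simp add: norm_emb[symmetric] L2_diff rep_L2 emb_diff restr_diff restr_emb) (simp add: restr_def)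
  also have "\<dots> \<le> norm (emb a b x - f)" by (rule norm_restr_le)
  also have "emb a b x - f = - evo.G t (y - Hop t (emb a b x))"
    by (simp add: f_def blinfun.diff_right evo.GH[OF t])
  also have "norm \<dots> \<le> norm (evo.G t) * norm (y - Hop t (emb a b x))" by (simp add: norm_blinfun)
  also have "\<dots> \<le> (1 / m) * norm (y - Hop t (emb a b x))" by (intro mult_right_mono evo.norm_G t) simp
  also have "\<dots> < (1 / m) * (\<epsilon> * m)" using y(2) m by (intro mult_strict_left_mono) auto
  also have "\<dots> = \<epsilon>" using m by simp
  finally show "\<exists>y\<in>domH t. L2_norm a b (\<lambda>\<zeta>. x \<zeta> - y \<zeta>) < \<epsilon>" using fD by blast
qed

lemma well_posed: "C1_well_posed a b domH opH domH"
  unfolding C1_well_posed_def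
proof (intro conjI)
  show "\<forall>t\<ge>0. dense_subspace a b (domH t) \<and> domH t \<subseteq> domH t" using dense_subspace_dom by simp
  show "\<forall>s\<ge>0. \<forall>x\<in>domH s. (\<exists>u. classical_solution a b domH opH s x u) \<and>
        (\<forall>u v. classical_solution a b domH opH s x u \<and> classical_solution a b domH opH s x v \<longrightarrow> (\<forall>t\<ge>s. eq_ae a b (u t) (v t))) \<and>
        (\<forall>u. classical_solution a b domH opH s x u \<longrightarrow> (\<forall>t\<ge>s. u t \<in> domH t))"
  proof (intro allI impI ballI conjI)
    fix s x assume s: "(0::real) \<le> s" and x: "x \<in> domH s"
    have xL: "x \<in> L2 a b" and xD: "Hop s (emb a b x) \<in> D" using x dom_iff[OF s] by auto
    obtain v where v: "evo.solves s v" "v s = emb a b x"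
      "continuous_on {s..} (\<lambda>t. A (Hop t (v t)) + mult_op a b (K t) (v t))"
    proof (rule evo.global_solution[OF s xD]) qed (rule that)
    from solves_imp_classical[OF s v(1) xL v(2,3)] show "\<exists>u. classical_solution a b domH opH s x u" by blast
    show "u t \<in> domH t" if "classical_solution a b domH opH s x u" "s \<le> t" for u t
      using classical_solution_L2(2)[OF that] .
    fix u v t assume uv: "classical_solution a b domH opH s x u \<and> classical_solution a b domH opH s x v" and t: "s \<le> t"
    then have u: "classical_solution a b domH opH s x u" and v: "classical_solution a b domH opH s x v" by auto
    have "eq_ae a b (u s) (v s)"
      using u v unfolding classical_solution_def by (meson eq_ae_trans eq_ae_sym)
    then have "emb a b (u s) = emb a b (v s)"
      by (intro emb_cong classical_solution_L2(1)[OF u] classical_solution_L2(1)[OF v]) auto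
    then have "emb a b (u t) = emb a b (v t)"
      by (rule evo.solves_unique[OF s t classical_imp_solves[OF s u] classical_imp_solves[OF s v]])
    then show "eq_ae a b (u t) (v t)"
      using emb_eq_iff[OF classical_solution_L2(1)[OF u t] classical_solution_L2(1)[OF v t]] by simp
  qed
  show "\<forall>sk xk uk s x u.
        (\<forall>k::nat. 0 \<le> sk k \<and> xk k \<in> domH (sk k) \<and> classical_solution a b domH opH (sk k) (xk k) (uk k)) \<and>
        0 \<le> s \<and> x \<in> domH s \<and> classical_solution a b domH opH s x u \<and>
        sk \<longlonglongrightarrow> s \<and> (\<lambda>k. L2_norm a b (\<lambda>\<zeta>. xk k \<zeta> - x \<zeta>)) \<longlonglongrightarrow> 0 \<longrightarrow>
        (\<forall>C. compact C \<and> C \<subseteq> {0..} \<longrightarrow>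
           uniform_limit C
             (\<lambda>k t. L2_norm a b (\<lambda>\<zeta>. extend_back (sk k) (xk k) (uk k) t \<zeta> - extend_back s x u t \<zeta>))
             (\<lambda>t. 0) sequentially)"
  proof (intro allI impI, elim conjE)
    fix sk xk uk s x u and C :: "real set"
    assume K: "\<forall>k::nat. 0 \<le> sk k \<and> xk k \<in> domH (sk k) \<and> classical_solution a b domH opH (sk k) (xk k) (uk k)"
      and s: "0 \<le> s" and x: "x \<in> domH s" and u: "classical_solution a b domH opH s x u"
      and sk: "sk \<longlonglongrightarrow> s" and xk: "(\<lambda>k. L2_norm a b (\<lambda>\<zeta>. xk k \<zeta> - x \<zeta>)) \<longlonglongrightarrow> 0"
      and C: "compact C" "C \<subseteq> {0..}"
    have k: "0 \<le> sk k" "xk k \<in> L2 a b" "classical_solution a b domH opH (sk k) (xk k) (uk k)" for k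
      using K by (auto simp: dom_At_def)
    have xL: "x \<in> L2 a b" using x by (simp add: dom_At_def)
    obtain T where T: "C \<subseteq> {0..T}"
    proof -
      obtain T where "\<And>t. t \<in> C \<Longrightarrow> t \<le> T"
        using bounded_imp_bdd_above[OF compact_imp_bounded, OF C(1)] by (auto simp: bdd_above_def)
      then show ?thesis using C(2) by (intro that[of T]) auto
    qed
    have start: "emb a b (u s) = emb a b x" if "classical_solution a b domH opH s x u" "x \<in> L2 a b" for s x u
      using that by (intro emb_cong classical_solution_L2(1)[OF that(1)]) (auto simp: classical_solution_def)
    have ext: "emb a b (extend_back s x u t) = (if s \<le> t then emb a b (u t) else emb a b (u s))"
      "extend_back s x u t \<in> L2 a b"
      if "classical_solution a b domH opH s x u" "x \<in> L2 a b" for s x u t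
      using that start[OF that] classical_solution_L2(1)[OF that(1), of t] by (auto simp: extend_back_def)
    have "(\<lambda>k. norm (emb a b (xk k) - emb a b x)) \<longlonglongrightarrow> 0"
      using xk by (simp add: emb_diff[symmetric] k xL norm_emb L2_diff)
    then have lim: "(\<lambda>k. emb a b (uk k (sk k))) \<longlonglongrightarrow> emb a b (u s)"
      by (simp add: start[OF k(3,2)] start[OF u xL] tendsto_norm_zero_iff LIM_zero_iff)
    show "uniform_limit C
             (\<lambda>k t. L2_norm a b (\<lambda>\<zeta>. extend_back (sk k) (xk k) (uk k) t \<zeta> - extend_back s x u t \<zeta>))
             (\<lambda>t. 0) sequentially"
    proof (rule uniform_limitI)
      fix e :: real assume "0 < e"
      from evo.continuous_dependence[OF k(1) classical_imp_solves[OF k(1,3)] s classical_imp_solves[OF s u] sk lim this, of T]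
      show "\<forall>\<^sub>F k in sequentially. \<forall>t\<in>C. dist (L2_norm a b (\<lambda>\<zeta>. extend_back (sk k) (xk k) (uk k) t \<zeta> - extend_back s x u t \<zeta>)) 0 < e"
      proof eventually_elim
        case (elim k)
        show ?case
        proof
          fix t assume "t \<in> C"
          then have "t \<in> {0..T}" using T by auto
          from bspec[OF elim this] show "dist (L2_norm a b (\<lambda>\<zeta>. extend_back (sk k) (xk k) (uk k) t \<zeta> - extend_back s x u t \<zeta>)) 0 < e"
            by (simp add: norm_emb[symmetric] ext(2)[OF k(3,2)] ext(2)[OF u xL] L2_diff emb_diff ext(1)[OF k(3,2)] ext(1)[OF u xL])
        qed
      qed
    qed
  qed
qed

lemma energy_norm_eq:
  assumes t: "0 \<le> t" and x: "x \<in> L2 a b"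
  shows "energy_norm a b H t x = sqrt (Hop t (emb a b x) \<bullet> emb a b x)"
  unfolding energy_norm_def Hop_emb[OF t x] emb_inner[OF HL2[OF t x] x] by (simp add: inner_commute)

lemma energy_nonneg:
  assumes "0 \<le> t" shows "0 \<le> Hop t f \<bullet> f"
  by (rule order_trans[OF _ Hop_lower[OF assms]]) (simp add: m less_imp_le)

lemma Hd_continuous_into: "continuous_into (Linf a b) (Linf_norm a b) {0..} Hd"
  using H_C1 by (simp add: C1_into_def)

lemma K_continuous_into: "continuous_into (Linf a b) (Linf_norm a b) {0..} K"
  by (rule C1_into_imp_continuous_into[OF ab K_C1])

lemma growth_rate_nonneg:
  assumes T: "0 \<le> T"
  shows "0 \<le> ((SUP t\<in>{0..T}. Linf_norm a b (Hd t)) + 2 * M * (SUP t\<in>{0..T}. Linf_norm a b (K t))) / m"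
proof -
  have "0 \<le> (SUP t\<in>{0..T}. Linf_norm a b (F t))" if "continuous_into (Linf a b) (Linf_norm a b) {0..} F"
    for F :: "real \<Rightarrow> real \<Rightarrow> 'k^'n^'n"
    using Linf_norm_nonneg[OF ab, of "F 0"] Linf_norm_le_SUP[OF ab that order_refl T] by linarith
  from this[OF Hd_continuous_into] this[OF K_continuous_into] m M show ?thesis by simp
qed

lemma energy_growth:
  assumes r: "0 \<le> r" and u: "classical_solution a b domH opH r x0 u" and st: "r \<le> s" "s \<le> t" "t \<le> T"
  shows "(energy_norm a b H t (u t))\<^sup>2 \<le>
    exp (((SUP t\<in>{0..T}. Linf_norm a b (Hd t)) + 2 * M * (SUP t\<in>{0..T}. Linf_norm a b (K t))) / m * (t - s))
      * (energy_norm a b H s (u s))\<^sup>2"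
proof -
  note h = Linf_norm_le_SUP[OF ab Hd_continuous_into] and k = Linf_norm_le_SUP[OF ab K_continuous_into]
  have "Hop t (emb a b (u t)) \<bullet> emb a b (u t) \<le>
    exp (((SUP t\<in>{0..T}. Linf_norm a b (Hd t)) + 2 * M * (SUP t\<in>{0..T}. Linf_norm a b (K t))) / m * (t - s))
      * (Hop s (emb a b (u s)) \<bullet> emb a b (u s))"
  proof (rule evo.energy_exponential_bound[OF classical_imp_solves[OF r u] r st(1,2)])
    fix q assume "q \<in> {s..t}"
    then have q: "0 \<le> q" "q \<le> T" using r st by auto
    show "norm (mult_op a b (Hd q)) \<le> (SUP t\<in>{0..T}. Linf_norm a b (Hd t))"
      using norm_mult_op[OF ab Hd_Linf[OF q(1)]] h[OF q] by linarith
    show "norm (mult_op a b (K q)) \<le> (SUP t\<in>{0..T}. Linf_norm a b (K t))"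
      using norm_mult_op[OF ab K_Linf[OF q(1)]] k[OF q] by linarith
  qed
  then show ?thesis
    using r st classical_solution_L2(1)[OF u]
    by (simp add: energy_norm_eq energy_nonneg)
qed

lemma energy_rate_nonpos:
  assumes t: "0 \<le> t"
    and le: "AE \<zeta> in lebesgue_on {a..b}. loewner_le (H t \<zeta> ** K t \<zeta> + ctranspose (K t \<zeta>) ** H t \<zeta> + Hd t \<zeta>) 0"
  shows "2 * (Hop t f \<bullet> mult_op a b (K t) f) + mult_op a b (Hd t) f \<bullet> f \<le> 0"
proof -
  let ?M = "lebesgue_on {a..b}"
  note KL = L2_mult(1)[OF ab K_Linf[OF t] rep_L2[of f]] and HdL = L2_mult(1)[OF ab Hd_Linf[OF t] rep_L2[of f]]
  have rH: "restr a b (Hop t f) = emb a b (\<lambda>\<zeta>. H t \<zeta> *v rep f \<zeta>)"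
    unfolding restr_def by (rule emb_cong[OF rep_L2 HL2[OF t rep_L2] rep_Hop[OF t]])
  have "Hop t f \<bullet> mult_op a b (K t) f = emb a b (\<lambda>\<zeta>. K t \<zeta> *v rep f \<zeta>) \<bullet> restr a b (Hop t f)"
    unfolding mult_op_apply[OF ab K_Linf[OF t]] inner_commute[of "Hop t f"] by (rule inner_emb_left[OF KL])
  then have 1: "Hop t f \<bullet> mult_op a b (K t) f = (LINT \<zeta>|?M. (K t \<zeta> *v rep f \<zeta>) \<bullet> (H t \<zeta> *v rep f \<zeta>))"
    unfolding rH emb_inner[OF KL HL2[OF t rep_L2]] .
  have "mult_op a b (Hd t) f \<bullet> f = emb a b (\<lambda>\<zeta>. Hd t \<zeta> *v rep f \<zeta>) \<bullet> restr a b f"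
    unfolding mult_op_apply[OF ab Hd_Linf[OF t]] by (rule inner_emb_left[OF HdL])
  then have 2: "mult_op a b (Hd t) f \<bullet> f = (LINT \<zeta>|?M. (Hd t \<zeta> *v rep f \<zeta>) \<bullet> rep f \<zeta>)"
    unfolding restr_def emb_inner[OF HdL rep_L2] .
  note i1 = L2_inner_integrable[OF KL HL2[OF t rep_L2[of f]]] and i2 = L2_inner_integrable[OF HdL rep_L2[of f]]
  have "2 * (Hop t f \<bullet> mult_op a b (K t) f) + mult_op a b (Hd t) f \<bullet> f
      = (LINT \<zeta>|?M. 2 * ((K t \<zeta> *v rep f \<zeta>) \<bullet> (H t \<zeta> *v rep f \<zeta>)) + (Hd t \<zeta> *v rep f \<zeta>) \<bullet> rep f \<zeta>)"
    unfolding 1 2 using i1 i2 by simp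
  also have "\<dots> \<le> (LINT \<zeta>|?M. 0)"
  proof (rule integral_mono_AE)
    show "AE \<zeta> in ?M. 2 * ((K t \<zeta> *v rep f \<zeta>) \<bullet> (H t \<zeta> *v rep f \<zeta>)) + (Hd t \<zeta> *v rep f \<zeta>) \<bullet> rep f \<zeta> \<le> 0"
      using le H_bounds[OF t]
    proof eventually_elim
      case (elim \<zeta>)
      let ?x = "rep f \<zeta>"
      have "?x \<bullet> (H t \<zeta> *v (K t \<zeta> *v ?x)) = (K t \<zeta> *v ?x) \<bullet> (H t \<zeta> *v ?x)"
        using inner_ctranspose[of "H t \<zeta>" ?x "K t \<zeta> *v ?x"] elim(2) by (simp add: inner_commute)
      moreover have "?x \<bullet> (ctranspose (K t \<zeta>) *v (H t \<zeta> *v ?x)) = (K t \<zeta> *v ?x) \<bullet> (H t \<zeta> *v ?x)"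
        by (rule inner_ctranspose[symmetric])
      ultimately show ?case
        using loewner_leD[OF elim(1), of ?x]
        by (simp add: matrix_vector_mult_add_rdistrib inner_add_right matrix_vector_mul_assoc[symmetric] inner_commute)
    qed
  qed (use i1 i2 in auto)
  finally show ?thesis by simp
qed

lemma energy_decay:
  assumes r: "0 \<le> r" and u: "classical_solution a b domH opH r x0 u" and st: "r \<le> s" "s \<le> t"
    and le: "\<forall>t\<ge>0. AE \<zeta> in lebesgue_on {a..b}.
          loewner_le (H t \<zeta> ** K t \<zeta> + ctranspose (K t \<zeta>) ** H t \<zeta> + Hd t \<zeta>) 0"
  shows "energy_norm a b H t (u t) \<le> energy_norm a b H s (u s)"
proof -
  have "Hop t (emb a b (u t)) \<bullet> emb a b (u t) \<le> Hop s (emb a b (u s)) \<bullet> emb a b (u s)"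
    by (rule evo.energy_nonincreasing[OF classical_imp_solves[OF r u] r st])
      (use le energy_rate_nonpos in simp)
  then show ?thesis
    using r st classical_solution_L2(1)[OF u] by (simp add: energy_norm_eq)
qed

end

text \<open>
  The rate \<open>(h + 2 M k) / m\<close>, with bounds \<open>h\<close> for the derivative of \<open>H\<close> and \<open>k\<close> for \<open>K\<close>, compares the power
  \<open>(H' x | x) + 2 Re (H x | K x) \<le> (h + 2 M k) |x|\<^sup>2\<close> with the energy \<open>(H x | x) \<ge> m |x|\<^sup>2\<close>.
\<close>

theorem theorem3p3:
  fixes M :: real
  shows "\<exists>c :: real \<Rightarrow> real \<Rightarrow> real \<Rightarrow> real.
    \<forall>a b (P0 :: 'k::real_or_complex^'n^'n) (P1 :: 'k^'n^'n) (W :: 'k^('n + 'n)^'n)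
      (H :: real \<Rightarrow> real \<Rightarrow> 'k^'n^'n) Hd K m.
    port_hamiltonian a b P0 P1 W H Hd K m M \<longrightarrow>
      C1_well_posed a b (dom_At a b W H) (op_At a b P0 P1 H K) (regularity_space a b W H) \<and>
      (\<forall>T\<ge>0.
         let c\<^sub>T = c m (SUP t\<in>{0..T}. Linf_norm a b (Hd t)) (SUP t\<in>{0..T}. Linf_norm a b (K t)) in
         0 \<le> c\<^sub>T \<and>
         (\<forall>r\<ge>0. \<forall>x0 x. classical_solution a b (dom_At a b W H) (op_At a b P0 P1 H K) r x0 x \<longrightarrow>
            (\<forall>s t. r \<le> s \<and> s \<le> t \<and> t \<le> T \<longrightarrow>
               (energy_norm a b H t (x t))\<^sup>2 \<le> exp (c\<^sub>T * (t - s)) * (energy_norm a b H s (x s))\<^sup>2))) \<and>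
      ((\<forall>t\<ge>0. AE \<zeta> in lebesgue_on {a..b}.
          loewner_le (H t \<zeta> ** K t \<zeta> + ctranspose (K t \<zeta>) ** H t \<zeta> + Hd t \<zeta>) 0) \<longrightarrow>
       (\<forall>r\<ge>0. \<forall>x0 x. classical_solution a b (dom_At a b W H) (op_At a b P0 P1 H K) r x0 x \<longrightarrow>
          (\<forall>s t. r \<le> s \<and> s \<le> t \<longrightarrow>
             energy_norm a b H t (x t) \<le> energy_norm a b H s (x s))))"
proof (intro exI[of _ "\<lambda>m h k. (h + 2 * M * k) / m"] allI impI)
  fix a b and P0 P1 :: "'k^'n^'n" and W :: "'k^('n + 'n)^'n" and H Hd K :: "real \<Rightarrow> real \<Rightarrow> 'k^'n^'n" and m
  assume "port_hamiltonian a b P0 P1 W H Hd K m M"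
  then interpret port_hamiltonian_system a b P0 P1 W H Hd K m M by unfold_locales
  show "C1_well_posed a b domH opH (regularity_space a b W H) \<and>
      (\<forall>T\<ge>0.
         let c\<^sub>T = ((SUP t\<in>{0..T}. Linf_norm a b (Hd t)) + 2 * M * (SUP t\<in>{0..T}. Linf_norm a b (K t))) / m in
         0 \<le> c\<^sub>T \<and>
         (\<forall>r\<ge>0. \<forall>x0 x. classical_solution a b domH opH r x0 x \<longrightarrow>
            (\<forall>s t. r \<le> s \<and> s \<le> t \<and> t \<le> T \<longrightarrow>
               (energy_norm a b H t (x t))\<^sup>2 \<le> exp (c\<^sub>T * (t - s)) * (energy_norm a b H s (x s))\<^sup>2))) \<and>
      ((\<forall>t\<ge>0. AE \<zeta> in lebesgue_on {a..b}.
          loewner_le (H t \<zeta> ** K t \<zeta> + ctranspose (K t \<zeta>) ** H t \<zeta> + Hd t \<zeta>) 0) \<longrightarrow>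
       (\<forall>r\<ge>0. \<forall>x0 x. classical_solution a b domH opH r x0 x \<longrightarrow>
          (\<forall>s t. r \<le> s \<and> s \<le> t \<longrightarrow>
             energy_norm a b H t (x t) \<le> energy_norm a b H s (x s))))"
    unfolding Let_def regularity_space_eq
    by (intro conjI allI impI well_posed growth_rate_nonneg)
      (blast intro: energy_growth energy_decay)+
qed

end
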